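(* Let $X$ be the standard Brownian motion, and for $\epsilon>0$, $t\ge0$, $x\in\mathbb{R}$ put $$J_\epsilon(t,x)=\frac1\epsilon\int_0^t\left(\mathbf 1_{\{x<X_{s+\epsilon}\}}-\mathbf 1_{\{x<X_s\}}\right)(X_{s+\epsilon}-X_s)\,ds .$$ For all $T>0$, $x\in\mathbb{R}$ and $\delta\in(0,\frac12)$, there exists a constant $C$ such that $$\forall\epsilon\in(0,1],\qquad\left\|\sup_{t\in[0,T]}\left|J_\epsilon(t,x)-L_t^x(X)\right|\right\|_{L^2(\Omega)}\le C\,\epsilon^{\delta/2}.$$
   Context: $(L_t^x(X))_{x\in\mathbb{R},t\ge0}$ is the (continuous) local time family of Brownian motion, normalized by $\int_0^t g(X_s)\,ds=\int_{\mathbb{R}}g(x)L_t^x(X)\,dx$ for all non-negative Borel $g$. *)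

theory Defs
  imports "HOL-Probability.Probability"
begin

text \<open>The time index is \<^typ>\<open>real\<close>; only times \<open>t \<ge> 0\<close> are constrained.\<close>

locale std_brownian_motion = prob_space M
  for M :: "'a measure" and X :: "real \<Rightarrow> 'a \<Rightarrow> real" +
  assumes random_variable_X: "\<And>t. 0 \<le> t \<Longrightarrow> random_variable borel (X t)"
    and start_zero: "AE \<omega> in M. X 0 \<omega> = 0"
    and gaussian_increments: "\<And>s t. 0 \<le> s \<Longrightarrow> s < t \<Longrightarrow>
      distributed M lborel (\<lambda>\<omega>. X t \<omega> - X s \<omega>) (normal_density 0 (sqrt (t - s)))"
    and indep_increments: "\<And>(n::nat) (\<tau>::nat \<Rightarrow> real). 0 \<le> \<tau> 0 \<Longrightarrow> (\<And>i. i < n \<Longrightarrow> \<tau> i < \<tau> (Suc i)) \<Longrightarrow>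
      indep_vars (\<lambda>_. borel) (\<lambda>i \<omega>. X (\<tau> (Suc i)) \<omega> - X (\<tau> i) \<omega>) {..<n}"
    and continuous_paths: "AE \<omega> in M. continuous_on {0..} (\<lambda>t. X t \<omega>)"

text \<open>\<open>L t x\<close> is the local time of \<open>X\<close> at level \<open>x\<close> up to time \<open>t\<close>. Non-negativity is stated
  separately because \<^const>\<open>ennreal\<close> truncates negative values, so the occupation times formula
  alone would not exclude them.\<close>

definition local_time_family ::
    "'a measure \<Rightarrow> (real \<Rightarrow> 'a \<Rightarrow> real) \<Rightarrow> (real \<Rightarrow> real \<Rightarrow> 'a \<Rightarrow> real) \<Rightarrow> bool" where
  "local_time_family M X L \<longleftrightarrow>
     (\<forall>t\<ge>0. \<forall>x. L t x \<in> borel_measurable M) \<and>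
     (AE \<omega> in M.
        continuous_on ({0..} \<times> UNIV) (\<lambda>(t, x). L t x \<omega>) \<and>
        (\<forall>t\<ge>0. \<forall>x. 0 \<le> L t x \<omega>) \<and>
        (\<forall>t\<ge>0. \<forall>g :: real \<Rightarrow> ennreal. g \<in> borel_measurable borel \<longrightarrow>
           (\<integral>\<^sup>+ s\<in>{0..t}. g (X s \<omega>) \<partial>lborel) = (\<integral>\<^sup>+ x. g x * ennreal (L t x \<omega>) \<partial>lborel)))"

definition J :: "(real \<Rightarrow> 'a \<Rightarrow> real) \<Rightarrow> real \<Rightarrow> real \<Rightarrow> real \<Rightarrow> 'a \<Rightarrow> real" where
  "J X \<epsilon> t x \<omega> = 1 / \<epsilon> *
     (LINT s:{0..t}|lborel.
        (indicator {x<..} (X (s + \<epsilon>) \<omega>) - indicator {x<..} (X s \<omega>)) * (X (s + \<epsilon>) \<omega> - X s \<omega>))"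

text \<open>The norm is infinite for functions outside \<open>L\<^sup>2\<close>, including those that are not measurable.
  Measurability refers to the completion, since the suprema below are well behaved only on
  the almost sure event where the paths are continuous.\<close>

definition L2_norm :: "'a measure \<Rightarrow> ('a \<Rightarrow> ennreal) \<Rightarrow> ennreal" where
  "L2_norm M f =
     (let I = \<integral>\<^sup>+ \<omega>. (f \<omega>)\<^sup>2 \<partial>completion M in
      if f \<in> borel_measurable (completion M) \<and> I < \<infinity> then ennreal (sqrt (enn2real I)) else \<infinity>)"

end

theory Submission
  imports Defs
begin

text \<open>
Write \<open>f\<^sub>u = crossing x X\<^sub>u X\<^sub>u\<^sub>+\<^sub>\<epsilon> / \<epsilon>\<close>, so that \<open>J\<^sub>\<epsilon>(t, x)\<close> is the integral of \<open>f\<^sub>u \<ge> 0\<close> over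
\<open>[0, t]\<close>, and let \<open>g\<^sub>u\<close> be \<open>1/(2\<eta>)\<close> times the indicator of \<open>x - \<eta> < X\<^sub>u \<le> x + \<eta>\<close>. By the occupation
times formula and the continuity of \<open>L\<close> in space, \<open>L\<^sub>t\<close> is the limit of the integrals of \<open>g\<^sub>u\<close> over
\<open>[0, t]\<close> as \<open>\<eta> \<rightarrow> 0\<close>. The proof estimates the second moments of the integrals of the discrepancy
\<open>h\<^sub>u = f\<^sub>u - g\<^sub>u\<close>, uniformly in small \<open>\<eta>\<close>.

Let \<open>u + \<epsilon> < v\<close> and \<open>\<tau> = v - (u + \<epsilon>)\<close>. Given the path up to time \<open>u + \<epsilon>\<close>, the mean of \<open>f\<^sub>v\<close>
averages the Gaussian density of variance \<open>\<tau>\<close> against a probability kernel of width \<open>\<surd>\<epsilon>\<close> around \<open>x\<close>, and the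
mean of \<open>g\<^sub>v\<close> averages it over a window of half-width \<open>\<eta> \<le> \<surd>\<epsilon>\<close>. The density is bounded by \<open>1/\<surd>\<tau>\<close> and has
Lipschitz constant at most \<open>1/\<tau>\<close>, so the two means differ by at most \<open>min (1/\<surd>\<tau>) (3\<surd>\<epsilon>/\<tau>)\<close>
(\<open>discrepancy_mean_bound\<close>). If \<open>v < u + \<epsilon>\<close> there is no cancellation, but the times are so close that
bounds for \<open>E f\<^sub>u\<^sup>2\<close> and \<open>E g\<^sub>u g\<^sub>v\<close> are enough. Interpolating, for \<open>u < v\<close> and \<open>\<gamma> < 1/2\<close>, \<open>E h\<^sub>u h\<^sub>v\<close> is at most a constant times
\<open>\<epsilon>\<^sup>\<gamma> / \<surd>u\<close> times a kernel in \<open>v\<close> with two integrable singularities, at \<open>u\<close> and at \<open>u + \<epsilon>\<close>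
(\<open>discrepancy_covariance_bound\<close>). Integrating over \<open>s \<le> u, v \<le> t\<close> and letting \<open>\<eta> \<rightarrow> 0\<close> gives, for
\<open>D = J\<^sub>\<epsilon> - L\<close>, the bound \<open>E (D\<^sub>t - D\<^sub>s)\<^sup>2 \<le> C \<epsilon>\<^sup>\<gamma> (\<surd>t - \<surd>s)\<close> on \<open>[0, T]\<close> (\<open>second_moment_error_increment\<close>).

This bound is additive over adjacent intervals, so at each dyadic level the squared
increments of \<open>D\<close> sum up to \<open>O(\<epsilon>\<^sup>\<gamma>)\<close> in the mean. Reaching a point of level \<open>n\<close> takes one increment per
level (\<open>dyadic_chaining\<close>), so, as in the Rademacher-Menshov inequality, the maximum over a grid of
mesh \<open>T/2\<^sup>n \<le> \<epsilon>\<close> costs only the factor \<open>(n + 1)\<^sup>2\<close>, with \<open>n\<close> of order \<open>log (1/\<epsilon>)\<close>. Between grid points both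
\<open>J\<^sub>\<epsilon>\<close> and \<open>L\<close> are nondecreasing in time, so \<open>D\<close> deviates from its grid values by at most an increment of
\<open>L\<close>, and those have squares of total mean \<open>O(\<surd>\<epsilon>)\<close>. With \<open>\<gamma>\<close> strictly between \<open>\<delta>\<close> and \<open>1/2\<close> the logarithms
are absorbed.\<close>

section \<open>Gaussian densities and singular integrals\<close>

abbreviation gauss :: "real \<Rightarrow> real \<Rightarrow> real" where
  "gauss t \<equiv> normal_density 0 (sqrt t)"

lemma gauss_le:
  assumes "0 < t" shows "gauss t y \<le> 1 / sqrt t"
proof -
  have "gauss t y = (1 / sqrt (2 * pi * t)) * exp (- y\<^sup>2 / (2 * t))"
    using assms by (simp add: normal_density_def)
  also have "\<dots> \<le> (1 / sqrt (2 * pi * t)) * 1"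
    using assms by (intro mult_left_mono) auto
  also have "\<dots> \<le> 1 / sqrt t"
  proof -
    \<comment> \<open>dropping the factor \<open>2\<pi>\<close>\<close>
    have "1 * t \<le> (2 * pi) * t"
      using pi_gt3 assms by (intro mult_right_mono) auto
    then show ?thesis
      using assms by (simp add: frac_le)
  qed
  finally show ?thesis .
qed

text \<open>With \<open>r = \<bar>v\<bar>/\<surd>t\<close>, the derivative at \<open>v\<close> is \<open>1/t\<close> times \<open>r exp (-r\<^sup>2/2) / \<surd>(2\<pi>)\<close> in absolute
value, and \<open>r \<le> 1 + r\<^sup>2/2 \<le> exp (r\<^sup>2/2)\<close>.\<close>

lemma gauss_lipschitz:
  assumes t: "0 < t" shows "\<bar>gauss t y - gauss t z\<bar> \<le> \<bar>y - z\<bar> / t"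
proof -
  have deriv: "(gauss t has_real_derivative (- v / t) * gauss t v) (at v)" for v
    unfolding normal_density_def using t
    by (auto intro!: derivative_eq_intros simp: field_simps power2_eq_square)
  have bound: "\<bar>(- v / t) * gauss t v\<bar> \<le> 1 / t" for v
  proof -
    define r where "r = \<bar>v\<bar> / sqrt t"
    have "r \<le> 1 + r\<^sup>2 / 2"
      using zero_le_power2[of "r - 1"] by (simp add: power2_eq_square algebra_simps)
    also have "\<dots> \<le> exp (r\<^sup>2 / 2)"
      by (rule exp_ge_add_one_self)
    finally have r: "r * exp (- (r\<^sup>2 / 2)) \<le> 1"
      by (simp add: exp_minus field_simps)
    have c: "1 / sqrt (2 * pi) \<le> 1"
      using pi_gt3 by (simp add: real_le_rsqrt)
    have "\<bar>(- v / t) * gauss t v\<bar> = (1 / t) * ((1 / sqrt (2 * pi)) * (r * exp (- (r\<^sup>2 / 2))))"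
      using t unfolding r_def normal_density_def
      by (simp add: abs_mult power_divide real_sqrt_mult field_simps)
    also have "\<dots> \<le> (1 / t) * (1 * 1)"
      using t c r by (intro mult_left_mono mult_mono) (auto simp: r_def)
    finally show ?thesis by simp
  qed
  have "norm (gauss t y - gauss t z) \<le> (1 / t) * norm (y - z)"
    by (rule field_differentiable_bound[where S = UNIV and f' = "\<lambda>v. (- v / t) * gauss t v"])
       (use bound in \<open>simp_all only: real_norm_def UNIV_I convex_UNIV has_field_derivative_at_within[OF deriv]\<close>)
  then show ?thesis by simp
qed

lemma gauss_moment_2:
  assumes "0 < t"
  shows "(\<integral>\<^sup>+b. ennreal (gauss t b) * ennreal (b\<^sup>2) \<partial>lborel) = ennreal t"
proof -
  have "has_bochner_integral lborel (\<lambda>b. gauss t b * b\<^sup>2) t"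
    using normal_moment_even[of "sqrt t" 0 1] assms
    by (simp add: fact_numeral power_mult_distrib power_divide field_simps numeral_2_eq_2)
  then have "(\<integral>\<^sup>+b. ennreal (gauss t b * b\<^sup>2) \<partial>lborel) = ennreal t"
    by (intro nn_integral_eq_integral[THEN trans])
       (auto simp: has_bochner_integral_iff)
  then show ?thesis by (simp add: ennreal_mult)
qed

lemma gauss_moment_abs_3:
  assumes "0 < t"
  shows "(\<integral>\<^sup>+b. ennreal (gauss t b) * ennreal (\<bar>b\<bar>^3) \<partial>lborel) \<le> ennreal (2 * t * sqrt t)"
proof -
  have "has_bochner_integral lborel (\<lambda>b. gauss t b * \<bar>b\<bar>^3) (2 * t * sqrt t * sqrt (2 / pi))"
    using normal_moment_abs_odd[of "sqrt t" 0 1] assms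
    by (simp add: fact_numeral power3_eq_cube mult_ac numeral_3_eq_3)
  then have "(\<integral>\<^sup>+b. ennreal (gauss t b * \<bar>b\<bar>^3) \<partial>lborel) = ennreal (2 * t * sqrt t * sqrt (2 / pi))"
    by (intro nn_integral_eq_integral[THEN trans]) (auto simp: has_bochner_integral_iff)
  also have "\<dots> \<le> ennreal (2 * t * sqrt t * 1)"
    using assms pi_gt3 by (intro ennreal_leI mult_left_mono) auto
  finally show ?thesis by (simp add: ennreal_mult)
qed

lemma gauss_interval_le:
  assumes "0 < t" "a \<le> b"
  shows "(\<integral>\<^sup>+y. ennreal (gauss t y) * indicator {a<..b} y \<partial>lborel) \<le> ennreal ((b - a) / sqrt t)"
proof -
  have "(\<integral>\<^sup>+y. ennreal (gauss t y) * indicator {a<..b} y \<partial>lborel)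
    \<le> (\<integral>\<^sup>+y. ennreal (1 / sqrt t) * indicator {a<..b} y \<partial>lborel)"
    by (intro nn_integral_mono mult_right_mono ennreal_leI gauss_le assms) auto
  also have "\<dots> = ennreal ((b - a) / sqrt t)"
    using assms by (simp add: nn_integral_cmult ennreal_mult[symmetric])
  finally show ?thesis .
qed

text \<open>Two one-sided bounds in place of an absolute difference, so that the nonnegative integral can be
used throughout and no integrability has to be tracked.\<close>

lemma gauss_interval_approx:
  assumes t: "0 < t" and "a \<le> b" and "\<And>y. y \<in> {a<..b} \<Longrightarrow> \<bar>y - x\<bar> \<le> r" and "0 \<le> r"
  shows "(\<integral>\<^sup>+y. ennreal (gauss t y) * indicator {a<..b} y \<partial>lborel)
      \<le> ennreal ((b - a) * gauss t x + (b - a) * r / t)" (is "?I \<le> _")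
    and "ennreal ((b - a) * gauss t x)
      \<le> (\<integral>\<^sup>+y. ennreal (gauss t y) * indicator {a<..b} y \<partial>lborel) + ennreal ((b - a) * r / t)"
proof -
  have lip: "\<bar>gauss t y - gauss t x\<bar> \<le> r / t" if "y \<in> {a<..b}" for y
    using order_trans[OF gauss_lipschitz[OF t, of y x] divide_right_mono[OF assms(3)[OF that]]] t
    by simp
  have ind: "(\<integral>\<^sup>+y. ennreal c * indicator {a<..b} y \<partial>lborel) = ennreal ((b - a) * c)" if "0 \<le> c" for c
    using that \<open>a \<le> b\<close> by (simp add: nn_integral_cmult ennreal_mult mult.commute)
  have rt: "0 \<le> r / t" using assms by simp
  have "?I \<le> (\<integral>\<^sup>+y. ennreal (gauss t x + r / t) * indicator {a<..b} y \<partial>lborel)"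
    using lip by (intro nn_integral_mono) (force split: split_indicator intro!: ennreal_leI)
  also have "\<dots> = ennreal ((b - a) * (gauss t x + r / t))"
    using rt by (intro ind) simp
  finally show "?I \<le> ennreal ((b - a) * gauss t x + (b - a) * r / t)"
    by (simp add: algebra_simps)
  have "ennreal ((b - a) * gauss t x) = (\<integral>\<^sup>+y. ennreal (gauss t x) * indicator {a<..b} y \<partial>lborel)"
    by (intro ind[symmetric]) simp
  also have "\<dots> \<le> (\<integral>\<^sup>+y. ennreal (gauss t y) * indicator {a<..b} y + ennreal (r / t) * indicator {a<..b} y \<partial>lborel)"
    using lip rt
    by (intro nn_integral_mono)
       (force split: split_indicator simp: ennreal_plus[symmetric] simp del: ennreal_plus intro!: ennreal_leI)
  also have "\<dots> = ?I + ennreal ((b - a) * (r / t))"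
    using rt by (subst nn_integral_add) (auto simp: ind simp del: times_divide_eq_right)
  finally show "ennreal ((b - a) * gauss t x) \<le> ?I + ennreal ((b - a) * r / t)"
    by simp
qed

text \<open>The bound is uniform in the position \<open>c\<close> of the singularity: moving \<open>c\<close> to the nearest point of the
interval increases the integrand, and each side of the singularity then contributes at most
the integral of \<open>v powr - \<beta>\<close> over \<open>[0, b - a]\<close>.\<close>

lemma nn_integral_abs_powr:
  fixes a b c \<beta> :: real
  assumes "a \<le> b" "0 < \<beta>" "\<beta> < 1"
  shows "(\<integral>\<^sup>+v. ennreal (\<bar>v - c\<bar> powr - \<beta>) * indicator {a..b} v \<partial>lborel)
    \<le> ennreal (2 * (b - a) powr (1 - \<beta>) / (1 - \<beta>))"
proof -
  define d where "d = b - a"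
  \<comment> \<open>the point of the interval nearest to the singularity\<close>
  define m where "m = max a (min b c)"
  have d: "0 \<le> d" using assms by (simp add: d_def)
  have half: "(\<integral>\<^sup>+v. ennreal (\<bar>v\<bar> powr - \<beta>) * indicator {0..d} v \<partial>lborel) = ennreal (d powr (1 - \<beta>) / (1 - \<beta>))"
  proof -
    have "((\<lambda>v. v powr - \<beta>) has_integral (d powr (1 - \<beta>) / (1 - \<beta>))) {0..d}"
      using has_integral_powr_from_0[of "- \<beta>" d] assms d by (simp add: add.commute)
    then have "((\<lambda>v. \<bar>v\<bar> powr - \<beta>) has_integral (d powr (1 - \<beta>) / (1 - \<beta>))) {0..d}"
      by (rule has_integral_eq[rotated]) auto
    then have "((\<lambda>v. \<bar>v\<bar> powr - \<beta> * indicator {0..d} v) has_integral (d powr (1 - \<beta>) / (1 - \<beta>))) UNIV"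
      by (subst (asm) has_integral_restrict_UNIV[symmetric])
         (simp add: indicator_def of_bool_def if_distrib cong: if_cong)
    then have "(\<integral>\<^sup>+v. ennreal (\<bar>v\<bar> powr - \<beta> * indicator {0..d} v) \<partial>lborel) = ennreal (d powr (1 - \<beta>) / (1 - \<beta>))"
      by (intro nn_integral_has_integral_lborel) auto
    then show ?thesis by (simp add: ennreal_mult'' ennreal_indicator[symmetric] del: ennreal_indicator)
  qed
  have right: "(\<integral>\<^sup>+v. ennreal (\<bar>v - m\<bar> powr - \<beta>) * indicator {m..m + d} v \<partial>lborel) = ennreal (d powr (1 - \<beta>) / (1 - \<beta>))"
    by (subst nn_integral_real_affine[where t = m and c = 1])
       (auto simp: half[symmetric] indicator_def intro!: nn_integral_cong)
  have left: "(\<integral>\<^sup>+v. ennreal (\<bar>v - m\<bar> powr - \<beta>) * indicator {m - d..m} v \<partial>lborel) = ennreal (d powr (1 - \<beta>) / (1 - \<beta>))"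
    by (subst nn_integral_real_affine[where t = m and c = "-1"])
       (auto simp: half[symmetric] indicator_def intro!: nn_integral_cong)
  have "(\<integral>\<^sup>+v. ennreal (\<bar>v - c\<bar> powr - \<beta>) * indicator {a..b} v \<partial>lborel)
    \<le> (\<integral>\<^sup>+v. ennreal (\<bar>v - m\<bar> powr - \<beta>) * indicator {m..m + d} v
         + ennreal (\<bar>v - m\<bar> powr - \<beta>) * indicator {m - d..m} v \<partial>lborel)"
  proof (rule nn_integral_mono_AE)
    show "AE v in lborel. ennreal (\<bar>v - c\<bar> powr - \<beta>) * indicator {a..b} v
      \<le> ennreal (\<bar>v - m\<bar> powr - \<beta>) * indicator {m..m + d} v
         + ennreal (\<bar>v - m\<bar> powr - \<beta>) * indicator {m - d..m} v"
      using AE_lborel_singleton[of m]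
    proof (rule AE_mp, intro AE_I2 impI)
      fix v assume "v \<noteq> m"
      show "ennreal (\<bar>v - c\<bar> powr - \<beta>) * indicator {a..b} v
        \<le> ennreal (\<bar>v - m\<bar> powr - \<beta>) * indicator {m..m + d} v
           + ennreal (\<bar>v - m\<bar> powr - \<beta>) * indicator {m - d..m} v"
      proof (cases "v \<in> {a..b}")
        case True
        then have "\<bar>v - m\<bar> \<le> \<bar>v - c\<bar>" and v: "v \<in> {m..m + d} \<or> v \<in> {m - d..m}"
          using \<open>a \<le> b\<close> by (auto simp: m_def d_def)
        then have "\<bar>v - c\<bar> powr - \<beta> \<le> \<bar>v - m\<bar> powr - \<beta>"
          using \<open>v \<noteq> m\<close> assms by (intro powr_mono2') auto
        then show ?thesis
          using True v by (auto split: split_indicator intro!: ennreal_leI add_increasing2)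
      qed simp
    qed
  qed
  also have "\<dots> = ennreal (d powr (1 - \<beta>) / (1 - \<beta>)) + ennreal (d powr (1 - \<beta>) / (1 - \<beta>))"
    by (subst nn_integral_add) (auto simp: left right)
  also have "\<dots> = ennreal (2 * (b - a) powr (1 - \<beta>) / (1 - \<beta>))"
    using assms by (subst ennreal_plus[symmetric]) (auto simp: d_def)
  finally show ?thesis .
qed

lemma nn_integral_inverse_sqrt:
  fixes s t :: real
  assumes "0 \<le> s" "s \<le> t"
  shows "(\<integral>\<^sup>+u. ennreal (1 / sqrt u) * indicator {s..t} u \<partial>lborel) = ennreal (2 * (sqrt t - sqrt s))"
proof -
  have "((\<lambda>u. 1 / sqrt u) has_integral (2 * sqrt t - 2 * sqrt s)) {s..t}"
    using assms
    by (intro fundamental_theorem_of_calculus_interior)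
       (auto intro!: continuous_intros derivative_eq_intros
          simp: has_real_derivative_iff_has_vector_derivative[symmetric] field_simps)
  then have "((\<lambda>u. (1 / sqrt u) * indicator {s..t} u) has_integral (2 * sqrt t - 2 * sqrt s)) UNIV"
    by (subst (asm) has_integral_restrict_UNIV[symmetric])
       (simp add: indicator_def of_bool_def if_distrib cong: if_cong)
  moreover have "(\<lambda>u. (1 / sqrt u) * indicator {s..t} u) = (\<lambda>u. \<bar>1 / sqrt u\<bar> * indicator {s..t} u)"
    using assms by (auto simp: fun_eq_iff split: split_indicator)
  ultimately have "((\<lambda>u. \<bar>1 / sqrt u\<bar> * indicator {s..t} u) has_integral (2 * sqrt t - 2 * sqrt s)) UNIV"
    by simp
  then have "(\<integral>\<^sup>+u. ennreal (\<bar>1 / sqrt u\<bar> * indicator {s..t} u) \<partial>lborel) = ennreal (2 * sqrt t - 2 * sqrt s)"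
    by (intro nn_integral_has_integral_lborel) auto
  moreover have "(\<integral>\<^sup>+u. ennreal (\<bar>1 / sqrt u\<bar> * indicator {s..t} u) \<partial>lborel)
     = (\<integral>\<^sup>+u. ennreal (1 / sqrt u) * indicator {s..t} u \<partial>lborel)"
    using assms by (intro nn_integral_cong) (auto split: split_indicator)
  ultimately show ?thesis by (simp add: algebra_simps)
qed

section \<open>The crossing and window kernels\<close>

text \<open>The integrand of \<^const>\<open>J\<close>: the distance \<open>\<bar>b - a\<bar>\<close> if exactly one of \<open>a\<close> and \<open>b\<close> lies above \<open>x\<close>, else \<open>0\<close>.\<close>

definition crossing :: "real \<Rightarrow> real \<Rightarrow> real \<Rightarrow> real" where
  "crossing x a b = (indicator {x<..} b - indicator {x<..} a) * (b - a)"

lemma crossing_nonneg: "0 \<le> crossing x a b"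
  by (auto simp: crossing_def split: split_indicator)

lemma crossing_translate: "crossing x (z + a) (z + b) = crossing (x - z) a b"
  by (auto simp: crossing_def less_diff_eq add.commute split: split_indicator)

lemma crossing_measurable [measurable (raw)]:
  assumes [measurable]: "f \<in> borel_measurable N" "g \<in> borel_measurable N"
  shows "(\<lambda>w. crossing x (f w) (g w)) \<in> borel_measurable N"
  unfolding crossing_def by measurable

text \<open>For a fixed displacement \<open>b\<close>, the starting points that cross the level form an interval of length
\<open>\<bar>b\<bar>\<close> with endpoint \<open>x\<close>. Hence averaging a crossing over the starting point gains one power of \<open>\<bar>b\<bar>\<close>.\<close>

lemma crossing_eq:
  "crossing x a (a + b) = \<bar>b\<bar> * indicator {min x (x - b)<..max x (x - b)} a"
  by (auto simp: crossing_def split: split_indicator)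

lemma crossing_power_eq:
  assumes "0 < p"
  shows "ennreal (crossing x a (a + b) ^ p)
    = ennreal (\<bar>b\<bar> ^ p) * indicator {min x (x - b)<..max x (x - b)} a"
  using assms unfolding crossing_eq by (auto split: split_indicator)

lemma length_crossing_set: "max x (x - b) - min x (x - b) = \<bar>b :: real\<bar>"
  by auto

lemma gauss_crossing_power:
  assumes t: "0 < t" and p: "0 < p"
  shows "(\<integral>\<^sup>+a. ennreal (gauss t a) * ennreal (crossing x a (a + b) ^ p) \<partial>lborel)
    \<le> ennreal (\<bar>b\<bar> ^ Suc p / sqrt t)"
proof -
  have "(\<integral>\<^sup>+a. ennreal (gauss t a) * ennreal (crossing x a (a + b) ^ p) \<partial>lborel)
    = (\<integral>\<^sup>+a. ennreal (\<bar>b\<bar> ^ p) * (ennreal (gauss t a) * indicator {min x (x - b)<..max x (x - b)} a) \<partial>lborel)"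
    unfolding crossing_power_eq[OF p] by (intro nn_integral_cong) (simp add: mult_ac)
  also have "\<dots> = ennreal (\<bar>b\<bar> ^ p) * (\<integral>\<^sup>+a. ennreal (gauss t a) * indicator {min x (x - b)<..max x (x - b)} a \<partial>lborel)"
    by (rule nn_integral_cmult) simp
  also have "\<dots> \<le> ennreal (\<bar>b\<bar> ^ p) * ennreal (\<bar>b\<bar> / sqrt t)"
    using gauss_interval_le[OF t, of "min x (x - b)" "max x (x - b)"]
    unfolding length_crossing_set by (intro mult_left_mono) auto
  also have "\<dots> = ennreal (\<bar>b\<bar> ^ Suc p / sqrt t)"
    using t by (simp add: ennreal_mult[symmetric] mult.commute)
  finally show ?thesis .
qed

lemma crossing_moment_1:
  assumes t: "0 < t" and e: "0 < e"
  shows "(\<integral>\<^sup>+b. ennreal (gauss e b) * (\<integral>\<^sup>+a. ennreal (gauss t a) * ennreal (crossing x a (a + b)) \<partial>lborel) \<partial>lborel)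
    \<le> ennreal (e / sqrt t)"
proof -
  have "(\<integral>\<^sup>+b. ennreal (gauss e b) * (\<integral>\<^sup>+a. ennreal (gauss t a) * ennreal (crossing x a (a + b)) \<partial>lborel) \<partial>lborel)
    \<le> (\<integral>\<^sup>+b. ennreal (1 / sqrt t) * (ennreal (gauss e b) * ennreal (b\<^sup>2)) \<partial>lborel)"
  proof (intro nn_integral_mono)
    fix b
    have "ennreal (gauss e b) * (\<integral>\<^sup>+a. ennreal (gauss t a) * ennreal (crossing x a (a + b)) \<partial>lborel)
      \<le> ennreal (gauss e b) * ennreal (\<bar>b\<bar> ^ Suc 1 / sqrt t)"
      using gauss_crossing_power[OF t, of 1 x b] by (intro mult_left_mono) auto
    also have "\<dots> = ennreal (gauss e b * (\<bar>b\<bar> ^ Suc 1 / sqrt t))"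
      using t by (intro ennreal_mult[symmetric]) auto
    also have "gauss e b * (\<bar>b\<bar> ^ Suc 1 / sqrt t) = 1 / sqrt t * (gauss e b * b\<^sup>2)"
      by (simp add: power2_eq_square)
    also have "ennreal \<dots> = ennreal (1 / sqrt t) * (ennreal (gauss e b) * ennreal (b\<^sup>2))"
      using t by (simp only: ennreal_mult normal_density_nonneg zero_le_power2 mult_nonneg_nonneg
        zero_le_divide_1_iff real_sqrt_ge_0_iff less_imp_le)
    finally show "ennreal (gauss e b) * (\<integral>\<^sup>+a. ennreal (gauss t a) * ennreal (crossing x a (a + b)) \<partial>lborel)
      \<le> ennreal (1 / sqrt t) * (ennreal (gauss e b) * ennreal (b\<^sup>2))" .
  qed
  also have "\<dots> = ennreal (1 / sqrt t) * ennreal e"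
    by (subst nn_integral_cmult) (auto simp: gauss_moment_2[OF e])
  also have "\<dots> = ennreal (e / sqrt t)"
    using t e by (simp add: ennreal_mult[symmetric])
  finally show ?thesis .
qed

lemma crossing_moment_2:
  assumes t: "0 < t" and e: "0 < e"
  shows "(\<integral>\<^sup>+b. ennreal (gauss e b) * (\<integral>\<^sup>+a. ennreal (gauss t a) * ennreal ((crossing x a (a + b))\<^sup>2) \<partial>lborel) \<partial>lborel)
    \<le> ennreal (2 * e * sqrt e / sqrt t)"
proof -
  have "(\<integral>\<^sup>+b. ennreal (gauss e b) * (\<integral>\<^sup>+a. ennreal (gauss t a) * ennreal ((crossing x a (a + b))\<^sup>2) \<partial>lborel) \<partial>lborel)
    \<le> (\<integral>\<^sup>+b. ennreal (1 / sqrt t) * (ennreal (gauss e b) * ennreal (\<bar>b\<bar>^3)) \<partial>lborel)"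
  proof (intro nn_integral_mono)
    fix b
    have "ennreal (gauss e b) * (\<integral>\<^sup>+a. ennreal (gauss t a) * ennreal ((crossing x a (a + b))\<^sup>2) \<partial>lborel)
      \<le> ennreal (gauss e b) * ennreal (\<bar>b\<bar> ^ Suc 2 / sqrt t)"
      using gauss_crossing_power[OF t, of 2 x b] by (intro mult_left_mono) auto
    also have "\<dots> = ennreal (gauss e b * (\<bar>b\<bar> ^ Suc 2 / sqrt t))"
      using t by (intro ennreal_mult[symmetric]) auto
    also have "gauss e b * (\<bar>b\<bar> ^ Suc 2 / sqrt t) = 1 / sqrt t * (gauss e b * \<bar>b\<bar>^3)"
      by (simp add: power2_eq_square power3_eq_cube)
    also have "ennreal \<dots> = ennreal (1 / sqrt t) * (ennreal (gauss e b) * ennreal (\<bar>b\<bar>^3))"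
      using t by (simp only: ennreal_mult normal_density_nonneg zero_le_power_abs mult_nonneg_nonneg
        zero_le_divide_1_iff real_sqrt_ge_0_iff less_imp_le)
    finally show "ennreal (gauss e b) * (\<integral>\<^sup>+a. ennreal (gauss t a) * ennreal ((crossing x a (a + b))\<^sup>2) \<partial>lborel)
      \<le> ennreal (1 / sqrt t) * (ennreal (gauss e b) * ennreal (\<bar>b\<bar>^3))" .
  qed
  also have "\<dots> \<le> ennreal (1 / sqrt t) * ennreal (2 * e * sqrt e)"
    by (subst nn_integral_cmult) (auto intro!: mult_left_mono gauss_moment_abs_3[OF e])
  also have "\<dots> = ennreal (2 * e * sqrt e / sqrt t)"
    using t e by (simp add: ennreal_mult[symmetric])
  finally show ?thesis .
qed

text \<open>The crossing kernel divided by \<open>e\<close> has mass \<open>e\<inverse> E B\<^sup>2 = 1\<close> for a centred Gaussian \<open>B\<close> of variance \<open>e\<close>,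
so it acts like a smeared Dirac mass at \<open>x\<close>. The error is the Lipschitz constant of the density
times the mean of \<open>\<bar>B\<bar>\<^sup>3\<close>: a third power because \<open>\<bar>B\<bar>\<close> counts once for the size of the crossing, once for
the length of the crossing interval and once for its extent around \<open>x\<close>.\<close>

lemma crossing_moment_1_approx:
  fixes x t e :: real
  assumes t: "0 < t" and e: "0 < e"
  defines "m \<equiv> (\<integral>\<^sup>+b. ennreal (gauss e b) * (\<integral>\<^sup>+a. ennreal (gauss t a) * ennreal (crossing x a (a + b)) \<partial>lborel) \<partial>lborel)"
  shows "m \<le> ennreal (e * gauss t x + 2 * e * sqrt e / t)"
    and "ennreal (e * gauss t x) \<le> m + ennreal (2 * e * sqrt e / t)"
proof -
  define F where "F b = (\<integral>\<^sup>+a. ennreal (gauss t a) * indicator {min x (x - b)<..max x (x - b)} a \<partial>lborel)" for b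
  have inner: "(\<integral>\<^sup>+a. ennreal (gauss t a) * ennreal (crossing x a (a + b)) \<partial>lborel) = ennreal \<bar>b\<bar> * F b" for b
  proof -
    have "(\<integral>\<^sup>+a. ennreal (gauss t a) * ennreal (crossing x a (a + b)) \<partial>lborel)
      = (\<integral>\<^sup>+a. ennreal \<bar>b\<bar> * (ennreal (gauss t a) * indicator {min x (x - b)<..max x (x - b)} a) \<partial>lborel)"
      using crossing_power_eq[of 1 x _ b] by (intro nn_integral_cong) (simp add: mult_ac)
    also have "\<dots> = ennreal \<bar>b\<bar> * F b"
      unfolding F_def by (rule nn_integral_cmult) simp
    finally show ?thesis .
  qed
  have in_crossing_set: "\<bar>y - x\<bar> \<le> \<bar>b\<bar>" if "y \<in> {min x (x - b)<..max x (x - b)}" for y b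
    using that by auto
  have F_le: "F b \<le> ennreal (\<bar>b\<bar> * gauss t x + \<bar>b\<bar> * \<bar>b\<bar> / t)"
    and F_ge: "ennreal (\<bar>b\<bar> * gauss t x) \<le> F b + ennreal (\<bar>b\<bar> * \<bar>b\<bar> / t)" for b
    using gauss_interval_approx[OF t, of "min x (x - b)" "max x (x - b)" x "\<bar>b\<bar>", OF _ in_crossing_set]
    unfolding length_crossing_set F_def by auto
  have [measurable]: "F \<in> borel_measurable borel"
    unfolding F_def indicator_def greaterThanAtMost_iff by measurable
  \<comment> \<open>the mass of the kernel, and below the error from smearing\<close>
  have main: "(\<integral>\<^sup>+b. ennreal (gauss t x) * (ennreal (gauss e b) * ennreal (b\<^sup>2)) \<partial>lborel) = ennreal (e * gauss t x)"
    using e by (subst nn_integral_cmult) (auto simp: gauss_moment_2[OF e] ennreal_mult mult.commute)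
  have err: "(\<integral>\<^sup>+b. ennreal (1 / t) * (ennreal (gauss e b) * ennreal (\<bar>b\<bar>^3)) \<partial>lborel) \<le> ennreal (2 * e * sqrt e / t)"
  proof -
    have "(\<integral>\<^sup>+b. ennreal (1 / t) * (ennreal (gauss e b) * ennreal (\<bar>b\<bar>^3)) \<partial>lborel) \<le> ennreal (1 / t) * ennreal (2 * e * sqrt e)"
      by (subst nn_integral_cmult) (auto intro!: mult_left_mono gauss_moment_abs_3[OF e])
    also have "\<dots> = ennreal (2 * e * sqrt e / t)"
      using t e by (simp add: ennreal_mult[symmetric])
    finally show ?thesis .
  qed
  have "m \<le> (\<integral>\<^sup>+b. ennreal (gauss t x) * (ennreal (gauss e b) * ennreal (b\<^sup>2))
      + ennreal (1 / t) * (ennreal (gauss e b) * ennreal (\<bar>b\<bar>^3)) \<partial>lborel)"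
    unfolding m_def inner
  proof (intro nn_integral_mono)
    fix b
    have "ennreal (gauss e b) * (ennreal \<bar>b\<bar> * F b)
      \<le> ennreal (gauss e b) * (ennreal \<bar>b\<bar> * ennreal (\<bar>b\<bar> * gauss t x + \<bar>b\<bar> * \<bar>b\<bar> / t))"
      by (intro mult_left_mono F_le) auto
    also have "\<dots> = ennreal (gauss e b * (\<bar>b\<bar> * (\<bar>b\<bar> * gauss t x + \<bar>b\<bar> * \<bar>b\<bar> / t)))"
      by (simp only: ennreal_mult' normal_density_nonneg abs_ge_zero)
    also have "gauss e b * (\<bar>b\<bar> * (\<bar>b\<bar> * gauss t x + \<bar>b\<bar> * \<bar>b\<bar> / t))
      = gauss t x * (gauss e b * b\<^sup>2) + 1 / t * (gauss e b * \<bar>b\<bar>^3)"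
      by (simp add: power2_eq_square power3_eq_cube algebra_simps)
    also have "ennreal \<dots> = ennreal (gauss t x * (gauss e b * b\<^sup>2)) + ennreal (1 / t * (gauss e b * \<bar>b\<bar>^3))"
      using t by (intro ennreal_plus) auto
    also have "\<dots> = ennreal (gauss t x) * (ennreal (gauss e b) * ennreal (b\<^sup>2))
      + ennreal (1 / t) * (ennreal (gauss e b) * ennreal (\<bar>b\<bar>^3))"
      using t by (simp only: ennreal_mult' normal_density_nonneg zero_le_divide_1_iff less_imp_le)
    finally show "ennreal (gauss e b) * (ennreal \<bar>b\<bar> * F b) \<le> ennreal (gauss t x) * (ennreal (gauss e b) * ennreal (b\<^sup>2))
      + ennreal (1 / t) * (ennreal (gauss e b) * ennreal (\<bar>b\<bar>^3))" .
  qed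
  also have "\<dots> \<le> ennreal (e * gauss t x) + ennreal (2 * e * sqrt e / t)"
    by (subst nn_integral_add) (auto simp only: main measurable_ennreal borel_measurable_normal_density intro!: add_left_mono err, measurable)
  finally show "m \<le> ennreal (e * gauss t x + 2 * e * sqrt e / t)"
    using t e by (subst ennreal_plus) auto
  have "ennreal (e * gauss t x) \<le> (\<integral>\<^sup>+b. ennreal (gauss e b) * (ennreal \<bar>b\<bar> * F b)
      + ennreal (1 / t) * (ennreal (gauss e b) * ennreal (\<bar>b\<bar>^3)) \<partial>lborel)"
    unfolding main[symmetric]
  proof (intro nn_integral_mono)
    fix b
    have "ennreal (gauss t x) * (ennreal (gauss e b) * ennreal (b\<^sup>2))
      = ennreal (gauss t x * (gauss e b * b\<^sup>2))"
      by (simp only: ennreal_mult' normal_density_nonneg)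
    also have "gauss t x * (gauss e b * b\<^sup>2) = gauss e b * (\<bar>b\<bar> * (\<bar>b\<bar> * gauss t x))"
      by (simp add: power2_eq_square)
    also have "ennreal \<dots> = ennreal (gauss e b) * (ennreal \<bar>b\<bar> * ennreal (\<bar>b\<bar> * gauss t x))"
      by (simp only: ennreal_mult' normal_density_nonneg abs_ge_zero)
    also have "\<dots> \<le> ennreal (gauss e b) * (ennreal \<bar>b\<bar> * (F b + ennreal (\<bar>b\<bar> * \<bar>b\<bar> / t)))"
      by (intro mult_left_mono F_ge) auto
    also have "\<dots> = ennreal (gauss e b) * (ennreal \<bar>b\<bar> * F b)
      + ennreal (gauss e b) * (ennreal \<bar>b\<bar> * ennreal (\<bar>b\<bar> * \<bar>b\<bar> / t))"
      by (simp add: distrib_left)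
    also have "ennreal (gauss e b) * (ennreal \<bar>b\<bar> * ennreal (\<bar>b\<bar> * \<bar>b\<bar> / t))
      = ennreal (gauss e b * (\<bar>b\<bar> * (\<bar>b\<bar> * \<bar>b\<bar> / t)))"
      by (simp only: ennreal_mult' normal_density_nonneg abs_ge_zero)
    also have "gauss e b * (\<bar>b\<bar> * (\<bar>b\<bar> * \<bar>b\<bar> / t)) = 1 / t * (gauss e b * \<bar>b\<bar>^3)"
      by (simp add: power3_eq_cube)
    also have "ennreal \<dots> = ennreal (1 / t) * (ennreal (gauss e b) * ennreal (\<bar>b\<bar>^3))"
      using t by (simp only: ennreal_mult' normal_density_nonneg zero_le_divide_1_iff less_imp_le)
    finally show "ennreal (gauss t x) * (ennreal (gauss e b) * ennreal (b\<^sup>2)) \<le> ennreal (gauss e b) * (ennreal \<bar>b\<bar> * F b)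
      + ennreal (1 / t) * (ennreal (gauss e b) * ennreal (\<bar>b\<bar>^3))" .
  qed
  also have "\<dots> = m + (\<integral>\<^sup>+b. ennreal (1 / t) * (ennreal (gauss e b) * ennreal (\<bar>b\<bar>^3)) \<partial>lborel)"
    unfolding m_def inner by (rule nn_integral_add) measurable
  also have "\<dots> \<le> m + ennreal (2 * e * sqrt e / t)"
    by (intro add_left_mono err)
  finally show "ennreal (e * gauss t x) \<le> m + ennreal (2 * e * sqrt e / t)" .
qed

definition window :: "real \<Rightarrow> real \<Rightarrow> real \<Rightarrow> real" where
  "window \<eta> x y = indicator {x - \<eta><..x + \<eta>} y / (2 * \<eta>)"

lemma window_nonneg: "0 < \<eta> \<Longrightarrow> 0 \<le> window \<eta> x y"
  by (simp add: window_def)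

lemma window_le: "0 < \<eta> \<Longrightarrow> window \<eta> x y \<le> 1 / (2 * \<eta>)"
  by (simp add: window_def divide_right_mono split: split_indicator)

lemma window_measurable [measurable]: "window \<eta> x \<in> borel_measurable borel"
  unfolding window_def[abs_def] by measurable

lemma window_translate: "window \<eta> x (z + y) = window \<eta> (x - z) y"
  by (auto simp: window_def algebra_simps split: split_indicator)

lemma gauss_window:
  fixes t \<eta> x :: real
  assumes t: "0 < t" and \<eta>: "0 < \<eta>"
  defines "m \<equiv> (\<integral>\<^sup>+y. ennreal (gauss t y) * ennreal (window \<eta> x y) \<partial>lborel)"
  shows "m \<le> ennreal (1 / sqrt t)"
    and "m \<le> ennreal (gauss t x + \<eta> / t)"
    and "ennreal (gauss t x) \<le> m + ennreal (\<eta> / t)"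
proof -
  define I where "I = (\<integral>\<^sup>+y. ennreal (gauss t y) * indicator {x - \<eta><..x + \<eta>} y \<partial>lborel)"
  have m: "m = ennreal (1 / (2 * \<eta>)) * I"
    unfolding m_def I_def
    by (subst nn_integral_cmult[symmetric])
       (auto intro!: nn_integral_cong simp: window_def mult_ac split: split_indicator)
  have "m \<le> ennreal (1 / (2 * \<eta>)) * ennreal (2 * \<eta> / sqrt t)"
    unfolding m I_def using gauss_interval_le[OF t, of "x - \<eta>" "x + \<eta>"] \<eta>
    by (intro mult_left_mono) auto
  then show "m \<le> ennreal (1 / sqrt t)"
    using t \<eta> by (simp add: ennreal_mult[symmetric])
  have approx: "I \<le> ennreal (2 * \<eta> * gauss t x + 2 * \<eta> * \<eta> / t)"
     "ennreal (2 * \<eta> * gauss t x) \<le> I + ennreal (2 * \<eta> * \<eta> / t)"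
    using gauss_interval_approx[OF t, of "x - \<eta>" "x + \<eta>" x \<eta>] \<eta> unfolding I_def by (auto simp: abs_le_iff)
  have "m \<le> ennreal (1 / (2 * \<eta>)) * ennreal (2 * \<eta> * gauss t x + 2 * \<eta> * \<eta> / t)"
    unfolding m by (intro mult_left_mono approx) auto
  also have "\<dots> = ennreal (1 / (2 * \<eta>) * (2 * \<eta> * gauss t x + 2 * \<eta> * \<eta> / t))"
    using t \<eta> by (intro ennreal_mult[symmetric]) auto
  also have "1 / (2 * \<eta>) * (2 * \<eta> * gauss t x + 2 * \<eta> * \<eta> / t) = gauss t x + \<eta> / t"
    using t \<eta> by (simp add: field_simps)
  finally show "m \<le> ennreal (gauss t x + \<eta> / t)" .
  have "ennreal (gauss t x) = ennreal (1 / (2 * \<eta>)) * ennreal (2 * \<eta> * gauss t x)"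
    using \<eta> by (simp add: ennreal_mult[symmetric])
  also have "\<dots> \<le> ennreal (1 / (2 * \<eta>)) * (I + ennreal (2 * \<eta> * \<eta> / t))"
    by (intro mult_left_mono approx) auto
  also have "\<dots> = m + ennreal (\<eta> / t)"
    using t \<eta> by (simp add: m distrib_left ennreal_mult[symmetric])
  finally show "ennreal (gauss t x) \<le> m + ennreal (\<eta> / t)" .
qed

text \<open>The density of the approximation error: its time integral along the path is \<^const>\<open>J\<close> minus the
\<open>\<eta>\<close>-approximation of the local time.\<close>

definition discrepancy :: "real \<Rightarrow> real \<Rightarrow> real \<Rightarrow> real \<Rightarrow> real \<Rightarrow> real" where
  "discrepancy \<epsilon> \<eta> x a b = crossing x a b / \<epsilon> - window \<eta> x a"

lemma discrepancy_measurable [measurable (raw)]: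
  assumes [measurable]: "f \<in> borel_measurable N" "g \<in> borel_measurable N"
  shows "(\<lambda>w. discrepancy \<epsilon> \<eta> x (f w) (g w)) \<in> borel_measurable N"
  unfolding discrepancy_def by measurable

text \<open>Together with the next lemma this turns \<open>min (1/\<surd>r) (\<surd>\<epsilon>/r)\<close> into a single power of \<open>r\<close> that is still
integrable at \<open>0\<close>, at the price of \<open>\<epsilon> powr \<gamma>\<close> with \<open>\<gamma> < 1/2\<close> in place of \<open>\<surd>\<epsilon>\<close>.\<close>

lemma powr_decay_near:
  fixes r \<epsilon> \<gamma> :: real
  assumes "0 < r" "r \<le> \<epsilon>" "0 < \<gamma>"
  shows "1 / sqrt r \<le> \<epsilon> powr \<gamma> * r powr - (1/2 + \<gamma>)"
proof -
  have "1 / sqrt r = r powr \<gamma> * r powr - (1/2 + \<gamma>)"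
    using assms by (simp add: powr_add[symmetric] powr_minus powr_half_sqrt[symmetric] inverse_eq_divide)
  also have "\<dots> \<le> \<epsilon> powr \<gamma> * r powr - (1/2 + \<gamma>)"
    using assms by (intro mult_right_mono powr_mono2) auto
  finally show ?thesis .
qed

lemma powr_decay_far:
  fixes r \<epsilon> \<gamma> :: real
  assumes "0 < \<epsilon>" "\<epsilon> \<le> r" "\<gamma> < 1/2"
  shows "sqrt \<epsilon> / r \<le> \<epsilon> powr \<gamma> * r powr - (1/2 + \<gamma>)"
proof -
  have r: "0 < r" using assms by linarith
  have "sqrt \<epsilon> / r = \<epsilon> powr \<gamma> * (\<epsilon> powr (1/2 - \<gamma>) * r powr - 1)"
    using assms r by (simp add: powr_add[symmetric] powr_minus powr_half_sqrt[symmetric] inverse_eq_divide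
        flip: mult.assoc)
  also have "\<dots> \<le> \<epsilon> powr \<gamma> * (r powr (1/2 - \<gamma>) * r powr - 1)"
    using assms by (intro mult_left_mono mult_right_mono powr_mono2) auto
  also have "r powr (1/2 - \<gamma>) * r powr - 1 = r powr - (1/2 + \<gamma>)"
    by (subst powr_add[symmetric]) simp
  finally show ?thesis .
qed

section \<open>Independent increments\<close>

text \<open>The mean of a product whose second factor also depends on independent randomness \<open>V\<close>: integrating
out \<open>V\<close> first replaces that factor by its conditional mean, which is bounded by \<open>\<kappa>\<close>.\<close>

lemma (in prob_space) indep_decouple:
  fixes \<Phi> :: "'b \<Rightarrow> real" and \<Theta> :: "'b \<Rightarrow> 'b \<Rightarrow> real"
  assumes indep: "indep_var N U K V"
    and \<Phi> [measurable]: "\<Phi> \<in> borel_measurable N"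
    and \<Theta> [measurable]: "(\<lambda>(u, v). \<Theta> u v) \<in> borel_measurable (N \<Otimes>\<^sub>M K)"
    and int: "integrable M (\<lambda>\<omega>. \<Phi> (U \<omega>) * \<Theta> (U \<omega>) (V \<omega>))"
    and int': "integrable M (\<lambda>\<omega>. \<Phi> (U \<omega>))"
    and bound: "\<And>u. u \<in> space N \<Longrightarrow> \<bar>\<integral>\<omega>. \<Theta> u (V \<omega>) \<partial>M\<bar> \<le> \<kappa>"
  shows "(\<integral>\<omega>. \<Phi> (U \<omega>) * \<Theta> (U \<omega>) (V \<omega>) \<partial>M) \<le> \<kappa> * (\<integral>\<omega>. \<bar>\<Phi> (U \<omega>)\<bar> \<partial>M)"
proof -
  have U [measurable]: "U \<in> M \<rightarrow>\<^sub>M N" and V [measurable]: "V \<in> M \<rightarrow>\<^sub>M K"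
    and joint: "distr M N U \<Otimes>\<^sub>M distr M K V = distr M (N \<Otimes>\<^sub>M K) (\<lambda>\<omega>. (U \<omega>, V \<omega>))"
    using indep unfolding indep_var_distribution_eq by auto
  interpret DU: prob_space "distr M N U" by (rule prob_space_distr) simp
  interpret DV: prob_space "distr M K V" by (rule prob_space_distr) simp
  interpret P: pair_prob_space "distr M N U" "distr M K V" ..
  have "integrable (distr M (N \<Otimes>\<^sub>M K) (\<lambda>\<omega>. (U \<omega>, V \<omega>))) (\<lambda>(u, v). \<Phi> u * \<Theta> u v)"
    using int by (subst integrable_distr_eq) auto
  then have int2: "integrable (distr M N U \<Otimes>\<^sub>M distr M K V) (\<lambda>(u, v). \<Phi> u * \<Theta> u v)"
    by (simp add: joint)
  have "(\<integral>\<omega>. \<Phi> (U \<omega>) * \<Theta> (U \<omega>) (V \<omega>) \<partial>M)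
    = (\<integral>p. (\<lambda>(u, v). \<Phi> u * \<Theta> u v) p \<partial>distr M (N \<Otimes>\<^sub>M K) (\<lambda>\<omega>. (U \<omega>, V \<omega>)))"
    by (subst integral_distr) auto
  also have "\<dots> = (\<integral>u. (\<integral>v. \<Phi> u * \<Theta> u v \<partial>distr M K V) \<partial>distr M N U)"
    unfolding joint[symmetric] using P.integral_fst'[OF int2] by simp
  also have "\<dots> = (\<integral>u. \<Phi> u * (\<integral>\<omega>. \<Theta> u (V \<omega>) \<partial>M) \<partial>distr M N U)"
  proof (rule Bochner_Integration.integral_cong)
    fix u assume "u \<in> space (distr M N U)"
    then have "u \<in> space N" by simp
    then have [measurable]: "\<Theta> u \<in> borel_measurable K" by measurable
    show "(\<integral>v. \<Phi> u * \<Theta> u v \<partial>distr M K V) = \<Phi> u * (\<integral>\<omega>. \<Theta> u (V \<omega>) \<partial>M)"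
      by (subst integral_mult_right_zero, subst integral_distr) auto
  qed simp
  also have "\<dots> \<le> (\<integral>u. \<kappa> * \<bar>\<Phi> u\<bar> \<partial>distr M N U)"
  proof (rule integral_mono)
    have "integrable (distr M N U) (\<lambda>u. \<integral>v. \<Phi> u * \<Theta> u v \<partial>distr M K V)"
      using P.integrable_fst'[OF int2] by simp
    also have "?this \<longleftrightarrow> integrable (distr M N U) (\<lambda>u. \<Phi> u * (\<integral>\<omega>. \<Theta> u (V \<omega>) \<partial>M))"
    proof (rule Bochner_Integration.integrable_cong)
      fix u assume "u \<in> space (distr M N U)"
      then have "u \<in> space N" by simp
      then have [measurable]: "\<Theta> u \<in> borel_measurable K" by measurable
      show "(\<integral>v. \<Phi> u * \<Theta> u v \<partial>distr M K V) = \<Phi> u * (\<integral>\<omega>. \<Theta> u (V \<omega>) \<partial>M)"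
        by (subst integral_mult_right_zero, subst integral_distr) auto
    qed simp
    finally show "integrable (distr M N U) (\<lambda>u. \<Phi> u * (\<integral>\<omega>. \<Theta> u (V \<omega>) \<partial>M))" .
    show "integrable (distr M N U) (\<lambda>u. \<kappa> * \<bar>\<Phi> u\<bar>)"
      using int' by (subst integrable_distr_eq) auto
    fix u assume "u \<in> space (distr M N U)"
    then have "\<bar>\<integral>\<omega>. \<Theta> u (V \<omega>) \<partial>M\<bar> \<le> \<kappa>" using bound by simp
    then have "\<bar>\<Phi> u\<bar> * \<bar>\<integral>\<omega>. \<Theta> u (V \<omega>) \<partial>M\<bar> \<le> \<bar>\<Phi> u\<bar> * \<kappa>"
      by (rule mult_left_mono) simp
    then show "\<Phi> u * (\<integral>\<omega>. \<Theta> u (V \<omega>) \<partial>M) \<le> \<kappa> * \<bar>\<Phi> u\<bar>"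
      unfolding abs_mult[symmetric] by (simp add: mult.commute)
  qed
  also have "\<dots> = \<kappa> * (\<integral>\<omega>. \<bar>\<Phi> (U \<omega>)\<bar> \<partial>M)"
    by (subst integral_distr) auto
  finally show ?thesis .
qed

context std_brownian_motion
begin

lemma indep_two_increments:
  assumes "0 \<le> r" "r < u" "u < v"
  shows "indep_var borel (\<lambda>\<omega>. X u \<omega> - X r \<omega>) borel (\<lambda>\<omega>. X v \<omega> - X u \<omega>)"
proof -
  define \<tau> where "\<tau> i = (if i = 0 then r else if i = Suc 0 then u else v)" for i
  have iv: "indep_vars (\<lambda>_. borel) (\<lambda>i \<omega>. X (\<tau> (Suc i)) \<omega> - X (\<tau> i) \<omega>) {..<2}"
    by (rule indep_increments) (use assms in \<open>auto simp: \<tau>_def\<close>)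
  have "indep_var borel ((\<lambda>r. r 0) \<circ> (\<lambda>\<omega>. restrict (\<lambda>i. X (\<tau> (Suc i)) \<omega> - X (\<tau> i) \<omega>) {0}))
     borel ((\<lambda>r. r 1) \<circ> (\<lambda>\<omega>. restrict (\<lambda>i. X (\<tau> (Suc i)) \<omega> - X (\<tau> i) \<omega>) {1}))"
    by (rule indep_var_compose[OF indep_var_restrict[OF iv]]) auto
  then show ?thesis by (simp add: comp_def \<tau>_def)
qed

lemma indep_past_future_increments:
  assumes "0 < u" "u < w" "w < v" "v < z"
  shows "indep_var (borel \<Otimes>\<^sub>M borel) (\<lambda>\<omega>. (X u \<omega> - X 0 \<omega>, X w \<omega> - X u \<omega>))
    (borel \<Otimes>\<^sub>M borel) (\<lambda>\<omega>. (X v \<omega> - X w \<omega>, X z \<omega> - X v \<omega>))"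
proof -
  define \<tau> where "\<tau> i = (if i = 0 then 0 else if i = Suc 0 then u else if i = Suc (Suc 0) then w
    else if i = Suc (Suc (Suc 0)) then v else z)" for i
  have "\<tau> i < \<tau> (Suc i)" if "i < 4" for i
  proof -
    have "i = 0 \<or> i = Suc 0 \<or> i = Suc (Suc 0) \<or> i = Suc (Suc (Suc 0))" using that by auto
    then show ?thesis using assms by (auto simp: \<tau>_def)
  qed
  then have iv: "indep_vars (\<lambda>_. borel) (\<lambda>i \<omega>. X (\<tau> (Suc i)) \<omega> - X (\<tau> i) \<omega>) {..<4}"
    by (intro indep_increments) (auto simp: \<tau>_def)
  have "indep_var (borel \<Otimes>\<^sub>M borel)
      ((\<lambda>r. (r 0, r (Suc 0))) \<circ> (\<lambda>\<omega>. restrict (\<lambda>i. X (\<tau> (Suc i)) \<omega> - X (\<tau> i) \<omega>) {0, Suc 0}))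
     (borel \<Otimes>\<^sub>M borel)
      ((\<lambda>r. (r (Suc (Suc 0)), r (Suc (Suc (Suc 0)))))
        \<circ> (\<lambda>\<omega>. restrict (\<lambda>i. X (\<tau> (Suc i)) \<omega> - X (\<tau> i) \<omega>) {Suc (Suc 0), Suc (Suc (Suc 0))}))"
    by (rule indep_var_compose[OF indep_var_restrict[OF iv]]) auto
  then show ?thesis by (simp add: comp_def \<tau>_def)
qed

text \<open>The integral over the first increment is the inner one, since the kernels are integrated over the
starting point first.\<close>

lemma nn_integral_two_increments:
  assumes "0 \<le> r" "r < u" "u < v"
    and [measurable]: "(\<lambda>(a, b). \<Phi> a b) \<in> borel_measurable (borel \<Otimes>\<^sub>M borel)"
  shows "(\<integral>\<^sup>+\<omega>. \<Phi> (X u \<omega> - X r \<omega>) (X v \<omega> - X u \<omega>) \<partial>M)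
    = (\<integral>\<^sup>+b. ennreal (gauss (v - u) b) * (\<integral>\<^sup>+a. ennreal (gauss (u - r) a) * \<Phi> a b \<partial>lborel) \<partial>lborel)"
proof -
  have "distributed M (lborel \<Otimes>\<^sub>M lborel) (\<lambda>\<omega>. (X u \<omega> - X r \<omega>, X v \<omega> - X u \<omega>))
    (\<lambda>(a, b). ennreal (gauss (u - r) a) * ennreal (gauss (v - u) b))"
    using indep_two_increments[OF assms(1-3)] assms(1-3)
    by (intro distributed_joint_indep gaussian_increments lborel.sigma_finite_measure_axioms)
       (auto simp: indep_var_distribution_eq cong: distr_cong)
  from distributed_nn_integral[OF this, of "\<lambda>(a, b). \<Phi> a b", symmetric]
  have "(\<integral>\<^sup>+\<omega>. \<Phi> (X u \<omega> - X r \<omega>) (X v \<omega> - X u \<omega>) \<partial>M)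
    = (\<integral>\<^sup>+(a, b). ennreal (gauss (u - r) a) * ennreal (gauss (v - u) b) * \<Phi> a b \<partial>(lborel \<Otimes>\<^sub>M lborel))"
    by (simp add: split_beta')
  also have "\<dots> = (\<integral>\<^sup>+b. (\<integral>\<^sup>+a. ennreal (gauss (u - r) a) * ennreal (gauss (v - u) b) * \<Phi> a b \<partial>lborel) \<partial>lborel)"
    by (subst lborel_pair.nn_integral_snd[symmetric]) auto
  also have "\<dots> = (\<integral>\<^sup>+b. ennreal (gauss (v - u) b) * (\<integral>\<^sup>+a. ennreal (gauss (u - r) a) * \<Phi> a b \<partial>lborel) \<partial>lborel)"
    by (subst nn_integral_cmult[symmetric]) (auto simp: mult_ac)
  finally show ?thesis .
qed

lemma nn_integral_increment:
  assumes "0 \<le> r" "r < u" and "\<Phi> \<in> borel_measurable borel"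
  shows "(\<integral>\<^sup>+\<omega>. \<Phi> (X u \<omega> - X r \<omega>) \<partial>M) = (\<integral>\<^sup>+a. ennreal (gauss (u - r) a) * \<Phi> a \<partial>lborel)"
  using distributed_nn_integral[OF gaussian_increments[OF assms(1,2)], of \<Phi>] assms(3) by simp

section \<open>Covariance of the discrepancy\<close>

lemma AE_increment_from_zero: "AE \<omega> in M. X u \<omega> - X 0 \<omega> = X u \<omega>"
  using start_zero by eventually_elim simp

lemma nn_integral_start_and_increment:
  assumes "0 < u" "u < v"
    and "(\<lambda>(a, b). \<Phi> a b) \<in> borel_measurable (borel \<Otimes>\<^sub>M borel)"
  shows "(\<integral>\<^sup>+\<omega>. \<Phi> (X u \<omega>) (X v \<omega> - X u \<omega>) \<partial>M)
    = (\<integral>\<^sup>+b. ennreal (gauss (v - u) b) * (\<integral>\<^sup>+a. ennreal (gauss u a) * \<Phi> a b \<partial>lborel) \<partial>lborel)"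
proof -
  have "(\<integral>\<^sup>+\<omega>. \<Phi> (X u \<omega>) (X v \<omega> - X u \<omega>) \<partial>M) = (\<integral>\<^sup>+\<omega>. \<Phi> (X u \<omega> - X 0 \<omega>) (X v \<omega> - X u \<omega>) \<partial>M)"
    by (intro nn_integral_cong_AE) (use AE_increment_from_zero[of u] in eventually_elim, simp)
  then show ?thesis
    using nn_integral_two_increments[of 0 u v \<Phi>] assms by simp
qed

lemma nn_integral_crossing:
  assumes "0 < u" "0 < \<epsilon>"
  shows "(\<integral>\<^sup>+\<omega>. ennreal (crossing x (X u \<omega>) (X (u + \<epsilon>) \<omega>) / \<epsilon>) \<partial>M) \<le> ennreal (1 / sqrt u)"
proof -
  have [measurable]: "X u \<in> borel_measurable M" "X (u + \<epsilon>) \<in> borel_measurable M"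
    using assms by (auto intro: random_variable_X)
  have "(\<integral>\<^sup>+\<omega>. ennreal (crossing x (X u \<omega>) (X (u + \<epsilon>) \<omega>) / \<epsilon>) \<partial>M)
    = (\<integral>\<^sup>+\<omega>. ennreal (1 / \<epsilon>) * ennreal (crossing x (X u \<omega>) (X u \<omega> + (X (u + \<epsilon>) \<omega> - X u \<omega>))) \<partial>M)"
    using assms by (intro nn_integral_cong) (simp add: ennreal_mult[symmetric] crossing_nonneg)
  also have "\<dots> = ennreal (1 / \<epsilon>) * (\<integral>\<^sup>+\<omega>. ennreal (crossing x (X u \<omega>) (X u \<omega> + (X (u + \<epsilon>) \<omega> - X u \<omega>))) \<partial>M)"
    by (rule nn_integral_cmult) measurable
  also have "\<dots> \<le> ennreal (1 / \<epsilon>) * ennreal (\<epsilon> / sqrt u)"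
    using assms crossing_moment_1[of u \<epsilon> x]
    by (intro mult_left_mono, subst nn_integral_start_and_increment) auto
  also have "\<dots> = ennreal (1 / sqrt u)"
    using assms by (simp add: ennreal_mult[symmetric])
  finally show ?thesis .
qed

lemma nn_integral_crossing_square:
  assumes "0 < u" "0 < \<epsilon>"
  shows "(\<integral>\<^sup>+\<omega>. ennreal ((crossing x (X u \<omega>) (X (u + \<epsilon>) \<omega>) / \<epsilon>)\<^sup>2) \<partial>M) \<le> ennreal (2 / (sqrt \<epsilon> * sqrt u))"
proof -
  have [measurable]: "X u \<in> borel_measurable M" "X (u + \<epsilon>) \<in> borel_measurable M"
    using assms by (auto intro: random_variable_X)
  have "(\<integral>\<^sup>+\<omega>. ennreal ((crossing x (X u \<omega>) (X (u + \<epsilon>) \<omega>) / \<epsilon>)\<^sup>2) \<partial>M)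
    = (\<integral>\<^sup>+\<omega>. ennreal (1 / \<epsilon>\<^sup>2) * ennreal ((crossing x (X u \<omega>) (X u \<omega> + (X (u + \<epsilon>) \<omega> - X u \<omega>)))\<^sup>2) \<partial>M)"
    using assms by (intro nn_integral_cong) (simp add: ennreal_mult[symmetric] power_divide)
  also have "\<dots> = ennreal (1 / \<epsilon>\<^sup>2) * (\<integral>\<^sup>+\<omega>. ennreal ((crossing x (X u \<omega>) (X u \<omega> + (X (u + \<epsilon>) \<omega> - X u \<omega>)))\<^sup>2) \<partial>M)"
    by (rule nn_integral_cmult) measurable
  also have "\<dots> \<le> ennreal (1 / \<epsilon>\<^sup>2) * ennreal (2 * \<epsilon> * sqrt \<epsilon> / sqrt u)"
    using assms crossing_moment_2[of u \<epsilon> x]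
    by (intro mult_left_mono, subst nn_integral_start_and_increment) auto
  also have "\<dots> = ennreal (1 / \<epsilon>\<^sup>2 * (2 * \<epsilon> * sqrt \<epsilon> / sqrt u))"
    using assms by (intro ennreal_mult[symmetric]) auto
  also have "1 / \<epsilon>\<^sup>2 * (2 * \<epsilon> * sqrt \<epsilon> / sqrt u) = 2 / (sqrt \<epsilon> * sqrt u)"
  proof -
    have "\<epsilon> = sqrt \<epsilon> * sqrt \<epsilon>" using assms by simp
    then show ?thesis using assms by (simp add: field_simps power2_eq_square)
  qed
  finally show ?thesis .
qed

lemma nn_integral_window:
  assumes "0 < u" "0 < \<eta>"
  shows "(\<integral>\<^sup>+\<omega>. ennreal (window \<eta> x (X u \<omega>)) \<partial>M) \<le> ennreal (1 / sqrt u)"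
proof -
  have "(\<integral>\<^sup>+\<omega>. ennreal (window \<eta> x (X u \<omega>)) \<partial>M) = (\<integral>\<^sup>+\<omega>. ennreal (window \<eta> x (X u \<omega> - X 0 \<omega>)) \<partial>M)"
    by (intro nn_integral_cong_AE) (use AE_increment_from_zero[of u] in eventually_elim, simp)
  also have "\<dots> \<le> ennreal (1 / sqrt u)"
    using assms gauss_window(1)[of u \<eta> x] by (subst nn_integral_increment) auto
  finally show ?thesis .
qed

lemma nn_integral_window_window:
  assumes "0 < u" "u < v" "0 < \<eta>"
  shows "(\<integral>\<^sup>+\<omega>. ennreal (window \<eta> x (X u \<omega>) * window \<eta> x (X v \<omega>)) \<partial>M) \<le> ennreal (1 / (sqrt u * sqrt (v - u)))"
proof -
  have "(\<integral>\<^sup>+\<omega>. ennreal (window \<eta> x (X u \<omega>) * window \<eta> x (X v \<omega>)) \<partial>M)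
    = (\<integral>\<^sup>+\<omega>. ennreal (window \<eta> x (X u \<omega>) * window \<eta> x (X u \<omega> + (X v \<omega> - X u \<omega>))) \<partial>M)"
    by simp
  also have "\<dots> = (\<integral>\<^sup>+b. ennreal (gauss (v - u) b)
      * (\<integral>\<^sup>+a. ennreal (gauss u a) * ennreal (window \<eta> x a * window \<eta> x (a + b)) \<partial>lborel) \<partial>lborel)"
    by (rule nn_integral_start_and_increment) (use assms in \<open>auto\<close>)
  also have "\<dots> = (\<integral>\<^sup>+b. (\<integral>\<^sup>+a. ennreal (gauss (v - u) b)
      * (ennreal (gauss u a) * ennreal (window \<eta> x a * window \<eta> x (a + b))) \<partial>lborel) \<partial>lborel)"
    by (subst nn_integral_cmult) auto
  also have "\<dots> = (\<integral>\<^sup>+a. (\<integral>\<^sup>+b. ennreal (gauss (v - u) b)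
      * (ennreal (gauss u a) * ennreal (window \<eta> x a * window \<eta> x (a + b))) \<partial>lborel) \<partial>lborel)"
    by (rule lborel_pair.Fubini') measurable
  also have "\<dots> = (\<integral>\<^sup>+a. ennreal (gauss u a) * ennreal (window \<eta> x a)
      * (\<integral>\<^sup>+b. ennreal (gauss (v - u) b) * ennreal (window \<eta> (x - a) b) \<partial>lborel) \<partial>lborel)"
    using assms by (subst nn_integral_cmult[symmetric])
      (auto simp: ennreal_mult window_nonneg window_translate mult_ac)
  also have "\<dots> \<le> (\<integral>\<^sup>+a. ennreal (gauss u a) * ennreal (window \<eta> x a) * ennreal (1 / sqrt (v - u)) \<partial>lborel)"
    using assms by (intro nn_integral_mono mult_left_mono gauss_window) auto
  also have "\<dots> \<le> ennreal (1 / sqrt u) * ennreal (1 / sqrt (v - u))"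
    using assms by (subst nn_integral_multc) (auto intro!: mult_right_mono gauss_window)
  also have "\<dots> = ennreal (1 / (sqrt u * sqrt (v - u)))"
    using assms by (simp add: ennreal_mult[symmetric])
  finally show ?thesis .
qed

text \<open>Here \<open>z\<close> is the position at time \<open>w\<close>. The two terms of the discrepancy are separately at most \<open>1/\<surd>\<tau>\<close>,
and both are close to the density at \<open>x - z\<close>: the crossing part up to \<open>2\<surd>\<epsilon>/\<tau>\<close>, the window part up to
\<open>\<eta>/\<tau> \<le> \<surd>\<epsilon>/\<tau>\<close>. This cancellation is the source of the rate.\<close>

lemma discrepancy_mean_bound:
  assumes w: "0 \<le> w" "w < v" and \<epsilon>: "0 < \<epsilon>" and \<eta>: "0 < \<eta>" "\<eta> \<le> sqrt \<epsilon>"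
  defines "\<tau> \<equiv> v - w"
  shows "\<bar>\<integral>\<omega>. discrepancy \<epsilon> \<eta> x (z + (X v \<omega> - X w \<omega>)) (z + (X v \<omega> - X w \<omega>) + (X (v + \<epsilon>) \<omega> - X v \<omega>)) \<partial>M\<bar>
    \<le> min (1 / sqrt \<tau>) (3 * sqrt \<epsilon> / \<tau>)"
proof -
  have [measurable]: "X v \<in> borel_measurable M" "X w \<in> borel_measurable M" "X (v + \<epsilon>) \<in> borel_measurable M"
    using w \<epsilon> by (auto intro: random_variable_X)
  have \<tau>: "0 < \<tau>" using w by (simp add: \<tau>_def)
  define f where "f \<omega> = crossing x (z + (X v \<omega> - X w \<omega>)) (z + (X v \<omega> - X w \<omega>) + (X (v + \<epsilon>) \<omega> - X v \<omega>)) / \<epsilon>" for \<omega>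
  define g where "g \<omega> = window \<eta> x (z + (X v \<omega> - X w \<omega>))" for \<omega>
  define p where "p = gauss \<tau> (x - z)"
  have f0: "0 \<le> f \<omega>" and g0: "0 \<le> g \<omega>" for \<omega>
    using \<epsilon> \<eta> by (simp_all add: f_def g_def crossing_nonneg window_nonneg)
  have [measurable]: "f \<in> borel_measurable M" "g \<in> borel_measurable M"
    unfolding f_def[abs_def] g_def[abs_def] by measurable
  define m where "m = (\<integral>\<^sup>+b. ennreal (gauss \<epsilon> b) * (\<integral>\<^sup>+a. ennreal (gauss \<tau> a) * ennreal (crossing (x - z) a (a + b)) \<partial>lborel) \<partial>lborel)"
  have f_eq: "(\<integral>\<^sup>+\<omega>. ennreal (f \<omega>) \<partial>M) = ennreal (1 / \<epsilon>) * m"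
  proof -
    have "(\<integral>\<^sup>+\<omega>. ennreal (f \<omega>) \<partial>M) = (\<integral>\<^sup>+\<omega>. ennreal (1 / \<epsilon>)
      * ennreal (crossing (x - z) (X v \<omega> - X w \<omega>) ((X v \<omega> - X w \<omega>) + (X (v + \<epsilon>) \<omega> - X v \<omega>))) \<partial>M)"
      unfolding f_def add.assoc crossing_translate
      using \<epsilon> by (intro nn_integral_cong) (simp add: ennreal_mult[symmetric] crossing_nonneg)
    also have "\<dots> = ennreal (1 / \<epsilon>)
      * (\<integral>\<^sup>+\<omega>. ennreal (crossing (x - z) (X v \<omega> - X w \<omega>) ((X v \<omega> - X w \<omega>) + (X (v + \<epsilon>) \<omega> - X v \<omega>))) \<partial>M)"
      by (rule nn_integral_cmult) measurable
    also have "(\<integral>\<^sup>+\<omega>. ennreal (crossing (x - z) (X v \<omega> - X w \<omega>) ((X v \<omega> - X w \<omega>) + (X (v + \<epsilon>) \<omega> - X v \<omega>))) \<partial>M) = m"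
      unfolding m_def \<tau>_def using nn_integral_two_increments[OF w, of "v + \<epsilon>" "\<lambda>a b. ennreal (crossing (x - z) a (a + b))"] \<epsilon>
      by simp
    finally show ?thesis .
  qed
  have f1: "(\<integral>\<^sup>+\<omega>. ennreal (f \<omega>) \<partial>M) \<le> ennreal (1 / sqrt \<tau>)"
  proof -
    have "ennreal (1 / \<epsilon>) * m \<le> ennreal (1 / \<epsilon>) * ennreal (\<epsilon> / sqrt \<tau>)"
      unfolding m_def by (intro mult_left_mono crossing_moment_1 \<tau> \<epsilon>) simp
    also have "\<dots> = ennreal (1 / sqrt \<tau>)"
      using \<epsilon> \<tau> by (simp add: ennreal_mult[symmetric])
    finally show ?thesis by (simp add: f_eq)
  qed
  have f2: "(\<integral>\<^sup>+\<omega>. ennreal (f \<omega>) \<partial>M) \<le> ennreal (p + 2 * sqrt \<epsilon> / \<tau>)"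
  proof -
    have "ennreal (1 / \<epsilon>) * m \<le> ennreal (1 / \<epsilon>) * ennreal (\<epsilon> * p + 2 * \<epsilon> * sqrt \<epsilon> / \<tau>)"
      unfolding m_def p_def by (intro mult_left_mono crossing_moment_1_approx(1) \<tau> \<epsilon>) simp
    also have "\<dots> = ennreal (1 / \<epsilon> * (\<epsilon> * p + 2 * \<epsilon> * sqrt \<epsilon> / \<tau>))"
      using \<epsilon> \<tau> by (intro ennreal_mult[symmetric]) (auto simp: p_def)
    also have "1 / \<epsilon> * (\<epsilon> * p + 2 * \<epsilon> * sqrt \<epsilon> / \<tau>) = p + 2 * sqrt \<epsilon> / \<tau>"
      using \<epsilon> \<tau> by (simp add: field_simps)
    finally show ?thesis by (simp add: f_eq)
  qed
  have f3: "ennreal p \<le> (\<integral>\<^sup>+\<omega>. ennreal (f \<omega>) \<partial>M) + ennreal (2 * sqrt \<epsilon> / \<tau>)"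
  proof -
    have "ennreal p = ennreal (1 / \<epsilon>) * ennreal (\<epsilon> * p)"
      using \<epsilon> by (simp add: ennreal_mult[symmetric] p_def)
    also have "\<dots> \<le> ennreal (1 / \<epsilon>) * (m + ennreal (2 * \<epsilon> * sqrt \<epsilon> / \<tau>))"
      unfolding m_def p_def by (intro mult_left_mono crossing_moment_1_approx(2) \<tau> \<epsilon>) simp
    also have "\<dots> = ennreal (1 / \<epsilon>) * m + ennreal (2 * sqrt \<epsilon> / \<tau>)"
      using \<epsilon> \<tau> by (simp add: distrib_left ennreal_mult[symmetric])
    finally show ?thesis by (simp add: f_eq)
  qed
  have g_eq: "(\<integral>\<^sup>+\<omega>. ennreal (g \<omega>) \<partial>M) = (\<integral>\<^sup>+y. ennreal (gauss \<tau> y) * ennreal (window \<eta> (x - z) y) \<partial>lborel)"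
    unfolding g_def window_translate \<tau>_def by (rule nn_integral_increment[OF w]) measurable
  note g1 = gauss_window(1)[OF \<tau> \<eta>(1), of "x - z", folded g_eq]
    and g2 = gauss_window(2,3)[OF \<tau> \<eta>(1), of "x - z", folded g_eq p_def]
  have fint: "integrable M f" and gint: "integrable M g"
    using f1 g1 f0 g0 by (auto intro!: integrableI_nonneg elim: le_less_trans)
  define mf where "mf = (\<integral>\<omega>. f \<omega> \<partial>M)"
  define mg where "mg = (\<integral>\<omega>. g \<omega> \<partial>M)"
  have mf: "(\<integral>\<^sup>+\<omega>. ennreal (f \<omega>) \<partial>M) = ennreal mf" and mg: "(\<integral>\<^sup>+\<omega>. ennreal (g \<omega>) \<partial>M) = ennreal mg"
    unfolding mf_def mg_def using fint gint f0 g0 by (auto intro!: nn_integral_eq_integral)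
  have mf0: "0 \<le> mf" and mg0: "0 \<le> mg"
    unfolding mf_def mg_def using f0 g0 by (auto intro!: Bochner_Integration.integral_nonneg)
  have "mf \<le> 1 / sqrt \<tau>" "mg \<le> 1 / sqrt \<tau>"
    using f1 g1 \<tau> unfolding mf mg by auto
  then have b1: "\<bar>mf - mg\<bar> \<le> 1 / sqrt \<tau>"
    using mf0 mg0 by linarith
  have p0: "0 \<le> p" by (simp add: p_def)
  have "mf \<le> p + 2 * sqrt \<epsilon> / \<tau>" "mg \<le> p + \<eta> / \<tau>"
    using f2 g2 \<tau> \<epsilon> \<eta> p0 unfolding mf mg by (auto simp: ennreal_le_iff simp del: ennreal_plus)
  moreover have "p \<le> mf + 2 * sqrt \<epsilon> / \<tau>" "p \<le> mg + \<eta> / \<tau>"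
    using f3 g2 \<tau> \<epsilon> \<eta> mf0 mg0 unfolding mf mg by (auto simp: ennreal_plus[symmetric] simp del: ennreal_plus)
  moreover have "\<eta> / \<tau> \<le> sqrt \<epsilon> / \<tau>"
    using \<eta> \<tau> by (intro divide_right_mono) auto
  moreover have "3 * sqrt \<epsilon> / \<tau> = 2 * sqrt \<epsilon> / \<tau> + sqrt \<epsilon> / \<tau>"
    by (simp add: field_simps)
  ultimately have b2: "\<bar>mf - mg\<bar> \<le> 3 * sqrt \<epsilon> / \<tau>"
    by linarith
  have "(\<integral>\<omega>. discrepancy \<epsilon> \<eta> x (z + (X v \<omega> - X w \<omega>)) (z + (X v \<omega> - X w \<omega>) + (X (v + \<epsilon>) \<omega> - X v \<omega>)) \<partial>M) = mf - mg"
    unfolding discrepancy_def f_def[symmetric] g_def[symmetric] mf_def mg_def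
    using fint gint by (rule Bochner_Integration.integral_diff)
  then show ?thesis using b1 b2 by simp
qed

lemma discrepancy_square_bound:
  assumes u: "0 < u" and \<epsilon>: "0 < \<epsilon>" and \<eta>: "0 < \<eta>"
  shows "(\<integral>\<^sup>+\<omega>. ennreal ((discrepancy \<epsilon> \<eta> x (X u \<omega>) (X (u + \<epsilon>) \<omega>))\<^sup>2) \<partial>M)
    \<le> ennreal (2 / (sqrt \<epsilon> * sqrt u) + (1 / (2 * \<eta>))\<^sup>2)"
proof -
  have [measurable]: "X u \<in> borel_measurable M" "X (u + \<epsilon>) \<in> borel_measurable M"
    using u \<epsilon> by (auto intro: random_variable_X)
  have "(\<integral>\<^sup>+\<omega>. ennreal ((discrepancy \<epsilon> \<eta> x (X u \<omega>) (X (u + \<epsilon>) \<omega>))\<^sup>2) \<partial>M)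
    \<le> (\<integral>\<^sup>+\<omega>. ennreal ((crossing x (X u \<omega>) (X (u + \<epsilon>) \<omega>) / \<epsilon>)\<^sup>2) + ennreal ((1 / (2 * \<eta>))\<^sup>2) \<partial>M)"
  proof (intro nn_integral_mono)
    fix \<omega>
    define f where "f = crossing x (X u \<omega>) (X (u + \<epsilon>) \<omega>) / \<epsilon>"
    define g where "g = window \<eta> x (X u \<omega>)"
    have "0 \<le> f" "0 \<le> g" "g \<le> 1 / (2 * \<eta>)"
      using \<epsilon> \<eta> by (simp_all add: f_def g_def crossing_nonneg window_nonneg window_le)
    then have "(f - g)\<^sup>2 \<le> f\<^sup>2 + g\<^sup>2" and "g\<^sup>2 \<le> (1 / (2 * \<eta>))\<^sup>2"
      by (auto simp: power2_diff intro!: power_mono)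
    then have "(f - g)\<^sup>2 \<le> f\<^sup>2 + (1 / (2 * \<eta>))\<^sup>2"
      by linarith
    then show "ennreal ((discrepancy \<epsilon> \<eta> x (X u \<omega>) (X (u + \<epsilon>) \<omega>))\<^sup>2)
      \<le> ennreal ((crossing x (X u \<omega>) (X (u + \<epsilon>) \<omega>) / \<epsilon>)\<^sup>2) + ennreal ((1 / (2 * \<eta>))\<^sup>2)"
      unfolding discrepancy_def f_def[symmetric] g_def[symmetric]
      by (simp add: ennreal_leI ennreal_plus[symmetric] del: ennreal_plus)
  qed
  also have "\<dots> \<le> ennreal (2 / (sqrt \<epsilon> * sqrt u)) + ennreal ((1 / (2 * \<eta>))\<^sup>2)"
    by (subst nn_integral_add) (auto intro!: add_right_mono nn_integral_crossing_square u \<epsilon> simp: emeasure_space_1)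
  also have "\<dots> = ennreal (2 / (sqrt \<epsilon> * sqrt u) + (1 / (2 * \<eta>))\<^sup>2)"
    using u \<epsilon> by (subst ennreal_plus) auto
  finally show ?thesis .
qed

text \<open>For \<open>v < u + \<epsilon>\<close> the negative mixed terms are dropped and the product of the two crossing terms is
split into squares; \<open>\<epsilon>\<close> is then replaced by the smaller \<open>v - u\<close>. For \<open>v > u + \<epsilon>\<close> the path after \<open>u + \<epsilon>\<close> is
independent of the first factor, so the covariance is at most the mean \<open>E \<bar>h\<^sub>u\<bar> \<le> 2/\<surd>u\<close> times the bound for the
conditional mean.\<close>

lemma discrepancy_covariance_bound:
  fixes x u v \<epsilon> \<eta> \<gamma> :: real
  assumes u: "0 < u" "u < v" and \<epsilon>: "0 < \<epsilon>" and \<eta>: "0 < \<eta>" "\<eta> \<le> sqrt \<epsilon>"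
    and \<gamma>: "0 < \<gamma>" "\<gamma> < 1/2" and neq: "v \<noteq> u + \<epsilon>"
  defines "h \<equiv> \<lambda>u \<omega>. discrepancy \<epsilon> \<eta> x (X u \<omega>) (X (u + \<epsilon>) \<omega>)"
  shows "(\<integral>\<omega>. h u \<omega> * h v \<omega> \<partial>M)
    \<le> 6 * \<epsilon> powr \<gamma> * (1 / sqrt u) * (\<bar>v - u\<bar> powr - (1/2 + \<gamma>) + \<bar>v - (u + \<epsilon>)\<bar> powr - (1/2 + \<gamma>))"
proof -
  have meas [measurable]: "X u \<in> borel_measurable M" "X (u + \<epsilon>) \<in> borel_measurable M"
      "X v \<in> borel_measurable M" "X (v + \<epsilon>) \<in> borel_measurable M" "X 0 \<in> borel_measurable M"
    using u \<epsilon> by (auto intro: random_variable_X)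
  have hm [measurable]: "h u \<in> borel_measurable M" "h v \<in> borel_measurable M"
    unfolding h_def by measurable
  define f where "f u \<omega> = crossing x (X u \<omega>) (X (u + \<epsilon>) \<omega>) / \<epsilon>" for u \<omega>
  define g where "g u \<omega> = window \<eta> x (X u \<omega>)" for u \<omega>
  have h: "h u \<omega> = f u \<omega> - g u \<omega>" for u \<omega>
    by (simp add: h_def f_def g_def discrepancy_def)
  have [measurable]: "f u \<in> borel_measurable M" "f v \<in> borel_measurable M"
      "g u \<in> borel_measurable M" "g v \<in> borel_measurable M"
    unfolding f_def[abs_def] g_def[abs_def] by measurable
  have f0: "0 \<le> f u \<omega>" and g0: "0 \<le> g u \<omega>" for u \<omega>
    using \<epsilon> \<eta> by (simp_all add: f_def g_def crossing_nonneg window_nonneg)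
  have sq: "integrable M (\<lambda>\<omega>. (h u \<omega>)\<^sup>2)" "integrable M (\<lambda>\<omega>. (h v \<omega>)\<^sup>2)"
    using discrepancy_square_bound[OF u(1) \<epsilon> \<eta>(1), of x] discrepancy_square_bound[of v, OF _ \<epsilon> \<eta>(1), of x] u
    unfolding h_def by (auto intro!: integrableI_nonneg intro: le_less_trans)
  have int: "integrable M (\<lambda>\<omega>. h u \<omega> * h v \<omega>)"
  proof (rule Bochner_Integration.integrable_bound)
    show "integrable M (\<lambda>\<omega>. (h u \<omega>)\<^sup>2 + (h v \<omega>)\<^sup>2)" using sq by simp
    have "\<bar>a * b\<bar> \<le> a\<^sup>2 + b\<^sup>2" for a b :: real
    proof -
      have "2 * \<bar>a * b\<bar> \<le> a\<^sup>2 + b\<^sup>2"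
        using zero_le_power2[of "\<bar>a\<bar> - \<bar>b\<bar>"] by (simp add: power2_diff abs_mult)
      moreover have "0 \<le> \<bar>a * b\<bar>" by simp
      ultimately show ?thesis by linarith
    qed
    then show "AE \<omega> in M. norm (h u \<omega> * h v \<omega>) \<le> norm ((h u \<omega>)\<^sup>2 + (h v \<omega>)\<^sup>2)"
      by simp
  qed simp
  \<comment> \<open>the times are within one lag of each other, or the second starts after the first crossing has ended\<close>
  have "v - u < \<epsilon> \<or> u + \<epsilon> < v" using neq by linarith
  then show ?thesis
  proof
    assume near: "v - u < \<epsilon>"
    have su: "1 / sqrt v \<le> 1 / sqrt u"
      using u by (intro divide_left_mono) auto
    have "(\<integral>\<^sup>+\<omega>. ennreal (h u \<omega> * h v \<omega>) \<partial>M)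
      \<le> (\<integral>\<^sup>+\<omega>. ennreal (1/2) * ennreal ((f u \<omega>)\<^sup>2) + ennreal (1/2) * ennreal ((f v \<omega>)\<^sup>2) + ennreal (g u \<omega> * g v \<omega>) \<partial>M)"
    proof (intro nn_integral_mono)
      fix \<omega>
      have "0 \<le> f u \<omega> * g v \<omega>" "0 \<le> g u \<omega> * f v \<omega>" "0 \<le> g u \<omega> * g v \<omega>"
        using f0 g0 by auto
      moreover have "2 * (f u \<omega> * f v \<omega>) \<le> (f u \<omega>)\<^sup>2 + (f v \<omega>)\<^sup>2"
        using zero_le_power2[of "f u \<omega> - f v \<omega>"] by (simp add: power2_diff)
      ultimately have "h u \<omega> * h v \<omega> \<le> 1/2 * (f u \<omega>)\<^sup>2 + 1/2 * (f v \<omega>)\<^sup>2 + g u \<omega> * g v \<omega>"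
        unfolding h by (simp add: algebra_simps)
      then have "ennreal (h u \<omega> * h v \<omega>) \<le> ennreal (1/2 * (f u \<omega>)\<^sup>2 + 1/2 * (f v \<omega>)\<^sup>2 + g u \<omega> * g v \<omega>)"
        by (rule ennreal_leI)
      also have "\<dots> = ennreal (1/2 * (f u \<omega>)\<^sup>2) + ennreal (1/2 * (f v \<omega>)\<^sup>2) + ennreal (g u \<omega> * g v \<omega>)"
        using \<open>0 \<le> g u \<omega> * g v \<omega>\<close>
        by (intro ennreal_plus[THEN trans] arg_cong2[where f = "(+)"] ennreal_plus refl) auto
      finally show "ennreal (h u \<omega> * h v \<omega>)
        \<le> ennreal (1/2) * ennreal ((f u \<omega>)\<^sup>2) + ennreal (1/2) * ennreal ((f v \<omega>)\<^sup>2) + ennreal (g u \<omega> * g v \<omega>)"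
        by (simp only: ennreal_mult'' zero_le_power2)
    qed
    also have "\<dots> = ennreal (1/2) * (\<integral>\<^sup>+\<omega>. ennreal ((f u \<omega>)\<^sup>2) \<partial>M) + ennreal (1/2) * (\<integral>\<^sup>+\<omega>. ennreal ((f v \<omega>)\<^sup>2) \<partial>M)
        + (\<integral>\<^sup>+\<omega>. ennreal (g u \<omega> * g v \<omega>) \<partial>M)"
      by (simp add: nn_integral_add nn_integral_cmult del: ennreal_half)
    also have "\<dots> \<le> ennreal (1/2) * ennreal (2 / (sqrt \<epsilon> * sqrt u)) + ennreal (1/2) * ennreal (2 / (sqrt \<epsilon> * sqrt v))
        + ennreal (1 / (sqrt u * sqrt (v - u)))"
      unfolding f_def g_def using u \<epsilon> \<eta>
      by (intro add_mono mult_left_mono nn_integral_crossing_square nn_integral_window_window) auto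
    also have "\<dots> = ennreal (1/2 * (2 / (sqrt \<epsilon> * sqrt u)) + 1/2 * (2 / (sqrt \<epsilon> * sqrt v)) + 1 / (sqrt u * sqrt (v - u)))"
      using u \<epsilon> by (simp add: ennreal_mult[symmetric] ennreal_plus[symmetric] del: ennreal_plus ennreal_half)
    finally have "(\<integral>\<omega>. h u \<omega> * h v \<omega> \<partial>M)
      \<le> 1/2 * (2 / (sqrt \<epsilon> * sqrt u)) + 1/2 * (2 / (sqrt \<epsilon> * sqrt v)) + 1 / (sqrt u * sqrt (v - u))"
      using u \<epsilon> by (intro integral_real_bounded) auto
    also have "\<dots> = 1 / sqrt \<epsilon> * (1 / sqrt u) + 1 / sqrt \<epsilon> * (1 / sqrt v) + 1 / sqrt (v - u) * (1 / sqrt u)"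
      by (simp add: field_simps)
    also have "\<dots> \<le> 1 / sqrt (v - u) * (1 / sqrt u) + 1 / sqrt (v - u) * (1 / sqrt u) + 1 / sqrt (v - u) * (1 / sqrt u)"
      using near u \<epsilon> su by (intro add_mono mult_mono divide_left_mono) auto
    also have "\<dots> = 3 * (1 / sqrt (v - u)) * (1 / sqrt u)" by simp
    also have "\<dots> \<le> 3 * (\<epsilon> powr \<gamma> * (v - u) powr - (1/2 + \<gamma>)) * (1 / sqrt u)"
      using near u \<gamma> by (intro mult_right_mono mult_left_mono powr_decay_near) auto
    also have "\<dots> = 3 * \<epsilon> powr \<gamma> * (1 / sqrt u) * (\<bar>v - u\<bar> powr - (1/2 + \<gamma>) + 0)"
      using u by simp
    also have "\<dots> \<le> 6 * \<epsilon> powr \<gamma> * (1 / sqrt u) * (\<bar>v - u\<bar> powr - (1/2 + \<gamma>) + \<bar>v - (u + \<epsilon>)\<bar> powr - (1/2 + \<gamma>))"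
      using u by (intro mult_mono add_mono) auto
    finally show ?thesis .
  next
    assume far: "u + \<epsilon> < v"
    define \<tau> where "\<tau> = v - (u + \<epsilon>)"
    have \<tau>: "0 < \<tau>" using far by (simp add: \<tau>_def)
    define \<kappa> where "\<kappa> = min (1 / sqrt \<tau>) (3 * sqrt \<epsilon> / \<tau>)"
    have \<kappa>: "\<kappa> \<le> 3 * (\<epsilon> powr \<gamma> * \<tau> powr - (1/2 + \<gamma>))"
    proof (cases "\<tau> \<le> \<epsilon>")
      case True
      have "\<kappa> \<le> 1 / sqrt \<tau>" by (simp add: \<kappa>_def)
      also have "\<dots> \<le> \<epsilon> powr \<gamma> * \<tau> powr - (1/2 + \<gamma>)"
        by (rule powr_decay_near) (use \<tau> True \<gamma> in auto)
      also have "\<dots> \<le> 3 * (\<epsilon> powr \<gamma> * \<tau> powr - (1/2 + \<gamma>))" by simp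
      finally show ?thesis .
    next
      case False
      have "\<kappa> \<le> 3 * (sqrt \<epsilon> / \<tau>)" by (simp add: \<kappa>_def)
      also have "\<dots> \<le> 3 * (\<epsilon> powr \<gamma> * \<tau> powr - (1/2 + \<gamma>))"
        by (intro mult_left_mono powr_decay_far) (use \<epsilon> False \<gamma> in auto)
      finally show ?thesis .
    qed
    define U where "U \<omega> = (X u \<omega> - X 0 \<omega>, X (u + \<epsilon>) \<omega> - X u \<omega>)" for \<omega>
    define V where "V \<omega> = (X v \<omega> - X (u + \<epsilon>) \<omega>, X (v + \<epsilon>) \<omega> - X v \<omega>)" for \<omega>
    define \<Phi> where "\<Phi> = (\<lambda>(a, b). discrepancy \<epsilon> \<eta> x a (a + b))"
    define \<Theta> where "\<Theta> p q = discrepancy \<epsilon> \<eta> x (fst p + snd p + fst q) (fst p + snd p + fst q + snd q)"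
      for p q :: "real \<times> real"
    have UV: "indep_var (borel \<Otimes>\<^sub>M borel) U (borel \<Otimes>\<^sub>M borel) V"
      unfolding U_def V_def using u \<epsilon> far by (intro indep_past_future_increments) auto
    have hu: "AE \<omega> in M. h u \<omega> = \<Phi> (U \<omega>)"
      using start_zero by eventually_elim (simp add: h_def \<Phi>_def U_def)
    have hv: "AE \<omega> in M. h v \<omega> = \<Theta> (U \<omega>) (V \<omega>)"
      using start_zero by eventually_elim (simp add: h_def \<Theta>_def U_def V_def)
    have [measurable]: "U \<in> M \<rightarrow>\<^sub>M borel \<Otimes>\<^sub>M borel" "V \<in> M \<rightarrow>\<^sub>M borel \<Otimes>\<^sub>M borel"
      unfolding U_def[abs_def] V_def[abs_def] by measurable
    have \<Phi>m [measurable]: "\<Phi> \<in> borel_measurable (borel \<Otimes>\<^sub>M borel)"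
      unfolding \<Phi>_def by measurable
    have \<Theta>m [measurable]: "(\<lambda>(u, v). \<Theta> u v) \<in> borel_measurable ((borel \<Otimes>\<^sub>M borel) \<Otimes>\<^sub>M (borel \<Otimes>\<^sub>M borel))"
      unfolding \<Theta>_def by measurable
    have inthu: "integrable M (h u)"
      by (rule square_integrable_imp_integrable[OF hm(1) sq(1)])
    have "(\<integral>\<omega>. h u \<omega> * h v \<omega> \<partial>M) = (\<integral>\<omega>. \<Phi> (U \<omega>) * \<Theta> (U \<omega>) (V \<omega>) \<partial>M)"
    proof (rule integral_cong_AE)
      show "AE \<omega> in M. h u \<omega> * h v \<omega> = \<Phi> (U \<omega>) * \<Theta> (U \<omega>) (V \<omega>)"
        using hu hv by eventually_elim simp
    qed measurable
    also have "\<dots> \<le> \<kappa> * (\<integral>\<omega>. \<bar>\<Phi> (U \<omega>)\<bar> \<partial>M)"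
    proof (rule indep_decouple[OF UV \<Phi>m \<Theta>m])
      have "AE \<omega> in M. h u \<omega> * h v \<omega> = \<Phi> (U \<omega>) * \<Theta> (U \<omega>) (V \<omega>)"
        using hu hv by eventually_elim simp
      then show "integrable M (\<lambda>\<omega>. \<Phi> (U \<omega>) * \<Theta> (U \<omega>) (V \<omega>))"
        using int by (subst integrable_cong_AE[symmetric]) auto
      show "integrable M (\<lambda>\<omega>. \<Phi> (U \<omega>))"
        using inthu hu by (subst integrable_cong_AE[symmetric]) auto
      fix p :: "real \<times> real"
      have "\<bar>\<integral>\<omega>. discrepancy \<epsilon> \<eta> x ((fst p + snd p) + (X v \<omega> - X (u + \<epsilon>) \<omega>))
         ((fst p + snd p) + (X v \<omega> - X (u + \<epsilon>) \<omega>) + (X (v + \<epsilon>) \<omega> - X v \<omega>)) \<partial>M\<bar> \<le> \<kappa>"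
        unfolding \<kappa>_def \<tau>_def using u \<epsilon> far \<eta> by (intro discrepancy_mean_bound) auto
      then show "\<bar>\<integral>\<omega>. \<Theta> p (V \<omega>) \<partial>M\<bar> \<le> \<kappa>"
        by (simp add: \<Theta>_def V_def)
    qed
    also have "(\<integral>\<omega>. \<bar>\<Phi> (U \<omega>)\<bar> \<partial>M) = (\<integral>\<omega>. \<bar>h u \<omega>\<bar> \<partial>M)"
    proof (rule integral_cong_AE)
      show "AE \<omega> in M. \<bar>\<Phi> (U \<omega>)\<bar> = \<bar>h u \<omega>\<bar>"
        using hu by eventually_elim simp
    qed measurable
    also have "\<kappa> * (\<integral>\<omega>. \<bar>h u \<omega>\<bar> \<partial>M) \<le> (3 * (\<epsilon> powr \<gamma> * \<tau> powr - (1/2 + \<gamma>))) * (2 * (1 / sqrt u))"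
    proof (intro mult_mono \<kappa>)
      have "(\<integral>\<^sup>+\<omega>. ennreal \<bar>h u \<omega>\<bar> \<partial>M) \<le> (\<integral>\<^sup>+\<omega>. ennreal (f u \<omega>) + ennreal (g u \<omega>) \<partial>M)"
      proof (intro nn_integral_mono)
        fix \<omega>
        have "\<bar>h u \<omega>\<bar> \<le> f u \<omega> + g u \<omega>" unfolding h using f0[of u \<omega>] g0[of u \<omega>] by linarith
        then show "ennreal \<bar>h u \<omega>\<bar> \<le> ennreal (f u \<omega>) + ennreal (g u \<omega>)"
          using f0 g0 by (simp add: ennreal_leI ennreal_plus[symmetric] del: ennreal_plus)
      qed
      also have "\<dots> = (\<integral>\<^sup>+\<omega>. ennreal (f u \<omega>) \<partial>M) + (\<integral>\<^sup>+\<omega>. ennreal (g u \<omega>) \<partial>M)"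
        by (rule nn_integral_add) auto
      also have "\<dots> \<le> ennreal (1 / sqrt u) + ennreal (1 / sqrt u)"
        unfolding f_def g_def by (intro add_mono nn_integral_crossing nn_integral_window u \<epsilon> \<eta>)
      also have "\<dots> = ennreal (2 * (1 / sqrt u))"
        using u by (subst ennreal_plus[symmetric]) auto
      finally show "(\<integral>\<omega>. \<bar>h u \<omega>\<bar> \<partial>M) \<le> 2 * (1 / sqrt u)"
        using u by (intro integral_real_bounded) auto
    qed auto
    also have "\<dots> = 6 * \<epsilon> powr \<gamma> * (1 / sqrt u) * (0 + \<bar>v - (u + \<epsilon>)\<bar> powr - (1/2 + \<gamma>))"
      using \<tau> unfolding \<tau>_def by simp
    also have "\<dots> \<le> 6 * \<epsilon> powr \<gamma> * (1 / sqrt u) * (\<bar>v - u\<bar> powr - (1/2 + \<gamma>) + \<bar>v - (u + \<epsilon>)\<bar> powr - (1/2 + \<gamma>))"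
      using u by (intro mult_mono add_mono) auto
    finally show ?thesis .
  qed
qed

end

section \<open>Second moments of time integrals\<close>

lemma integral_le_nn_integral:
  fixes f :: "'a \<Rightarrow> real"
  shows "ennreal (integral\<^sup>L M f) \<le> (\<integral>\<^sup>+x. ennreal (f x) \<partial>M)"
proof (cases "integrable M f")
  case True
  have "integral\<^sup>L M f \<le> (\<integral>x. max 0 (f x) \<partial>M)"
    using True by (intro integral_mono) auto
  then have "ennreal (integral\<^sup>L M f) \<le> ennreal (\<integral>x. max 0 (f x) \<partial>M)"
    by (rule ennreal_leI)
  also have "\<dots> = (\<integral>\<^sup>+x. ennreal (max 0 (f x)) \<partial>M)"
    using True by (intro nn_integral_eq_integral[symmetric]) auto
  also have "\<dots> = (\<integral>\<^sup>+x. ennreal (f x) \<partial>M)"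
    by (intro nn_integral_cong) (simp add: max_def ennreal_neg)
  finally show ?thesis .
qed (simp add: not_integrable_integral_eq)

lemma nn_integral_symmetric_kernel:
  fixes q :: "real \<Rightarrow> real \<Rightarrow> ennreal"
  assumes [measurable]: "(\<lambda>(u, v). q u v) \<in> borel_measurable (lborel \<Otimes>\<^sub>M lborel)"
    and sym: "\<And>u v. q u v = q v u"
  shows "(\<integral>\<^sup>+u. (\<integral>\<^sup>+v. q u v \<partial>lborel) \<partial>lborel) = 2 * (\<integral>\<^sup>+u. (\<integral>\<^sup>+v. q u v * indicator {u<..} v \<partial>lborel) \<partial>lborel)"
proof -
  have "(\<integral>\<^sup>+u. (\<integral>\<^sup>+v. q u v \<partial>lborel) \<partial>lborel)
    = (\<integral>\<^sup>+u. (\<integral>\<^sup>+v. q u v * of_bool (u < v) + q u v * of_bool (v < u) \<partial>lborel) \<partial>lborel)"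
  proof (rule nn_integral_cong, rule nn_integral_cong_AE)
    fix u :: real
    show "AE v in lborel. q u v = q u v * of_bool (u < v) + q u v * of_bool (v < u)"
      using AE_lborel_singleton[of u] by eventually_elim (auto simp: neq_iff)
  qed
  also have "\<dots> = (\<integral>\<^sup>+u. (\<integral>\<^sup>+v. q u v * of_bool (u < v) \<partial>lborel) \<partial>lborel)
      + (\<integral>\<^sup>+u. (\<integral>\<^sup>+v. q u v * of_bool (v < u) \<partial>lborel) \<partial>lborel)"
    by (simp add: nn_integral_add)
  also have "(\<integral>\<^sup>+u. (\<integral>\<^sup>+v. q u v * of_bool (v < u) \<partial>lborel) \<partial>lborel)
      = (\<integral>\<^sup>+v. (\<integral>\<^sup>+u. q u v * of_bool (v < u) \<partial>lborel) \<partial>lborel)"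
    by (rule lborel_pair.Fubini') measurable
  also have "\<dots> = (\<integral>\<^sup>+u. (\<integral>\<^sup>+v. q u v * of_bool (u < v) \<partial>lborel) \<partial>lborel)"
    by (subst sym) simp
  finally show ?thesis
    by (simp add: mult_2 indicator_def)
qed

text \<open>Fubini turns the second moment of a time integral into the double integral of the covariances.
The covariance is symmetric, so only \<open>u < v\<close> has to be bounded, and only for almost every \<open>v\<close>.\<close>

lemma (in prob_space) second_moment_time_integral:
  fixes h :: "real \<Rightarrow> 'a \<Rightarrow> real" and s t :: real and K :: "real \<Rightarrow> real \<Rightarrow> ennreal"
  assumes h [measurable]: "(\<lambda>(u, \<omega>). h u \<omega>) \<in> borel_measurable (borel \<Otimes>\<^sub>M M)"
    and "s \<le> t"
    and sq: "(\<integral>\<^sup>+u. (\<integral>\<^sup>+\<omega>. ennreal ((h u \<omega>)\<^sup>2) \<partial>M) * indicator {s..t} u \<partial>lborel) < \<infinity>"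
    and K: "\<And>u. s < u \<Longrightarrow> u \<le> t \<Longrightarrow>
      AE v in lborel. u < v \<longrightarrow> v \<le> t \<longrightarrow> ennreal (\<integral>\<omega>. h u \<omega> * h v \<omega> \<partial>M) \<le> K u v"
  shows "(\<integral>\<^sup>+\<omega>. ennreal ((LINT u:{s..t}|lborel. h u \<omega>)\<^sup>2) \<partial>M)
    \<le> 2 * (\<integral>\<^sup>+u. (\<integral>\<^sup>+v. K u v * indicator {s..t} v \<partial>lborel) * indicator {s..t} u \<partial>lborel)"
proof -
  interpret LM: pair_sigma_finite lborel M ..
  define P where "P = (lborel :: real measure) \<Otimes>\<^sub>M (lborel :: real measure)"
  interpret PS: sigma_finite_measure P
    unfolding P_def by (rule lborel_pair.sigma_finite_measure_axioms)
  interpret PM: pair_sigma_finite P M ..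
  \<comment> \<open>the factor \<open>indicator {s..t} u\<close> in \<open>k\<close> allows all integrals in time to range over the whole line\<close>
  define k where "k u \<omega> = indicator {s..t} u * h u \<omega>" for u \<omega>
  have hm [measurable]: "h u \<in> borel_measurable M" for u
    using measurable_compose_Pair1[OF _ h, of u] by simp
  have km [measurable]: "(\<lambda>(u, \<omega>). k u \<omega>) \<in> borel_measurable (borel \<Otimes>\<^sub>M M)"
    unfolding k_def by measurable
  have km' [measurable (raw)]: "(\<lambda>w. k (f w) (g w)) \<in> borel_measurable N"
    if [measurable]: "f \<in> borel_measurable N" "g \<in> N \<rightarrow>\<^sub>M M" for f g and N :: "'z measure"
  proof -
    have "(\<lambda>w. (\<lambda>(u, \<omega>). k u \<omega>) (f w, g w)) \<in> borel_measurable N" by measurable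
    then show ?thesis by simp
  qed
  have sqk: "(\<integral>\<^sup>+u. (\<integral>\<^sup>+\<omega>. ennreal ((k u \<omega>)\<^sup>2) \<partial>M) \<partial>lborel) < \<infinity>"
  proof -
    have "(\<integral>\<^sup>+u. (\<integral>\<^sup>+\<omega>. ennreal ((k u \<omega>)\<^sup>2) \<partial>M) \<partial>lborel)
      = (\<integral>\<^sup>+u. (\<integral>\<^sup>+\<omega>. ennreal ((h u \<omega>)\<^sup>2) \<partial>M) * indicator {s..t} u \<partial>lborel)"
      by (intro nn_integral_cong) (auto simp: k_def split: split_indicator)
    then show ?thesis using sq by simp
  qed
  have ind: "(\<integral>\<^sup>+u. indicator {s..t} u \<partial>lborel) = ennreal (t - s)"
    using \<open>s \<le> t\<close> by simp
  have prod_bound: "\<bar>k u \<omega> * k v \<omega>\<bar> \<le> indicator {s..t} v * (k u \<omega>)\<^sup>2 + indicator {s..t} u * (k v \<omega>)\<^sup>2" for u v \<omega>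
  proof -
    have "2 * \<bar>a * b\<bar> \<le> a\<^sup>2 + b\<^sup>2" for a b :: real
      using zero_le_power2[of "\<bar>a\<bar> - \<bar>b\<bar>"] by (simp add: power2_diff abs_mult)
    then have "\<bar>a * b\<bar> \<le> a\<^sup>2 + b\<^sup>2" for a b :: real
      using abs_ge_zero[of "a * b"] by (smt (verit))
    then show ?thesis by (auto simp: k_def split: split_indicator)
  qed
  have int3: "integrable (P \<Otimes>\<^sub>M M) (\<lambda>p. k (fst (fst p)) (snd p) * k (snd (fst p)) (snd p))"
  proof (rule integrableI_bounded)
    show "(\<lambda>p. k (fst (fst p)) (snd p) * k (snd (fst p)) (snd p)) \<in> borel_measurable (P \<Otimes>\<^sub>M M)"
      unfolding P_def by measurable
    have "(\<integral>\<^sup>+p. ennreal (norm (k (fst (fst p)) (snd p) * k (snd (fst p)) (snd p))) \<partial>(P \<Otimes>\<^sub>M M))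
      = (\<integral>\<^sup>+u. (\<integral>\<^sup>+v. (\<integral>\<^sup>+\<omega>. ennreal \<bar>k u \<omega> * k v \<omega>\<bar> \<partial>M) \<partial>lborel) \<partial>lborel)"
      unfolding P_def
      by (subst nn_integral_fst[symmetric], measurable, subst lborel.nn_integral_fst[symmetric], measurable)
    also have "\<dots> \<le> (\<integral>\<^sup>+u. (\<integral>\<^sup>+v. (\<integral>\<^sup>+\<omega>. indicator {s..t} v * ennreal ((k u \<omega>)\<^sup>2) + indicator {s..t} u * ennreal ((k v \<omega>)\<^sup>2) \<partial>M) \<partial>lborel) \<partial>lborel)"
    proof (intro nn_integral_mono)
      fix u v \<omega>
      have "ennreal \<bar>k u \<omega> * k v \<omega>\<bar> \<le> ennreal (indicator {s..t} v * (k u \<omega>)\<^sup>2 + indicator {s..t} u * (k v \<omega>)\<^sup>2)"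
        by (intro ennreal_leI prod_bound)
      also have "\<dots> = indicator {s..t} v * ennreal ((k u \<omega>)\<^sup>2) + indicator {s..t} u * ennreal ((k v \<omega>)\<^sup>2)"
        by (auto split: split_indicator)
      finally show "ennreal \<bar>k u \<omega> * k v \<omega>\<bar> \<le> indicator {s..t} v * ennreal ((k u \<omega>)\<^sup>2) + indicator {s..t} u * ennreal ((k v \<omega>)\<^sup>2)" .
    qed
    also have "\<dots> = (\<integral>\<^sup>+u. ennreal (t - s) * (\<integral>\<^sup>+\<omega>. ennreal ((k u \<omega>)\<^sup>2) \<partial>M) \<partial>lborel)
       + (\<integral>\<^sup>+u. indicator {s..t} u * (\<integral>\<^sup>+v. (\<integral>\<^sup>+\<omega>. ennreal ((k v \<omega>)\<^sup>2) \<partial>M) \<partial>lborel) \<partial>lborel)"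
      by (simp add: nn_integral_add nn_integral_cmult nn_integral_multc ind)
    also have "\<dots> = ennreal (t - s) * (\<integral>\<^sup>+u. (\<integral>\<^sup>+\<omega>. ennreal ((k u \<omega>)\<^sup>2) \<partial>M) \<partial>lborel)
       + ennreal (t - s) * (\<integral>\<^sup>+v. (\<integral>\<^sup>+\<omega>. ennreal ((k v \<omega>)\<^sup>2) \<partial>M) \<partial>lborel)"
      by (simp add: nn_integral_cmult nn_integral_multc ind)
    also have "\<dots> < \<infinity>"
      using sqk by (simp add: ennreal_mult_less_top)
    finally show "(\<integral>\<^sup>+p. ennreal (norm (k (fst (fst p)) (snd p) * k (snd (fst p)) (snd p))) \<partial>(P \<Otimes>\<^sub>M M)) < \<infinity>" .
  qed
  define q where "q u v = (\<integral>\<omega>. k u \<omega> * k v \<omega> \<partial>M)" for u v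
  have square: "AE \<omega> in M. (LINT u:{s..t}|lborel. h u \<omega>)\<^sup>2 = (\<integral>p. k (fst p) \<omega> * k (snd p) \<omega> \<partial>P)"
  proof -
    have "(\<integral>\<^sup>+\<omega>. (\<integral>\<^sup>+u. ennreal ((k u \<omega>)\<^sup>2) \<partial>lborel) \<partial>M) < \<infinity>"
      using sqk by (subst LM.Fubini') (auto simp: split_beta')
    then have "AE \<omega> in M. (\<integral>\<^sup>+u. ennreal ((k u \<omega>)\<^sup>2) \<partial>lborel) \<noteq> \<infinity>"
      by (intro nn_integral_PInf_AE) (auto simp: less_top)
    then show ?thesis
    proof (rule AE_mp, intro AE_I2 impI)
      fix \<omega> assume [measurable]: "\<omega> \<in> space M" and fin: "(\<integral>\<^sup>+u. ennreal ((k u \<omega>)\<^sup>2) \<partial>lborel) \<noteq> \<infinity>"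
      have i2: "integrable lborel (\<lambda>u. (k u \<omega>)\<^sup>2)"
        using fin by (intro integrableI_nonneg) (auto simp: less_top)
      \<comment> \<open>square integrability gives integrability, since the time interval is bounded\<close>
      have "integrable lborel (\<lambda>u. indicator {s..t} u + (k u \<omega>)\<^sup>2 :: real)"
        using i2 \<open>s \<le> t\<close> by (intro Bochner_Integration.integrable_add integrable_real_indicator) auto
      then have i1: "integrable lborel (\<lambda>u. k u \<omega>)"
      proof (rule Bochner_Integration.integrable_bound)
        have "\<bar>a\<bar> \<le> 1 + a\<^sup>2" for a :: real
          using zero_le_power2[of "\<bar>a\<bar> - 1"] abs_ge_zero[of a] by (simp add: power2_diff)
        then show "AE u in lborel. norm (k u \<omega>) \<le> norm (indicator {s..t} u + (k u \<omega>)\<^sup>2 :: real)"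
          by (auto simp: k_def split: split_indicator)
      qed simp
      have "integrable P (\<lambda>p. k (fst p) \<omega> * k (snd p) \<omega>)"
        unfolding P_def
        by (rule lborel_pair.Fubini_integrable) (use i1 in \<open>auto simp: abs_mult\<close>)
      then have "(\<integral>p. k (fst p) \<omega> * k (snd p) \<omega> \<partial>P) = (\<integral>u. (\<integral>v. k u \<omega> * k v \<omega> \<partial>lborel) \<partial>lborel)"
        unfolding P_def using lborel_pair.integral_fst'[of "\<lambda>p. k (fst p) \<omega> * k (snd p) \<omega>"] by simp
      also have "\<dots> = (\<integral>u. k u \<omega> \<partial>lborel)\<^sup>2"
        by (simp add: power2_eq_square)
      finally show "(LINT u:{s..t}|lborel. h u \<omega>)\<^sup>2 = (\<integral>p. k (fst p) \<omega> * k (snd p) \<omega> \<partial>P)"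
        by (simp add: set_lebesgue_integral_def k_def)
    qed
  qed
  have "(\<integral>\<^sup>+\<omega>. ennreal ((LINT u:{s..t}|lborel. h u \<omega>)\<^sup>2) \<partial>M)
    = (\<integral>\<^sup>+\<omega>. ennreal (\<integral>p. k (fst p) \<omega> * k (snd p) \<omega> \<partial>P) \<partial>M)"
    by (intro nn_integral_cong_AE) (use square in eventually_elim, simp)
  also have "\<dots> = ennreal (\<integral>\<omega>. (\<integral>p. k (fst p) \<omega> * k (snd p) \<omega> \<partial>P) \<partial>M)"
  proof (rule nn_integral_eq_integral)
    show "integrable M (\<lambda>\<omega>. \<integral>p. k (fst p) \<omega> * k (snd p) \<omega> \<partial>P)"
      using PM.integrable_snd[of "\<lambda>p \<omega>. k (fst p) \<omega> * k (snd p) \<omega>"] int3 by (simp add: split_beta')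
    show "AE \<omega> in M. 0 \<le> (\<integral>p. k (fst p) \<omega> * k (snd p) \<omega> \<partial>P)"
      using square by eventually_elim (metis zero_le_power2)
  qed
  also have "(\<integral>\<omega>. (\<integral>p. k (fst p) \<omega> * k (snd p) \<omega> \<partial>P) \<partial>M) = (\<integral>p. (\<integral>\<omega>. k (fst p) \<omega> * k (snd p) \<omega> \<partial>M) \<partial>P)"
    using PM.Fubini_integral[of "\<lambda>p \<omega>. k (fst p) \<omega> * k (snd p) \<omega>"] int3 by (simp add: split_beta')
  also have "\<dots> = (\<integral>p. q (fst p) (snd p) \<partial>P)"
    by (simp add: q_def split_beta')
  also have "ennreal \<dots> \<le> (\<integral>\<^sup>+p. ennreal (q (fst p) (snd p)) \<partial>P)"
    by (rule integral_le_nn_integral)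
  also have "\<dots> = (\<integral>\<^sup>+u. (\<integral>\<^sup>+v. ennreal (q u v) \<partial>lborel) \<partial>lborel)"
    unfolding P_def by (subst lborel.nn_integral_fst[symmetric]) (auto simp: q_def)
  also have "\<dots> = 2 * (\<integral>\<^sup>+u. (\<integral>\<^sup>+v. ennreal (q u v) * indicator {u<..} v \<partial>lborel) \<partial>lborel)"
    by (rule nn_integral_symmetric_kernel) (auto simp: q_def mult.commute)
  also have "(\<integral>\<^sup>+u. (\<integral>\<^sup>+v. ennreal (q u v) * indicator {u<..} v \<partial>lborel) \<partial>lborel)
    \<le> (\<integral>\<^sup>+u. (\<integral>\<^sup>+v. K u v * indicator {s..t} v \<partial>lborel) * indicator {s..t} u \<partial>lborel)"
  proof (rule nn_integral_mono_AE)
    show "AE u in lborel. (\<integral>\<^sup>+v. ennreal (q u v) * indicator {u<..} v \<partial>lborel)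
      \<le> (\<integral>\<^sup>+v. K u v * indicator {s..t} v \<partial>lborel) * indicator {s..t} u"
      using AE_lborel_singleton[of s]
    proof (rule AE_mp, intro AE_I2 impI)
      fix u assume "u \<noteq> s"
      show "(\<integral>\<^sup>+v. ennreal (q u v) * indicator {u<..} v \<partial>lborel)
        \<le> (\<integral>\<^sup>+v. K u v * indicator {s..t} v \<partial>lborel) * indicator {s..t} u"
      proof (cases "u \<in> {s..t}")
        case True
        then have "AE v in lborel. u < v \<longrightarrow> v \<le> t \<longrightarrow> ennreal (\<integral>\<omega>. h u \<omega> * h v \<omega> \<partial>M) \<le> K u v"
          using \<open>u \<noteq> s\<close> by (intro K) auto
        then have "(\<integral>\<^sup>+v. ennreal (q u v) * indicator {u<..} v \<partial>lborel) \<le> (\<integral>\<^sup>+v. K u v * indicator {s..t} v \<partial>lborel)"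
          using True
          by (intro nn_integral_mono_AE, elim AE_mp, intro AE_I2) (auto simp: q_def k_def split: split_indicator)
        then show ?thesis using True by simp
      qed (simp add: q_def k_def)
    qed
  qed
  finally show ?thesis by (simp add: mult_left_mono)
qed

text \<open>The path is the pointwise limit of its values at the grid points \<open>\<lfloor>(n + 1) t\<rfloor> / (n + 1)\<close>, which take
countably many values.\<close>

lemma jointly_measurable_of_continuous_paths:
  fixes Y :: "real \<Rightarrow> 'a \<Rightarrow> real"
  assumes meas: "\<And>t. Y t \<in> borel_measurable M" and cont: "\<And>\<omega>. continuous_on UNIV (\<lambda>t. Y t \<omega>)"
  shows "(\<lambda>(t, \<omega>). Y t \<omega>) \<in> borel_measurable (borel \<Otimes>\<^sub>M M)"
proof (rule borel_measurable_LIMSEQ_real)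
  define q :: "nat \<Rightarrow> real \<Rightarrow> real" where "q n t = real_of_int \<lfloor>real (Suc n) * t\<rfloor> / real (Suc n)" for n t
  show "(\<lambda>n. (\<lambda>(t, \<omega>). Y (q n t) \<omega>) p) \<longlonglongrightarrow> (\<lambda>(t, \<omega>). Y t \<omega>) p" for p
  proof -
    obtain t \<omega> where p: "p = (t, \<omega>)" by (cases p)
    have "(\<lambda>n. q n t) \<longlonglongrightarrow> t"
    proof (rule tendsto_sandwich)
      show "\<forall>\<^sub>F n in sequentially. t - inverse (real (Suc n)) \<le> q n t"
      proof (intro always_eventually allI)
        fix n
        have "real (Suc n) * t - 1 \<le> real_of_int \<lfloor>real (Suc n) * t\<rfloor>" by linarith
        then have "(real (Suc n) * t - 1) / real (Suc n) \<le> q n t"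
          unfolding q_def by (intro divide_right_mono) auto
        then show "t - inverse (real (Suc n)) \<le> q n t"
          by (simp add: diff_divide_distrib inverse_eq_divide del: of_nat_Suc)
      qed
      show "\<forall>\<^sub>F n in sequentially. q n t \<le> t"
        unfolding q_def by (intro always_eventually allI) (simp add: divide_le_eq mult.commute del: of_nat_Suc)
      show "(\<lambda>n. t - inverse (real (Suc n))) \<longlonglongrightarrow> t"
        using tendsto_diff[OF tendsto_const LIMSEQ_inverse_real_of_nat, of t] by simp
    qed simp
    moreover have "isCont (\<lambda>t. Y t \<omega>) t"
      using cont by (simp add: continuous_on_eq_continuous_at)
    ultimately show ?thesis
      unfolding p by (auto intro: isCont_tendsto_compose)
  qed
  show "(\<lambda>(t, \<omega>). Y (q n t) \<omega>) \<in> borel_measurable (borel \<Otimes>\<^sub>M M)" for n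
  proof -
    have [measurable]: "(\<lambda>p. Y (real_of_int i / real (Suc n)) (snd p)) \<in> borel_measurable (borel \<Otimes>\<^sub>M M)" for i
      using meas by measurable
    have "(\<lambda>p. Y (real_of_int \<lfloor>real (Suc n) * fst p\<rfloor> / real (Suc n)) (snd p)) \<in> borel_measurable (borel \<Otimes>\<^sub>M M)"
      by (rule measurable_compose_countable[where f = "\<lambda>i p. Y (real_of_int i / real (Suc n)) (snd p)"]) measurable
    then show ?thesis by (simp add: q_def split_beta')
  qed
qed

text \<open>The process \<open>X\<close> has continuous paths only almost surely and only for nonnegative times. A version
that is continuous everywhere and on the whole line is jointly measurable, so that Fubini applies.\<close>

locale continuous_version = std_brownian_motion M X
  for M :: "'a measure" and X :: "real \<Rightarrow> 'a \<Rightarrow> real" +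
  fixes Y :: "real \<Rightarrow> 'a \<Rightarrow> real"
  assumes Y_measurable: "\<And>t. Y t \<in> borel_measurable M"
    and Y_continuous: "\<And>\<omega>. continuous_on UNIV (\<lambda>t. Y t \<omega>)"
    and Y_eq: "AE \<omega> in M. \<forall>t\<ge>0. Y t \<omega> = X t \<omega>"

text \<open>The version vanishes identically off an event of full measure on which all paths are continuous.\<close>

lemma (in std_brownian_motion) continuous_version_exists:
  "\<exists>Y. continuous_version M X Y"
proof -
  obtain N where N: "{\<omega> \<in> space M. \<not> continuous_on {0..} (\<lambda>t. X t \<omega>)} \<subseteq> N" "emeasure M N = 0" "N \<in> sets M"
    using continuous_paths by (rule AE_E)
  \<comment> \<open>\<open>max 0 t\<close> freezes the path at negative times\<close>
  define Y where "Y t \<omega> = (if \<omega> \<in> space M - N then X (max 0 t) \<omega> else 0)" for t \<omega>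
  have "AE \<omega> in M. \<omega> \<notin> N"
    using N by (intro AE_not_in) (auto simp: null_sets_def)
  then have eq: "AE \<omega> in M. \<forall>t\<ge>0. Y t \<omega> = X t \<omega>"
    using AE_space by eventually_elim (simp add: Y_def)
  have cont: "continuous_on UNIV (\<lambda>t. Y t \<omega>)" for \<omega>
  proof (cases "\<omega> \<in> space M - N")
    case True
    then have "continuous_on {0..} (\<lambda>t. X t \<omega>)" using N by auto
    then have "continuous_on UNIV (\<lambda>t. X (max 0 t) \<omega>)"
      by (rule continuous_on_compose2) (auto intro!: continuous_intros)
    then show ?thesis using True by (simp add: Y_def)
  next
    case False
    then have "Y t \<omega> = 0" for t by (auto simp: Y_def)
    then show ?thesis by simp
  qed
  have "Y t \<in> borel_measurable M" for t
  proof -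
    have [measurable]: "X (max 0 t) \<in> borel_measurable M" by (rule random_variable_X) simp
    show ?thesis unfolding Y_def using N(3) by measurable
  qed
  then show ?thesis using eq cont by (intro exI[of _ Y]) (unfold_locales; simp)
qed

context continuous_version
begin

lemma Y_jointly_measurable [measurable (raw)]:
  assumes [measurable]: "f \<in> borel_measurable N" "g \<in> N \<rightarrow>\<^sub>M M"
  shows "(\<lambda>w. Y (f w) (g w)) \<in> borel_measurable N"
proof -
  have [measurable]: "(\<lambda>(t, \<omega>). Y t \<omega>) \<in> borel_measurable (borel \<Otimes>\<^sub>M M)"
    by (intro jointly_measurable_of_continuous_paths Y_measurable Y_continuous)
  have "(\<lambda>w. (\<lambda>(t, \<omega>). Y t \<omega>) (f w, g w)) \<in> borel_measurable N" by measurable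
  then show ?thesis by simp
qed

text \<open>The double integral of the covariance bound: each of its two singularities integrates in \<open>v\<close> to at
most \<open>2 (t - s) powr (1/2 - \<gamma>) / (1/2 - \<gamma>)\<close>, and \<open>1/\<surd>u\<close> integrates to \<open>2 (\<surd>t - \<surd>s)\<close>. With the factor \<open>6\<close> of the
covariance and the factor \<open>2\<close> from symmetry the constant is \<open>96\<close>.\<close>

lemma second_moment_discrepancy_integral:
  assumes st: "0 \<le> s" "s \<le> t" and \<epsilon>: "0 < \<epsilon>" and \<eta>: "0 < \<eta>" "\<eta> \<le> sqrt \<epsilon>" and \<gamma>: "0 < \<gamma>" "\<gamma> < 1/2"
  shows "(\<integral>\<^sup>+\<omega>. ennreal ((LINT u:{s..t}|lborel. discrepancy \<epsilon> \<eta> x (Y u \<omega>) (Y (u + \<epsilon>) \<omega>))\<^sup>2) \<partial>M)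
    \<le> ennreal (96 / (1/2 - \<gamma>) * \<epsilon> powr \<gamma> * (t - s) powr (1/2 - \<gamma>) * (sqrt t - sqrt s))"
proof -
  define \<beta> where "\<beta> = 1/2 + \<gamma>"
  have \<beta>: "0 < \<beta>" "\<beta> < 1" "1 - \<beta> = 1/2 - \<gamma>" using \<gamma> by (auto simp: \<beta>_def)
  define h where "h u \<omega> = discrepancy \<epsilon> \<eta> x (Y u \<omega>) (Y (u + \<epsilon>) \<omega>)" for u \<omega>
  define K where "K u v = ennreal (6 * \<epsilon> powr \<gamma>) * ennreal (1 / sqrt u)
    * (ennreal (\<bar>v - u\<bar> powr - \<beta>) + ennreal (\<bar>v - (u + \<epsilon>)\<bar> powr - \<beta>))" for u v
  define B where "B = 2 * (t - s) powr (1 - \<beta>) / (1 - \<beta>)"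
  have B: "0 \<le> B" using st \<beta> by (simp add: B_def)
  have h_eq: "AE \<omega> in M. h u \<omega> = discrepancy \<epsilon> \<eta> x (X u \<omega>) (X (u + \<epsilon>) \<omega>)" if "0 \<le> u" for u
    using Y_eq by eventually_elim (use that \<epsilon> in \<open>simp add: h_def\<close>)
  have hm [measurable]: "(\<lambda>(u, \<omega>). h u \<omega>) \<in> borel_measurable (borel \<Otimes>\<^sub>M M)"
    unfolding h_def by measurable
  have XM [measurable]: "X u \<in> borel_measurable M" if "0 < u" for u
    using that by (auto intro: random_variable_X)
  have "(\<integral>\<^sup>+\<omega>. ennreal ((LINT u:{s..t}|lborel. h u \<omega>)\<^sup>2) \<partial>M)
    \<le> 2 * (\<integral>\<^sup>+u. (\<integral>\<^sup>+v. K u v * indicator {s..t} v \<partial>lborel) * indicator {s..t} u \<partial>lborel)"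
  proof (rule second_moment_time_integral[OF hm \<open>s \<le> t\<close>])
    have "(\<integral>\<^sup>+u. (\<integral>\<^sup>+\<omega>. ennreal ((h u \<omega>)\<^sup>2) \<partial>M) * indicator {s..t} u \<partial>lborel)
      \<le> (\<integral>\<^sup>+u. ennreal (2 / sqrt \<epsilon>) * (ennreal (1 / sqrt u) * indicator {s..t} u)
            + ennreal ((1 / (2 * \<eta>))\<^sup>2) * indicator {s..t} u \<partial>lborel)"
    proof (rule nn_integral_mono_AE)
      show "AE u in lborel. (\<integral>\<^sup>+\<omega>. ennreal ((h u \<omega>)\<^sup>2) \<partial>M) * indicator {s..t} u
        \<le> ennreal (2 / sqrt \<epsilon>) * (ennreal (1 / sqrt u) * indicator {s..t} u)
            + ennreal ((1 / (2 * \<eta>))\<^sup>2) * indicator {s..t} u"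
        using AE_lborel_singleton[of 0]
      proof (rule AE_mp, intro AE_I2 impI)
        fix u :: real assume "u \<noteq> 0"
        show "(\<integral>\<^sup>+\<omega>. ennreal ((h u \<omega>)\<^sup>2) \<partial>M) * indicator {s..t} u
          \<le> ennreal (2 / sqrt \<epsilon>) * (ennreal (1 / sqrt u) * indicator {s..t} u)
            + ennreal ((1 / (2 * \<eta>))\<^sup>2) * indicator {s..t} u"
        proof (cases "u \<in> {s..t}")
          case True
          then have u: "0 < u" using st \<open>u \<noteq> 0\<close> by auto
          have "(\<integral>\<^sup>+\<omega>. ennreal ((h u \<omega>)\<^sup>2) \<partial>M)
            = (\<integral>\<^sup>+\<omega>. ennreal ((discrepancy \<epsilon> \<eta> x (X u \<omega>) (X (u + \<epsilon>) \<omega>))\<^sup>2) \<partial>M)"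
          proof (rule nn_integral_cong_AE)
            show "AE \<omega> in M. ennreal ((h u \<omega>)\<^sup>2) = ennreal ((discrepancy \<epsilon> \<eta> x (X u \<omega>) (X (u + \<epsilon>) \<omega>))\<^sup>2)"
              using h_eq[OF less_imp_le[OF u]] by eventually_elim simp
          qed
          also have "\<dots> \<le> ennreal (2 / (sqrt \<epsilon> * sqrt u) + (1 / (2 * \<eta>))\<^sup>2)"
            by (rule discrepancy_square_bound[OF u \<epsilon> \<eta>(1)])
          also have "\<dots> = ennreal (2 / sqrt \<epsilon>) * ennreal (1 / sqrt u) + ennreal ((1 / (2 * \<eta>))\<^sup>2)"
            using u \<epsilon> by (simp add: ennreal_mult[symmetric] ennreal_plus[symmetric] del: ennreal_plus)
          finally show ?thesis using True by simp
        qed simp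
      qed
    qed
    also have "\<dots> = ennreal (2 / sqrt \<epsilon>) * ennreal (2 * (sqrt t - sqrt s)) + ennreal ((1 / (2 * \<eta>))\<^sup>2) * ennreal (t - s)"
      using st by (simp add: nn_integral_add nn_integral_cmult nn_integral_inverse_sqrt)
    also have "\<dots> < \<infinity>" by (simp add: ennreal_mult_less_top)
    finally show "(\<integral>\<^sup>+u. (\<integral>\<^sup>+\<omega>. ennreal ((h u \<omega>)\<^sup>2) \<partial>M) * indicator {s..t} u \<partial>lborel) < \<infinity>" .
  next
    fix u assume "s < u" "u \<le> t"
    then have u: "0 < u" using st by simp
    show "AE v in lborel. u < v \<longrightarrow> v \<le> t \<longrightarrow> ennreal (\<integral>\<omega>. h u \<omega> * h v \<omega> \<partial>M) \<le> K u v"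
      using AE_lborel_singleton[of "u + \<epsilon>"]
    proof (rule AE_mp, intro AE_I2 impI)
      fix v assume v: "v \<noteq> u + \<epsilon>" "u < v"
      have [measurable]: "X u \<in> borel_measurable M" "X (u + \<epsilon>) \<in> borel_measurable M"
        "X v \<in> borel_measurable M" "X (v + \<epsilon>) \<in> borel_measurable M"
        using u v \<epsilon> by auto
      have "(\<integral>\<omega>. h u \<omega> * h v \<omega> \<partial>M)
        = (\<integral>\<omega>. discrepancy \<epsilon> \<eta> x (X u \<omega>) (X (u + \<epsilon>) \<omega>) * discrepancy \<epsilon> \<eta> x (X v \<omega>) (X (v + \<epsilon>) \<omega>) \<partial>M)"
      proof (rule integral_cong_AE)
        show "(\<lambda>\<omega>. h u \<omega> * h v \<omega>) \<in> borel_measurable M" unfolding h_def by measurable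
        show "AE \<omega> in M. h u \<omega> * h v \<omega>
          = discrepancy \<epsilon> \<eta> x (X u \<omega>) (X (u + \<epsilon>) \<omega>) * discrepancy \<epsilon> \<eta> x (X v \<omega>) (X (v + \<epsilon>) \<omega>)"
          using h_eq[of u, OF less_imp_le[OF u]] h_eq[of v, OF less_imp_le[OF less_trans[OF u v(2)]]]
          by eventually_elim simp
      qed measurable
      also have "\<dots> \<le> 6 * \<epsilon> powr \<gamma> * (1 / sqrt u) * (\<bar>v - u\<bar> powr - \<beta> + \<bar>v - (u + \<epsilon>)\<bar> powr - \<beta>)"
        unfolding \<beta>_def using u v \<epsilon> \<eta> \<gamma> by (intro discrepancy_covariance_bound) auto
      finally have "ennreal (\<integral>\<omega>. h u \<omega> * h v \<omega> \<partial>M)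
        \<le> ennreal (6 * \<epsilon> powr \<gamma> * (1 / sqrt u) * (\<bar>v - u\<bar> powr - \<beta> + \<bar>v - (u + \<epsilon>)\<bar> powr - \<beta>))"
        by (rule ennreal_leI)
      also have "\<dots> = K u v"
        unfolding K_def using u by (subst ennreal_mult, simp, simp, subst ennreal_mult, simp, simp, subst ennreal_plus) auto
      finally show "ennreal (\<integral>\<omega>. h u \<omega> * h v \<omega> \<partial>M) \<le> K u v" .
    qed
  qed
  also have "(\<integral>\<^sup>+u. (\<integral>\<^sup>+v. K u v * indicator {s..t} v \<partial>lborel) * indicator {s..t} u \<partial>lborel)
    \<le> (\<integral>\<^sup>+u. (ennreal (6 * \<epsilon> powr \<gamma>) * ennreal (2 * B)) * (ennreal (1 / sqrt u) * indicator {s..t} u) \<partial>lborel)"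
  proof (intro nn_integral_mono)
    fix u
    have "(\<integral>\<^sup>+v. K u v * indicator {s..t} v \<partial>lborel)
      = (\<integral>\<^sup>+v. (ennreal (6 * \<epsilon> powr \<gamma>) * ennreal (1 / sqrt u))
        * (ennreal (\<bar>v - u\<bar> powr - \<beta>) * indicator {s..t} v + ennreal (\<bar>v - (u + \<epsilon>)\<bar> powr - \<beta>) * indicator {s..t} v) \<partial>lborel)"
      unfolding K_def by (intro nn_integral_cong) (simp add: algebra_simps)
    also have "\<dots> = (ennreal (6 * \<epsilon> powr \<gamma>) * ennreal (1 / sqrt u))
      * ((\<integral>\<^sup>+v. ennreal (\<bar>v - u\<bar> powr - \<beta>) * indicator {s..t} v \<partial>lborel)
         + (\<integral>\<^sup>+v. ennreal (\<bar>v - (u + \<epsilon>)\<bar> powr - \<beta>) * indicator {s..t} v \<partial>lborel))"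
      by (subst nn_integral_cmult, measurable, subst nn_integral_add) auto
    also have "\<dots> \<le> (ennreal (6 * \<epsilon> powr \<gamma>) * ennreal (1 / sqrt u)) * (ennreal B + ennreal B)"
      unfolding B_def by (intro mult_left_mono add_mono nn_integral_abs_powr st \<beta>) simp
    also have "\<dots> = (ennreal (6 * \<epsilon> powr \<gamma>) * ennreal (2 * B)) * ennreal (1 / sqrt u)"
      using B by (simp add: ennreal_plus[symmetric] mult_ac del: ennreal_plus)
    finally show "(\<integral>\<^sup>+v. K u v * indicator {s..t} v \<partial>lborel) * indicator {s..t} u
      \<le> (ennreal (6 * \<epsilon> powr \<gamma>) * ennreal (2 * B)) * (ennreal (1 / sqrt u) * indicator {s..t} u)"
      by (simp add: mult_right_mono mult.assoc[symmetric])
  qed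
  also have "\<dots> = ennreal (6 * \<epsilon> powr \<gamma>) * ennreal (2 * B) * ennreal (2 * (sqrt t - sqrt s))"
    using st by (simp add: nn_integral_cmult nn_integral_inverse_sqrt)
  also have "2 * (ennreal (6 * \<epsilon> powr \<gamma>) * ennreal (2 * B) * ennreal (2 * (sqrt t - sqrt s)))
    = ennreal (2 * (6 * \<epsilon> powr \<gamma> * (2 * B) * (2 * (sqrt t - sqrt s))))"
    proof -
    have "2 * (ennreal a * ennreal b * ennreal c) = ennreal (2 * (a * b * c))" if "0 \<le> a" "0 \<le> b" "0 \<le> c" for a b c
      using that by (simp add: ennreal_mult)
    then show ?thesis using B st by simp
  qed
  also have "2 * (6 * \<epsilon> powr \<gamma> * (2 * B) * (2 * (sqrt t - sqrt s)))
    = 96 / (1/2 - \<gamma>) * \<epsilon> powr \<gamma> * (t - s) powr (1/2 - \<gamma>) * (sqrt t - sqrt s)"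
    by (simp add: B_def \<beta>(3))
  finally show ?thesis
    by (simp add: h_def mult_left_mono)
qed

text \<open>The covariance of the window kernels at times \<open>u < v\<close> is at most \<open>1/(\<surd>u \<surd>(v - u))\<close>, whatever the width.\<close>

lemma second_moment_window_integral:
  assumes st: "0 \<le> s" "s \<le> t" and \<eta>: "0 < \<eta>"
  shows "(\<integral>\<^sup>+\<omega>. ennreal ((LINT u:{s..t}|lborel. window \<eta> x (Y u \<omega>))\<^sup>2) \<partial>M)
    \<le> ennreal (16 * sqrt (t - s) * (sqrt t - sqrt s))"
proof -
  define K where "K u v = ennreal (1 / sqrt u) * ennreal (\<bar>v - u\<bar> powr - (1/2))" for u v :: real
  define B where "B = 4 * sqrt (t - s)"
  have B: "0 \<le> B" using st by (simp add: B_def)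
  have gm [measurable]: "(\<lambda>(u, \<omega>). window \<eta> x (Y u \<omega>)) \<in> borel_measurable (borel \<Otimes>\<^sub>M M)"
    by measurable
  have "(\<integral>\<^sup>+\<omega>. ennreal ((LINT u:{s..t}|lborel. window \<eta> x (Y u \<omega>))\<^sup>2) \<partial>M)
    \<le> 2 * (\<integral>\<^sup>+u. (\<integral>\<^sup>+v. K u v * indicator {s..t} v \<partial>lborel) * indicator {s..t} u \<partial>lborel)"
  proof (rule second_moment_time_integral[OF gm \<open>s \<le> t\<close>])
    have "(\<integral>\<^sup>+u. (\<integral>\<^sup>+\<omega>. ennreal ((window \<eta> x (Y u \<omega>))\<^sup>2) \<partial>M) * indicator {s..t} u \<partial>lborel)
      \<le> (\<integral>\<^sup>+u. (\<integral>\<^sup>+\<omega>. ennreal ((1 / (2 * \<eta>))\<^sup>2) \<partial>M) * indicator {s..t} u \<partial>lborel)"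
      using \<eta> by (intro nn_integral_mono mult_right_mono ennreal_leI power_mono window_le window_nonneg) auto
    also have "\<dots> = ennreal ((1 / (2 * \<eta>))\<^sup>2) * ennreal (t - s)"
      using st by (simp add: emeasure_space_1 nn_integral_cmult)
    also have "\<dots> < \<infinity>" by (simp add: ennreal_mult_less_top)
    finally show "(\<integral>\<^sup>+u. (\<integral>\<^sup>+\<omega>. ennreal ((window \<eta> x (Y u \<omega>))\<^sup>2) \<partial>M) * indicator {s..t} u \<partial>lborel) < \<infinity>" .
  next
    fix u assume "s < u" "u \<le> t"
    then have u: "0 < u" using st by simp
    have "ennreal (\<integral>\<omega>. window \<eta> x (Y u \<omega>) * window \<eta> x (Y v \<omega>) \<partial>M) \<le> K u v" if "u < v" for v
    proof -
      have "ennreal (\<integral>\<omega>. window \<eta> x (Y u \<omega>) * window \<eta> x (Y v \<omega>) \<partial>M)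
        \<le> (\<integral>\<^sup>+\<omega>. ennreal (window \<eta> x (Y u \<omega>) * window \<eta> x (Y v \<omega>)) \<partial>M)"
        by (rule integral_le_nn_integral)
      also have "\<dots> = (\<integral>\<^sup>+\<omega>. ennreal (window \<eta> x (X u \<omega>) * window \<eta> x (X v \<omega>)) \<partial>M)"
      proof (rule nn_integral_cong_AE)
        show "AE \<omega> in M. ennreal (window \<eta> x (Y u \<omega>) * window \<eta> x (Y v \<omega>))
          = ennreal (window \<eta> x (X u \<omega>) * window \<eta> x (X v \<omega>))"
          using Y_eq by eventually_elim (use u that in simp)
      qed
      also have "\<dots> \<le> ennreal (1 / (sqrt u * sqrt (v - u)))"
        by (rule nn_integral_window_window[OF u that \<eta>])
      also have "\<dots> = K u v"
        using u that unfolding K_def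
        by (simp add: ennreal_mult[symmetric] powr_minus powr_half_sqrt inverse_eq_divide)
      finally show ?thesis .
    qed
    then show "AE v in lborel. u < v \<longrightarrow> v \<le> t \<longrightarrow> ennreal (\<integral>\<omega>. window \<eta> x (Y u \<omega>) * window \<eta> x (Y v \<omega>) \<partial>M) \<le> K u v"
      by auto
  qed
  also have "(\<integral>\<^sup>+u. (\<integral>\<^sup>+v. K u v * indicator {s..t} v \<partial>lborel) * indicator {s..t} u \<partial>lborel)
    \<le> (\<integral>\<^sup>+u. ennreal B * (ennreal (1 / sqrt u) * indicator {s..t} u) \<partial>lborel)"
  proof (intro nn_integral_mono)
    fix u
    have "(\<integral>\<^sup>+v. K u v * indicator {s..t} v \<partial>lborel)
      = ennreal (1 / sqrt u) * (\<integral>\<^sup>+v. ennreal (\<bar>v - u\<bar> powr - (1/2)) * indicator {s..t} v \<partial>lborel)"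
      unfolding K_def by (subst nn_integral_cmult[symmetric]) (auto simp: mult_ac)
    also have "\<dots> \<le> ennreal (1 / sqrt u) * ennreal B"
      using nn_integral_abs_powr[OF \<open>s \<le> t\<close>, of "1/2" u] st
      by (intro mult_left_mono) (auto simp: B_def powr_half_sqrt)
    finally show "(\<integral>\<^sup>+v. K u v * indicator {s..t} v \<partial>lborel) * indicator {s..t} u
      \<le> ennreal B * (ennreal (1 / sqrt u) * indicator {s..t} u)"
      by (auto simp: mult_ac split: split_indicator)
  qed
  also have "\<dots> = ennreal B * ennreal (2 * (sqrt t - sqrt s))"
    using st by (simp add: nn_integral_cmult nn_integral_inverse_sqrt)
  also have "2 * (ennreal B * ennreal (2 * (sqrt t - sqrt s))) = ennreal (2 * (B * (2 * (sqrt t - sqrt s))))"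
    using B st by (simp add: ennreal_mult)
  also have "2 * (B * (2 * (sqrt t - sqrt s))) = 16 * sqrt (t - s) * (sqrt t - sqrt s)"
    by (simp add: B_def)
  finally show ?thesis
    by (simp add: mult_left_mono)
qed

end

section \<open>From the occupation formula to local times\<close>

lemma set_integral_split_at:
  fixes f :: "real \<Rightarrow> real"
  assumes st: "a \<le> s" "s \<le> t" and int: "set_integrable lborel {a..t} f"
  shows "(LINT u:{a..t}|lborel. f u) = (LINT u:{a..s}|lborel. f u) + (LINT u:{s..t}|lborel. f u)"
proof -
  have "(LINT u:{a..s} \<union> {s..t}|lborel. f u) = (LINT u:{a..s}|lborel. f u) + (LINT u:{s..t}|lborel. f u)"
  proof (rule set_integral_Un_AE)
    show "AE u in lborel. \<not> (u \<in> {a..s} \<and> u \<in> {s..t})"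
      using AE_lborel_singleton[of s] by eventually_elim auto
  qed (use st in \<open>auto intro: set_integrable_subset[OF int]\<close>)
  moreover have "{a..s} \<union> {s..t} = {a..t}" using st by auto
  ultimately show ?thesis by simp
qed

lemma abs_crossing_le: "\<bar>crossing x a b\<bar> \<le> \<bar>b - a\<bar>"
  by (auto simp: crossing_def split: split_indicator)

lemma crossing_path_integrable:
  fixes y :: "real \<Rightarrow> real"
  assumes y: "continuous_on UNIV y"
  shows "set_integrable lborel {s..t} (\<lambda>u. crossing x (y u) (y (u + \<epsilon>)))"
proof -
  have [measurable]: "y \<in> borel_measurable borel"
    by (rule borel_measurable_continuous_onI[OF y])
  have "continuous_on UNIV (\<lambda>u. y (u + \<epsilon>))"
    by (rule continuous_on_compose2[OF y]) (auto intro!: continuous_intros)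
  then have "continuous_on {s..t} (\<lambda>u. \<bar>y (u + \<epsilon>) - y u\<bar>)"
    using y by (auto intro!: continuous_intros intro: continuous_on_subset)
  then have "set_integrable lborel {s..t} (\<lambda>u. \<bar>y (u + \<epsilon>) - y u\<bar>)"
    by (rule borel_integrable_atLeastAtMost')
  then show ?thesis
  proof (rule set_integrable_bound)
    show "set_borel_measurable lborel {s..t} (\<lambda>u. crossing x (y u) (y (u + \<epsilon>)))"
      unfolding set_borel_measurable_def by measurable
  qed (auto intro: abs_crossing_le)
qed

lemma window_path_integrable:
  fixes y :: "real \<Rightarrow> real"
  assumes y: "continuous_on UNIV y" and \<eta>: "0 < \<eta>"
  shows "set_integrable lborel {s..t} (\<lambda>u. window \<eta> x (y u))"
proof -
  have [measurable]: "y \<in> borel_measurable borel"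
    by (rule borel_measurable_continuous_onI[OF y])
  have "set_integrable lborel {s..t} (\<lambda>u. 1 / (2 * \<eta>))"
    by (rule borel_integrable_atLeastAtMost') simp
  then show ?thesis
  proof (rule set_integrable_bound)
    show "set_borel_measurable lborel {s..t} (\<lambda>u. window \<eta> x (y u))"
      unfolding set_borel_measurable_def by measurable
  qed (use \<eta> in \<open>auto simp: window_nonneg window_le\<close>)
qed

lemma nn_integral_window_lborel:
  assumes "0 < \<eta>" shows "(\<integral>\<^sup>+z. ennreal (window \<eta> x z) \<partial>lborel) = 1"
proof -
  have "(\<integral>\<^sup>+z. ennreal (window \<eta> x z) \<partial>lborel) = (\<integral>\<^sup>+z. ennreal (1 / (2 * \<eta>)) * indicator {x - \<eta><..x + \<eta>} z \<partial>lborel)"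
    by (intro nn_integral_cong) (auto simp: window_def split: split_indicator)
  also have "\<dots> = 1"
    using assms by (simp add: nn_integral_cmult ennreal_mult[symmetric])
  finally show ?thesis .
qed

text \<open>By the occupation formula the time integral is the mean of \<open>l\<close> over a window shrinking to \<open>x\<close>.\<close>

lemma window_occupation_tendsto:
  fixes y l :: "real \<Rightarrow> real"
  assumes y: "continuous_on UNIV y" and t: "0 \<le> t"
    and cont: "isCont l x" and nonneg: "\<And>z. 0 \<le> l z"
    and occ: "\<And>g :: real \<Rightarrow> ennreal. g \<in> borel_measurable borel \<Longrightarrow>
      (\<integral>\<^sup>+u\<in>{0..t}. g (y u) \<partial>lborel) = (\<integral>\<^sup>+z. g z * ennreal (l z) \<partial>lborel)"
    and \<eta>: "\<And>n. 0 < \<eta> n" "\<eta> \<longlonglongrightarrow> 0"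
  shows "(\<lambda>n. LINT u:{0..t}|lborel. window (\<eta> n) x (y u)) \<longlonglongrightarrow> l x"
proof (rule LIMSEQ_I)
  fix r :: real assume "0 < r"
  define e where "e = r / 2"
  have e: "0 < e" "e < r" using \<open>0 < r\<close> by (auto simp: e_def)
  obtain d where d: "0 < d" "\<And>z. \<bar>z - x\<bar> < d \<Longrightarrow> \<bar>l z - l x\<bar> < e"
    using cont \<open>0 < e\<close> unfolding continuous_at_eps_delta dist_real_def by blast
  obtain N where N: "\<And>n. n \<ge> N \<Longrightarrow> \<bar>\<eta> n\<bar> < d"
    using LIMSEQ_D[OF \<eta>(2) d(1)] by auto
  have "norm ((LINT u:{0..t}|lborel. window (\<eta> n) x (y u)) - l x) < r" if "n \<ge> N" for n
  proof -
    define A where "A = (LINT u:{0..t}|lborel. window (\<eta> n) x (y u))"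
    have \<eta>n: "0 < \<eta> n" "\<eta> n < d" using \<eta>(1)[of n] N[OF that] by auto
    have near: "\<bar>l z - l x\<bar> \<le> e" if "window (\<eta> n) x z \<noteq> 0" for z
    proof -
      have "\<bar>z - x\<bar> \<le> \<eta> n" using that by (auto simp: window_def abs_le_iff indicator_def split: if_splits)
      then show ?thesis using d(2)[of z] \<eta>n by simp
    qed
    have A0: "0 \<le> A"
      unfolding A_def set_lebesgue_integral_def
      using window_nonneg[OF \<eta>n(1)] by (intro Bochner_Integration.integral_nonneg) (simp add: scaleR_nonneg_nonneg)
    have "ennreal A = (\<integral>\<^sup>+u\<in>{0..t}. ennreal (window (\<eta> n) x (y u)) \<partial>lborel)"
      unfolding A_def set_lebesgue_integral_def
      using window_path_integrable[OF y \<eta>n(1), of 0 t x] window_nonneg[OF \<eta>n(1)]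
      unfolding set_integrable_def
      by (subst nn_integral_eq_integral[symmetric])
         (auto intro!: nn_integral_cong split: split_indicator simp: scaleR_nonneg_nonneg)
    also have "\<dots> = (\<integral>\<^sup>+z. ennreal (window (\<eta> n) x z) * ennreal (l z) \<partial>lborel)"
      by (rule occ) simp
    finally have A: "ennreal A = (\<integral>\<^sup>+z. ennreal (window (\<eta> n) x z) * ennreal (l z) \<partial>lborel)" .
    have weigh: "(\<integral>\<^sup>+z. ennreal (window (\<eta> n) x z) * c \<partial>lborel) = c" for c
      by (simp add: nn_integral_multc nn_integral_window_lborel[OF \<eta>n(1)])
    have "ennreal A \<le> (\<integral>\<^sup>+z. ennreal (window (\<eta> n) x z) * ennreal (l x + e) \<partial>lborel)"
      unfolding A
    proof (intro nn_integral_mono)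
      fix z
      show "ennreal (window (\<eta> n) x z) * ennreal (l z) \<le> ennreal (window (\<eta> n) x z) * ennreal (l x + e)"
        using near[of z] by (cases "window (\<eta> n) x z = 0") (auto intro!: mult_left_mono ennreal_leI)
    qed
    then have up: "A \<le> l x + e"
      using nonneg[of x] e by (simp add: weigh ennreal_le_iff del: ennreal_plus)
    have "(\<integral>\<^sup>+z. ennreal (window (\<eta> n) x z) * ennreal (l x - e) \<partial>lborel) \<le> ennreal A"
      unfolding A
    proof (intro nn_integral_mono)
      fix z
      show "ennreal (window (\<eta> n) x z) * ennreal (l x - e) \<le> ennreal (window (\<eta> n) x z) * ennreal (l z)"
        using near[of z] by (cases "window (\<eta> n) x z = 0") (auto intro!: mult_left_mono ennreal_leI)
    qed
    then have "l x - e \<le> A"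
      unfolding weigh using A0 by (auto simp: ennreal_le_iff2)
    with up e show ?thesis by (simp add: A_def)
  qed
  then show "\<exists>N. \<forall>n\<ge>N. norm ((LINT u:{0..t}|lborel. window (\<eta> n) x (y u)) - l x) < r"
    by blast
qed

text \<open>Fatou's lemma, applied to the squares.\<close>

lemma second_moment_limit:
  fixes Z :: "nat \<Rightarrow> 'a \<Rightarrow> real"
  assumes [measurable]: "\<And>n. Z n \<in> borel_measurable M"
    and lim: "AE \<omega> in M. (\<lambda>n. Z n \<omega>) \<longlonglongrightarrow> W \<omega>"
    and bound: "\<And>n. (\<integral>\<^sup>+\<omega>. ennreal ((Z n \<omega>)\<^sup>2) \<partial>M) \<le> c"
  shows "(\<integral>\<^sup>+\<omega>. ennreal ((W \<omega>)\<^sup>2) \<partial>M) \<le> c"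
proof -
  have "(\<integral>\<^sup>+\<omega>. ennreal ((W \<omega>)\<^sup>2) \<partial>M) = (\<integral>\<^sup>+\<omega>. liminf (\<lambda>n. ennreal ((Z n \<omega>)\<^sup>2)) \<partial>M)"
  proof (rule nn_integral_cong_AE)
    show "AE \<omega> in M. ennreal ((W \<omega>)\<^sup>2) = liminf (\<lambda>n. ennreal ((Z n \<omega>)\<^sup>2))"
      using lim
    proof eventually_elim
      fix \<omega> assume "(\<lambda>n. Z n \<omega>) \<longlonglongrightarrow> W \<omega>"
      then have "(\<lambda>n. ennreal ((Z n \<omega>)\<^sup>2)) \<longlonglongrightarrow> ennreal ((W \<omega>)\<^sup>2)"
        by (intro tendsto_intros)
      then show "ennreal ((W \<omega>)\<^sup>2) = liminf (\<lambda>n. ennreal ((Z n \<omega>)\<^sup>2))"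
        by (intro lim_imp_Liminf[symmetric]) auto
    qed
  qed
  also have "\<dots> \<le> liminf (\<lambda>n. \<integral>\<^sup>+\<omega>. ennreal ((Z n \<omega>)\<^sup>2) \<partial>M)"
    by (rule nn_integral_liminf) measurable
  also have "\<dots> \<le> liminf (\<lambda>n::nat. c)"
    by (intro Liminf_mono always_eventually allI bound)
  finally show ?thesis by (simp add: Liminf_const)
qed

locale local_time_setting = continuous_version M X Y
  for M :: "'a measure" and X Y :: "real \<Rightarrow> 'a \<Rightarrow> real" +
  fixes L :: "real \<Rightarrow> real \<Rightarrow> 'a \<Rightarrow> real" and x :: real
  assumes L: "local_time_family M X L"
begin

text \<open>The functional \<^const>\<open>J\<close> of the continuous version, which is measurable in \<open>\<omega>\<close> and continuous in time.\<close>

definition J_version :: "real \<Rightarrow> real \<Rightarrow> 'a \<Rightarrow> real" where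
  "J_version \<epsilon> t \<omega> = (LINT u:{0..t}|lborel. crossing x (Y u \<omega>) (Y (u + \<epsilon>) \<omega>) / \<epsilon>)"

text \<open>The almost sure event on which all the pathwise arguments take place.\<close>

definition regular :: "'a \<Rightarrow> bool" where
  "regular \<omega> \<longleftrightarrow> (\<forall>t\<ge>0. Y t \<omega> = X t \<omega>) \<and> (\<forall>t\<ge>0. isCont (\<lambda>z. L t z \<omega>) x)
     \<and> continuous_on {0..} (\<lambda>t. L t x \<omega>) \<and> (\<forall>t\<ge>0. \<forall>z. 0 \<le> L t z \<omega>)
     \<and> (\<forall>t\<ge>0. \<forall>g :: real \<Rightarrow> ennreal. g \<in> borel_measurable borel \<longrightarrow>
           (\<integral>\<^sup>+u\<in>{0..t}. g (Y u \<omega>) \<partial>lborel) = (\<integral>\<^sup>+z. g z * ennreal (L t z \<omega>) \<partial>lborel))"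

lemma L_measurable [measurable]: "0 \<le> t \<Longrightarrow> L t z \<in> borel_measurable M"
  using L by (auto simp: local_time_family_def)

lemma AE_regular: "AE \<omega> in M. regular \<omega>"
proof -
  have "AE \<omega> in M. continuous_on ({0..} \<times> UNIV) (\<lambda>(t, x). L t x \<omega>) \<and>
        (\<forall>t\<ge>0. \<forall>x. 0 \<le> L t x \<omega>) \<and>
        (\<forall>t\<ge>0. \<forall>g :: real \<Rightarrow> ennreal. g \<in> borel_measurable borel \<longrightarrow>
           (\<integral>\<^sup>+ s\<in>{0..t}. g (X s \<omega>) \<partial>lborel) = (\<integral>\<^sup>+ x. g x * ennreal (L t x \<omega>) \<partial>lborel))"
    using L by (simp add: local_time_family_def)
  with Y_eq show ?thesis
  proof eventually_elim
    case (elim \<omega>)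
    then have cont: "continuous_on ({0..} \<times> UNIV) (\<lambda>(t, x). L t x \<omega>)" by blast
    have "continuous_on UNIV (\<lambda>z. (\<lambda>(t, x). L t x \<omega>) (t, z))" if "0 \<le> t" for t
      by (rule continuous_on_compose2[OF cont]) (use that in \<open>auto intro!: continuous_intros\<close>)
    then have c1: "isCont (\<lambda>z. L t z \<omega>) x" if "0 \<le> t" for t
      using that by (simp add: continuous_on_eq_continuous_at)
    have "continuous_on {0..} (\<lambda>t. (\<lambda>(t, x). L t x \<omega>) (t, x))"
      by (rule continuous_on_compose2[OF cont]) (auto intro!: continuous_intros)
    then have c2: "continuous_on {0..} (\<lambda>t. L t x \<omega>)" by simp
    have occ: "(\<integral>\<^sup>+u\<in>{0..t}. g (Y u \<omega>) \<partial>lborel) = (\<integral>\<^sup>+z. g z * ennreal (L t z \<omega>) \<partial>lborel)"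
      if "0 \<le> t" "g \<in> borel_measurable borel" for t and g :: "real \<Rightarrow> ennreal"
    proof -
      have "(\<integral>\<^sup>+u\<in>{0..t}. g (Y u \<omega>) \<partial>lborel) = (\<integral>\<^sup>+u\<in>{0..t}. g (X u \<omega>) \<partial>lborel)"
        using elim by (intro nn_integral_cong) (auto split: split_indicator)
      then show ?thesis using elim that by simp
    qed
    show ?case
      unfolding regular_def using elim c1 c2 occ by blast
  qed
qed

lemma J_eq_J_version:
  assumes "regular \<omega>" "0 \<le> t" "0 < \<epsilon>"
  shows "J X \<epsilon> t x \<omega> = J_version \<epsilon> t \<omega>"
proof -
  have "(LINT u:{0..t}|lborel. (indicator {x<..} (X (u + \<epsilon>) \<omega>) - indicator {x<..} (X u \<omega>)) * (X (u + \<epsilon>) \<omega> - X u \<omega>))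
    = (LINT u:{0..t}|lborel. crossing x (Y u \<omega>) (Y (u + \<epsilon>) \<omega>))"
    using assms by (intro set_lebesgue_integral_cong) (auto simp: crossing_def regular_def)
  then show ?thesis
    by (simp add: J_def J_version_def)
qed

lemma J_version_measurable [measurable]: "J_version \<epsilon> t \<in> borel_measurable M"
  unfolding J_version_def[abs_def] set_lebesgue_integral_def by measurable

lemma J_version_integrable: "set_integrable lborel {s..t} (\<lambda>u. crossing x (Y u \<omega>) (Y (u + \<epsilon>) \<omega>) / \<epsilon>)"
  by (intro set_integrable_divide crossing_path_integrable Y_continuous)

lemma J_version_0: "J_version \<epsilon> 0 \<omega> = 0"
proof -
  have "AE u in lborel. indicator {0..0} u *\<^sub>R (crossing x (Y u \<omega>) (Y (u + \<epsilon>) \<omega>) / \<epsilon>) = (0::real)"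
    using AE_lborel_singleton[of 0] by eventually_elim (auto split: split_indicator)
  then show ?thesis
    unfolding J_version_def set_lebesgue_integral_def by (rule integral_eq_zero_AE)
qed

lemma J_version_increment:
  assumes "0 \<le> s" "s \<le> t"
  shows "J_version \<epsilon> t \<omega> = J_version \<epsilon> s \<omega> + (LINT u:{s..t}|lborel. crossing x (Y u \<omega>) (Y (u + \<epsilon>) \<omega>) / \<epsilon>)"
  unfolding J_version_def by (rule set_integral_split_at[OF assms J_version_integrable])

lemma J_version_mono:
  assumes "0 \<le> s" "s \<le> t" "0 < \<epsilon>"
  shows "J_version \<epsilon> s \<omega> \<le> J_version \<epsilon> t \<omega>"
proof -
  have "0 \<le> (LINT u:{s..t}|lborel. crossing x (Y u \<omega>) (Y (u + \<epsilon>) \<omega>) / \<epsilon>)"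
    unfolding set_lebesgue_integral_def using assms(3)
    by (intro Bochner_Integration.integral_nonneg) (auto simp: crossing_nonneg split: split_indicator)
  then show ?thesis using J_version_increment[OF assms(1,2), of \<epsilon> \<omega>] by simp
qed

lemma J_version_continuous: "continuous_on {0..T} (\<lambda>t. J_version \<epsilon> t \<omega>)"
proof -
  have "continuous_on {0..T} (\<lambda>t. integral {0..t} (\<lambda>u. crossing x (Y u \<omega>) (Y (u + \<epsilon>) \<omega>) / \<epsilon>))"
    by (intro indefinite_integral_continuous_1 set_borel_integral_eq_integral J_version_integrable)
  then show ?thesis
    unfolding J_version_def set_borel_integral_eq_integral(2)[OF J_version_integrable] .
qed

lemma local_time_limit:
  assumes "regular \<omega>" "0 \<le> t" "\<And>n. 0 < \<eta> n" "\<eta> \<longlonglongrightarrow> 0"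
  shows "(\<lambda>n. LINT u:{0..t}|lborel. window (\<eta> n) x (Y u \<omega>)) \<longlonglongrightarrow> L t x \<omega>"
  using assms by (intro window_occupation_tendsto Y_continuous) (auto simp: regular_def)

lemma local_time_increment_limit:
  assumes \<omega>: "regular \<omega>" and st: "0 \<le> s" "s \<le> t" and \<eta>: "\<And>n. 0 < \<eta> n" "\<eta> \<longlonglongrightarrow> 0"
  shows "(\<lambda>n. LINT u:{s..t}|lborel. window (\<eta> n) x (Y u \<omega>)) \<longlonglongrightarrow> L t x \<omega> - L s x \<omega>"
proof -
  have "(\<lambda>n. (LINT u:{0..t}|lborel. window (\<eta> n) x (Y u \<omega>)) - (LINT u:{0..s}|lborel. window (\<eta> n) x (Y u \<omega>)))
    \<longlonglongrightarrow> L t x \<omega> - L s x \<omega>"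
    using st by (intro tendsto_diff local_time_limit \<omega> \<eta>) auto
  then show ?thesis
    by (simp add: set_integral_split_at[OF st window_path_integrable[OF Y_continuous \<eta>(1)]])
qed

lemma discrepancy_increment_limit:
  assumes \<omega>: "regular \<omega>" and st: "0 \<le> s" "s \<le> t" and \<eta>: "\<And>n. 0 < \<eta> n" "\<eta> \<longlonglongrightarrow> 0"
  shows "(\<lambda>n. LINT u:{s..t}|lborel. discrepancy \<epsilon> (\<eta> n) x (Y u \<omega>) (Y (u + \<epsilon>) \<omega>))
    \<longlonglongrightarrow> (J_version \<epsilon> t \<omega> - L t x \<omega>) - (J_version \<epsilon> s \<omega> - L s x \<omega>)"
proof -
  have "(\<lambda>n. (J_version \<epsilon> t \<omega> - J_version \<epsilon> s \<omega>) - (LINT u:{s..t}|lborel. window (\<eta> n) x (Y u \<omega>)))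
    \<longlonglongrightarrow> (J_version \<epsilon> t \<omega> - J_version \<epsilon> s \<omega>) - (L t x \<omega> - L s x \<omega>)"
    by (intro tendsto_diff tendsto_const local_time_increment_limit assms)
  moreover have "(LINT u:{s..t}|lborel. discrepancy \<epsilon> (\<eta> n) x (Y u \<omega>) (Y (u + \<epsilon>) \<omega>))
    = (J_version \<epsilon> t \<omega> - J_version \<epsilon> s \<omega>) - (LINT u:{s..t}|lborel. window (\<eta> n) x (Y u \<omega>))" for n
    unfolding discrepancy_def
    using set_integral_diff(2)[OF J_version_integrable window_path_integrable[OF Y_continuous \<eta>(1)]]
    by (simp add: J_version_increment[OF st])
  moreover have "(J_version \<epsilon> t \<omega> - J_version \<epsilon> s \<omega>) - (L t x \<omega> - L s x \<omega>) = (J_version \<epsilon> t \<omega> - L t x \<omega>) - (J_version \<epsilon> s \<omega> - L s x \<omega>)"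
    by simp
  ultimately show ?thesis by (simp only:)
qed

text \<open>Monotonicity in time is inherited from the approximating occupation integrals.\<close>

lemma local_time_mono:
  assumes \<omega>: "regular \<omega>" and st: "0 \<le> s" "s \<le> t"
  shows "L s x \<omega> \<le> L t x \<omega>"
proof -
  have lim: "(\<lambda>n. LINT u:{s..t}|lborel. window (inverse (real (Suc n))) x (Y u \<omega>)) \<longlonglongrightarrow> L t x \<omega> - L s x \<omega>"
    by (rule local_time_increment_limit[OF \<omega> st]) (simp, rule LIMSEQ_inverse_real_of_nat)
  have "0 \<le> (LINT u:{s..t}|lborel. window (inverse (real (Suc n))) x (Y u \<omega>))" for n
    unfolding set_lebesgue_integral_def
    by (intro Bochner_Integration.integral_nonneg) (auto intro: window_nonneg split: split_indicator)
  then have "0 \<le> L t x \<omega> - L s x \<omega>"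
    by (intro LIMSEQ_le_const[OF lim]) auto
  then show ?thesis by simp
qed

lemma local_time_0:
  assumes \<omega>: "regular \<omega>" shows "L 0 x \<omega> = 0"
proof -
  have "(\<lambda>n. LINT u:{0..0}|lborel. window (inverse (real (Suc n))) x (Y u \<omega>)) \<longlonglongrightarrow> L 0 x \<omega>"
    by (rule local_time_limit[OF \<omega> order_refl _ LIMSEQ_inverse_real_of_nat]) simp
  moreover have "(LINT u:{0..0}|lborel. window (inverse (real (Suc n))) x (Y u \<omega>)) = 0" for n
  proof -
    have "AE u in lborel. indicator {0..0} u *\<^sub>R window (inverse (real (Suc n))) x (Y u \<omega>) = (0::real)"
      using AE_lborel_singleton[of 0] by eventually_elim (auto split: split_indicator)
    then show ?thesis unfolding set_lebesgue_integral_def by (rule integral_eq_zero_AE)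
  qed
  ultimately have "(\<lambda>n::nat. 0) \<longlonglongrightarrow> L 0 x \<omega>" by simp
  then show ?thesis by (simp add: LIMSEQ_const_iff)
qed

text \<open>The widths \<open>\<surd>\<epsilon>/(n + 1)\<close> tend to \<open>0\<close> and stay below \<open>\<surd>\<epsilon>\<close>, where the bound for the integrated discrepancy
does not depend on the width.\<close>

lemma second_moment_error_increment:
  assumes st: "0 \<le> s" "s \<le> t" and \<epsilon>: "0 < \<epsilon>" and \<gamma>: "0 < \<gamma>" "\<gamma> < 1/2"
  shows "(\<integral>\<^sup>+\<omega>. ennreal (((J_version \<epsilon> t \<omega> - L t x \<omega>) - (J_version \<epsilon> s \<omega> - L s x \<omega>))\<^sup>2) \<partial>M)
    \<le> ennreal (96 / (1/2 - \<gamma>) * \<epsilon> powr \<gamma> * (t - s) powr (1/2 - \<gamma>) * (sqrt t - sqrt s))"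
proof (rule second_moment_limit)
  define \<eta> where "\<eta> n = sqrt \<epsilon> * inverse (real (Suc n))" for n
  have \<eta>: "0 < \<eta> n" "\<eta> n \<le> sqrt \<epsilon>" for n
    using \<epsilon> by (auto simp: \<eta>_def field_simps)
  have lim: "\<eta> \<longlonglongrightarrow> 0"
    unfolding \<eta>_def using tendsto_mult_right_zero[OF LIMSEQ_inverse_real_of_nat] by auto
  show "(\<lambda>\<omega>. LINT u:{s..t}|lborel. discrepancy \<epsilon> (\<eta> n) x (Y u \<omega>) (Y (u + \<epsilon>) \<omega>)) \<in> borel_measurable M" for n
    unfolding set_lebesgue_integral_def by measurable
  show "AE \<omega> in M. (\<lambda>n. LINT u:{s..t}|lborel. discrepancy \<epsilon> (\<eta> n) x (Y u \<omega>) (Y (u + \<epsilon>) \<omega>))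
    \<longlonglongrightarrow> (J_version \<epsilon> t \<omega> - L t x \<omega>) - (J_version \<epsilon> s \<omega> - L s x \<omega>)"
    using AE_regular by eventually_elim (intro discrepancy_increment_limit st \<eta> lim)
  show "(\<integral>\<^sup>+\<omega>. ennreal ((LINT u:{s..t}|lborel. discrepancy \<epsilon> (\<eta> n) x (Y u \<omega>) (Y (u + \<epsilon>) \<omega>))\<^sup>2) \<partial>M)
    \<le> ennreal (96 / (1/2 - \<gamma>) * \<epsilon> powr \<gamma> * (t - s) powr (1/2 - \<gamma>) * (sqrt t - sqrt s))" for n
    by (rule second_moment_discrepancy_integral[OF st \<epsilon> \<eta> \<gamma>])
qed

lemma second_moment_local_time_increment:
  assumes st: "0 \<le> s" "s \<le> t"
  shows "(\<integral>\<^sup>+\<omega>. ennreal ((L t x \<omega> - L s x \<omega>)\<^sup>2) \<partial>M) \<le> ennreal (16 * sqrt (t - s) * (sqrt t - sqrt s))"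
proof (rule second_moment_limit)
  show "(\<lambda>\<omega>. LINT u:{s..t}|lborel. window (inverse (real (Suc n))) x (Y u \<omega>)) \<in> borel_measurable M" for n
    unfolding set_lebesgue_integral_def by measurable
  show "AE \<omega> in M. (\<lambda>n. LINT u:{s..t}|lborel. window (inverse (real (Suc n))) x (Y u \<omega>)) \<longlonglongrightarrow> L t x \<omega> - L s x \<omega>"
    using AE_regular by eventually_elim (rule local_time_increment_limit[OF _ st _ LIMSEQ_inverse_real_of_nat]; simp)
  show "(\<integral>\<^sup>+\<omega>. ennreal ((LINT u:{s..t}|lborel. window (inverse (real (Suc n))) x (Y u \<omega>))\<^sup>2) \<partial>M)
    \<le> ennreal (16 * sqrt (t - s) * (sqrt t - sqrt s))" for n
    by (rule second_moment_window_integral[OF st]) simp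
qed

end

section \<open>Dyadic chaining for differences of monotone functions\<close>

definition dyadic_variation :: "(real \<Rightarrow> real) \<Rightarrow> real \<Rightarrow> nat \<Rightarrow> real" where
  "dyadic_variation D T j = (\<Sum>i<2^j. (D (real (Suc i) * T / 2^j) - D (real i * T / 2^j))\<^sup>2)"

lemma dyadic_variation_nonneg: "0 \<le> dyadic_variation D T j"
  unfolding dyadic_variation_def by (intro sum_nonneg) simp

lemma dyadic_increment_le:
  assumes "i < 2^j"
  shows "\<bar>D (real (Suc i) * T / 2^j) - D (real i * T / 2^j)\<bar> \<le> sqrt (dyadic_variation D T j)"
proof -
  have "(D (real (Suc i) * T / 2^j) - D (real i * T / 2^j))\<^sup>2 \<le> dyadic_variation D T j"
    unfolding dyadic_variation_def
    using assms by (intro member_le_sum[where f = "\<lambda>i. (D (real (Suc i) * T / 2^j) - D (real i * T / 2^j))\<^sup>2"]) auto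
  then show ?thesis by (intro real_le_rsqrt) (simp del: of_nat_Suc)
qed

text \<open>A point of level \<open>m + 1\<close> is either a point of level \<open>m\<close> or the right neighbour of one, so each level
contributes at most one increment.\<close>

lemma dyadic_chaining:
  assumes D0: "D 0 = 0" and "i \<le> 2^m"
  shows "\<bar>D (real i * T / 2^m)\<bar> \<le> (\<Sum>j\<le>m. sqrt (dyadic_variation D T j))"
  using \<open>i \<le> 2^m\<close>
proof (induction m arbitrary: i)
  case 0
  then consider "i = 0" | "i = 1" by force
  then show ?case
  proof cases
    case 1
    then show ?thesis by (simp add: D0 dyadic_variation_nonneg)
  next
    case 2
    then show ?thesis using dyadic_increment_le[of 0 0 D T] by (simp add: D0)
  qed
next
  case (Suc m)
  have double: "real (2 * k) * T / 2 ^ Suc m = real k * T / 2 ^ m" for k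
    by simp
  show ?case
  proof (cases "even i")
    case True
    then obtain k where k: "i = 2 * k" by (elim evenE)
    have "\<bar>D (real k * T / 2^m)\<bar> \<le> (\<Sum>j\<le>m. sqrt (dyadic_variation D T j))"
      using Suc.prems k by (intro Suc.IH) simp
    also have "\<dots> \<le> (\<Sum>j\<le>Suc m. sqrt (dyadic_variation D T j))"
      by (simp add: dyadic_variation_nonneg)
    finally show ?thesis unfolding k double .
  next
    case False
    then obtain k where k: "i = Suc (2 * k)" by (auto elim: oddE)
    have "2 * k < 2 ^ Suc m" using Suc.prems k by simp
    then have "\<bar>D (real i * T / 2 ^ Suc m) - D (real k * T / 2 ^ m)\<bar> \<le> sqrt (dyadic_variation D T (Suc m))"
      using dyadic_increment_le[of "2 * k" "Suc m" D T] unfolding k double by simp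
    moreover have "\<bar>D (real k * T / 2^m)\<bar> \<le> (\<Sum>j\<le>m. sqrt (dyadic_variation D T j))"
      using \<open>2 * k < 2 ^ Suc m\<close> by (intro Suc.IH) simp
    ultimately show ?thesis by simp
  qed
qed

text \<open>Between two neighbouring grid points \<open>a \<le> t \<le> b\<close> monotonicity gives
\<open>A a - l b \<le> A t - l t \<le> A b - l a\<close>, so the difference \<open>A - l\<close> at \<open>t\<close> is within \<open>l b - l a\<close> of its value at \<open>a\<close> or
at \<open>b\<close>. Squaring the chaining bound with the Cauchy-Schwarz inequality costs the factor \<open>n + 1\<close>.\<close>

lemma monotone_difference_square_le:
  assumes T: "0 < T" and t: "0 \<le> t" "t \<le> T" and zero: "A 0 = 0" "l 0 = 0"
    and A: "\<And>s t. 0 \<le> s \<Longrightarrow> s \<le> t \<Longrightarrow> A s \<le> A t"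
    and l: "\<And>s t. 0 \<le> s \<Longrightarrow> s \<le> t \<Longrightarrow> l s \<le> l t"
  shows "(A t - l t)\<^sup>2 \<le> 2 * real (Suc n) * (\<Sum>j\<le>n. dyadic_variation (\<lambda>t. A t - l t) T j)
    + 2 * dyadic_variation l T n"
proof -
  define D where "D t = A t - l t" for t
  define V where "V = (\<Sum>j\<le>n. sqrt (dyadic_variation D T j))"
  define W where "W = sqrt (dyadic_variation l T n)"
  obtain k where k: "k < 2^n" "real k * T / 2^n \<le> t" "t \<le> real (Suc k) * T / 2^n"
  proof (cases "t = T")
    case True
    have "(1::nat) \<le> 2^n" by simp
    then have "real (Suc (2^n - 1)) = 2^n" by (simp add: of_nat_diff)
    moreover have "real (2^n - 1) \<le> 2^n" by (simp add: of_nat_diff)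
    then have "real (2^n - 1) * T \<le> 2^n * T" using T by (intro mult_right_mono) auto
    ultimately show ?thesis
      using True T by (intro that[of "2^n - 1"]) (auto simp: divide_le_eq mult.commute)
  next
    case False
    define r where "r = t * 2^n / T"
    have r: "0 \<le> r" "r < 2^n" using t T False by (auto simp: r_def divide_less_eq)
    have "real (nat \<lfloor>r\<rfloor>) \<le> r" "r \<le> real (Suc (nat \<lfloor>r\<rfloor>))" using r by linarith+
    moreover have "nat \<lfloor>r\<rfloor> < 2^n"
      using r by (simp add: nat_less_iff floor_less_iff)
    moreover have "t = r * T / 2^n" using T by (simp add: r_def)
    ultimately show ?thesis
      using T by (intro that[of "nat \<lfloor>r\<rfloor>"]) (auto intro!: divide_right_mono mult_right_mono simp del: of_nat_Suc)
  qed
  define a where "a = real k * T / 2^n"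
  define b where "b = real (Suc k) * T / 2^n"
  have ab: "0 \<le> a" "a \<le> t" "t \<le> b" using k T by (auto simp: a_def b_def)
  have Da: "\<bar>D a\<bar> \<le> V" and Db: "\<bar>D b\<bar> \<le> V"
    unfolding a_def b_def V_def using k(1) zero by (intro dyadic_chaining; simp add: D_def)+
  have lW: "\<bar>l b - l a\<bar> \<le> W"
    unfolding a_def b_def W_def using k(1) by (rule dyadic_increment_le)
  have "A a \<le> A t" "A t \<le> A b" "l a \<le> l t" "l t \<le> l b"
    using ab A l by auto
  then have "\<bar>D t\<bar> \<le> V + W"
    using Da Db lW unfolding D_def by linarith
  then have "(D t)\<^sup>2 \<le> (V + W)\<^sup>2"
    by (metis abs_ge_zero power2_abs power_mono)
  also have "\<dots> \<le> 2 * V\<^sup>2 + 2 * W\<^sup>2"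
    using zero_le_power2[of "V - W"] by (simp add: power2_sum power2_diff)
  also have "V\<^sup>2 \<le> (\<Sum>j\<le>n. (sqrt (dyadic_variation D T j))\<^sup>2) * real (card {..n})"
    unfolding V_def by (rule sum_squared_le_sum_of_squares)
  also have "\<dots> = real (Suc n) * (\<Sum>j\<le>n. dyadic_variation D T j)"
    by (simp add: dyadic_variation_nonneg mult.commute)
  also have "W\<^sup>2 = dyadic_variation l T n"
    by (simp add: W_def dyadic_variation_nonneg)
  finally show ?thesis
    by (simp add: D_def[abs_def] mult.assoc del: of_nat_Suc)
qed

text \<open>The bounds for the increments telescope, so the total does not grow with the number of intervals.\<close>

lemma nn_integral_dyadic_variation_le:
  fixes D :: "real \<Rightarrow> 'a \<Rightarrow> real"
  assumes [measurable]: "\<And>t. 0 \<le> t \<Longrightarrow> D t \<in> borel_measurable M" and T: "0 < T" and c: "0 \<le> c"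
    and incr: "\<And>s t. 0 \<le> s \<Longrightarrow> s \<le> t \<Longrightarrow> t - s = T / 2^j \<Longrightarrow>
      (\<integral>\<^sup>+\<omega>. ennreal ((D t \<omega> - D s \<omega>)\<^sup>2) \<partial>M) \<le> ennreal (c * (sqrt t - sqrt s))"
  shows "(\<integral>\<^sup>+\<omega>. ennreal (dyadic_variation (\<lambda>t. D t \<omega>) T j) \<partial>M) \<le> ennreal (c * sqrt T)"
proof -
  define \<tau> where "\<tau> i = real i * T / 2^j" for i
  have \<tau>: "0 \<le> \<tau> i" "\<tau> i \<le> \<tau> (Suc i)" "\<tau> (Suc i) - \<tau> i = T / 2^j" for i
    using T by (auto simp: \<tau>_def field_simps)
  have "(\<integral>\<^sup>+\<omega>. ennreal (dyadic_variation (\<lambda>t. D t \<omega>) T j) \<partial>M)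
    = (\<integral>\<^sup>+\<omega>. (\<Sum>i<2^j. ennreal ((D (\<tau> (Suc i)) \<omega> - D (\<tau> i) \<omega>)\<^sup>2)) \<partial>M)"
    unfolding dyadic_variation_def \<tau>_def by (simp add: sum_ennreal)
  also have "\<dots> = (\<Sum>i<2^j. \<integral>\<^sup>+\<omega>. ennreal ((D (\<tau> (Suc i)) \<omega> - D (\<tau> i) \<omega>)\<^sup>2) \<partial>M)"
    using \<tau>(1) by (intro nn_integral_sum) measurable
  also have "\<dots> \<le> (\<Sum>i<2^j. ennreal (c * (sqrt (\<tau> (Suc i)) - sqrt (\<tau> i))))"
    by (intro sum_mono incr \<tau>)
  also have "\<dots> = ennreal (\<Sum>i<2^j. c * (sqrt (\<tau> (Suc i)) - sqrt (\<tau> i)))"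
    using c \<tau>(2) by (intro sum_ennreal) simp
  also have "(\<Sum>i<2^j. c * (sqrt (\<tau> (Suc i)) - sqrt (\<tau> i))) = c * (sqrt (\<tau> (2^j)) - sqrt (\<tau> 0))"
    using sum_lessThan_telescope[of "\<lambda>i. sqrt (\<tau> i)" "2^j"] by (simp add: sum_distrib_left[symmetric])
  also have "\<dots> = c * sqrt T" by (simp add: \<tau>_def)
  finally show ?thesis .
qed

text \<open>The number of levels grows like \<open>log (1/\<epsilon>)\<close>, hence more slowly than any negative power of \<open>\<epsilon>\<close>.\<close>

lemma dyadic_mesh_exists:
  fixes T a :: real
  assumes T: "0 < T" and a: "0 < a"
  shows "\<exists>C\<ge>0. \<forall>\<epsilon>\<in>{0<..1}. \<exists>n. T / 2^n \<le> \<epsilon> \<and> real (Suc n) \<le> C * \<epsilon> powr - a"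
proof (rule exI, intro conjI ballI)
  show "0 \<le> (T + 1) powr a * (1 / (a * ln 2) + 2)" using a by simp
  fix \<epsilon> :: real assume \<epsilon>: "\<epsilon> \<in> {0<..1}"
  define y where "y = (T + 1) / \<epsilon>"
  have y: "1 \<le> y" "T / \<epsilon> \<le> y" using T \<epsilon> by (auto simp: y_def field_simps)
  define n where "n = nat \<lceil>log 2 y\<rceil>"
  have log0: "0 \<le> log 2 y" using y by simp
  have n: "log 2 y \<le> real n" "real n \<le> log 2 y + 1"
    using log0 by (auto simp: n_def)
  have "y = 2 powr log 2 y" using y by simp
  also have "\<dots> \<le> 2 powr real n" using n by (intro powr_mono) auto
  also have "\<dots> = 2^n" by (simp add: powr_realpow)
  finally have "T / \<epsilon> \<le> 2^n" using y by linarith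
  then have "T / 2^n \<le> \<epsilon>" using \<epsilon> by (simp add: field_simps)
  moreover have "real (Suc n) \<le> (T + 1) powr a * (1 / (a * ln 2) + 2) * \<epsilon> powr - a"
  proof -
    have "1 \<le> y powr a" using y a by (simp add: ge_one_powr_ge_zero)
    moreover have "log 2 y \<le> y powr a / (a * ln 2)"
      using divide_right_mono[OF ln_powr_bound[OF y(1) a], of "ln 2"] by (simp add: log_def)
    ultimately have "real (Suc n) \<le> y powr a * (1 / (a * ln 2) + 2)"
      using n(2) by (simp add: distrib_left)
    also have "y powr a = (T + 1) powr a * \<epsilon> powr - a"
      unfolding y_def using T \<epsilon> by (subst powr_divide) (auto simp: powr_minus_divide)
    finally show ?thesis by (simp add: mult_ac)
  qed
  ultimately show "\<exists>n. T / 2^n \<le> \<epsilon> \<and> real (Suc n) \<le> (T + 1) powr a * (1 / (a * ln 2) + 2) * \<epsilon> powr - a"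
    by blast
qed

section \<open>The supremum over a time interval\<close>

text \<open>For the supremum over an uncountable set of times, which agrees with a countable supremum only on
an almost sure event.\<close>

lemma measurable_completion_AE_eq:
  assumes g: "g \<in> M \<rightarrow>\<^sub>M N" and eq: "AE w in M. f w = g w" and f: "\<And>w. w \<in> space M \<Longrightarrow> f w \<in> space N"
  shows "f \<in> completion M \<rightarrow>\<^sub>M N"
proof (rule measurableI)
  fix A assume A: "A \<in> sets N"
  show "f -` A \<inter> space (completion M) \<in> sets (completion M)"
  proof (rule completion.in_sets_AE)
    show "g -` A \<inter> space M \<in> sets (completion M)"
      using measurable_sets[OF g A] by simp
    show "AE w in completion M. w \<in> g -` A \<inter> space M \<longleftrightarrow> w \<in> f -` A \<inter> space (completion M)"
      using AE_completion[OF eq] by eventually_elim simp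
  qed simp
qed (use f in simp)

lemma SUP_dense_eq:
  fixes f :: "real \<Rightarrow> real"
  assumes cont: "continuous_on I f" and S: "S \<subseteq> I" "I \<subseteq> closure S"
  shows "(SUP t\<in>I. ennreal (f t)) = (SUP t\<in>S. ennreal (f t))"
proof (rule antisym)
  show "(SUP t\<in>I. ennreal (f t)) \<le> (SUP t\<in>S. ennreal (f t))"
  proof (rule SUP_least)
    fix t assume t: "t \<in> I"
    then have "t \<in> closure S" using S(2) by auto
    then obtain q where q: "\<forall>n. q n \<in> S" "q \<longlonglongrightarrow> t"
      unfolding closure_sequential by auto
    have "(\<lambda>n. ennreal (f (q n))) \<longlonglongrightarrow> ennreal (f t)"
      using q S(1) t by (intro tendsto_ennrealI continuous_on_tendsto_compose[OF cont]) (auto intro!: always_eventually)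
    then show "ennreal (f t) \<le> (SUP t\<in>S. ennreal (f t))"
      by (rule LIMSEQ_le_const2) (use q in \<open>auto intro!: SUP_upper\<close>)
  qed
qed (intro SUP_subset_mono S order_refl)

context local_time_setting
begin

text \<open>The random bound for the squared error, simultaneous for all times in \<open>[0, T]\<close>.\<close>

definition majorant :: "real \<Rightarrow> real \<Rightarrow> nat \<Rightarrow> 'a \<Rightarrow> real" where
  "majorant \<epsilon> T n \<omega> = 2 * real (Suc n) * (\<Sum>j\<le>n. dyadic_variation (\<lambda>t. J_version \<epsilon> t \<omega> - L t x \<omega>) T j)
    + 2 * dyadic_variation (\<lambda>t. L t x \<omega>) T n"

lemma dyadic_variation_measurable:
  assumes "\<And>t. 0 \<le> t \<Longrightarrow> D t \<in> borel_measurable M" "0 < T"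
  shows "(\<lambda>\<omega>. dyadic_variation (\<lambda>t. D t \<omega>) T j) \<in> borel_measurable M"
  unfolding dyadic_variation_def
  by (intro borel_measurable_sum borel_measurable_power borel_measurable_diff assms(1)) (use assms(2) in auto)

lemma error_square_le_majorant:
  assumes \<omega>: "regular \<omega>" and "0 < T" "0 < \<epsilon>" "t \<in> {0..T}"
  shows "(J_version \<epsilon> t \<omega> - L t x \<omega>)\<^sup>2 \<le> majorant \<epsilon> T n \<omega>"
  unfolding majorant_def
  using assms by (intro monotone_difference_square_le J_version_0 local_time_0 J_version_mono local_time_mono) auto

lemma majorant_nonneg: "0 \<le> majorant \<epsilon> T n \<omega>"
  unfolding majorant_def
  by (intro add_nonneg_nonneg mult_nonneg_nonneg sum_nonneg dyadic_variation_nonneg) auto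

text \<open>Each of the \<open>n + 1\<close> levels of the error contributes the same bound, since the increment bound
telescopes; the local time contributes the square root of the mesh, from the intervals of the
finest level only.\<close>

lemma nn_integral_majorant_le:
  assumes T: "0 < T" and \<epsilon>: "0 < \<epsilon>" and \<gamma>: "0 < \<gamma>" "\<gamma> < 1/2"
  shows "(\<integral>\<^sup>+\<omega>. ennreal (majorant \<epsilon> T n \<omega>) \<partial>M)
    \<le> ennreal (2 * (real (Suc n))\<^sup>2 * (96 / (1/2 - \<gamma>) * \<epsilon> powr \<gamma> * T powr (1/2 - \<gamma>) * sqrt T)
        + 32 * sqrt (T / 2^n) * sqrt T)"
proof -
  define c where "c = 96 / (1/2 - \<gamma>) * \<epsilon> powr \<gamma> * T powr (1/2 - \<gamma>)"
  have c: "0 \<le> c" using \<gamma> by (simp add: c_def)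
  have DM: "(\<lambda>\<omega>. J_version \<epsilon> t \<omega> - L t x \<omega>) \<in> borel_measurable M" if "0 \<le> t" for t
    using that by measurable
  have [measurable]: "(\<lambda>\<omega>. dyadic_variation (\<lambda>t. J_version \<epsilon> t \<omega> - L t x \<omega>) T j) \<in> borel_measurable M"
     "(\<lambda>\<omega>. dyadic_variation (\<lambda>t. L t x \<omega>) T j) \<in> borel_measurable M" for j
    using T by (auto intro!: dyadic_variation_measurable[of "\<lambda>t \<omega>. J_version \<epsilon> t \<omega> - L t x \<omega>"]
      dyadic_variation_measurable[of "\<lambda>t \<omega>. L t x \<omega>"])
  have D: "(\<integral>\<^sup>+\<omega>. ennreal (dyadic_variation (\<lambda>t. J_version \<epsilon> t \<omega> - L t x \<omega>) T j) \<partial>M) \<le> ennreal (c * sqrt T)" for j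
  proof (rule nn_integral_dyadic_variation_le[OF DM T c])
    fix s t :: real assume st: "0 \<le> s" "s \<le> t" "t - s = T / 2^j"
    have "T / 2^j \<le> T / 1" using T by (intro divide_left_mono) auto
    then have "(t - s) powr (1/2 - \<gamma>) \<le> T powr (1/2 - \<gamma>)"
      using st \<gamma> by (intro powr_mono2) auto
    then have "96 / (1/2 - \<gamma>) * \<epsilon> powr \<gamma> * (t - s) powr (1/2 - \<gamma>) * (sqrt t - sqrt s) \<le> c * (sqrt t - sqrt s)"
      unfolding c_def using st \<gamma> by (intro mult_right_mono mult_left_mono) auto
    then show "(\<integral>\<^sup>+\<omega>. ennreal (((J_version \<epsilon> t \<omega> - L t x \<omega>) - (J_version \<epsilon> s \<omega> - L s x \<omega>))\<^sup>2) \<partial>M) \<le> ennreal (c * (sqrt t - sqrt s))"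
      by (intro order_trans[OF second_moment_error_increment[OF st(1,2) \<epsilon> \<gamma>]] ennreal_leI)
  qed simp
  have l: "(\<integral>\<^sup>+\<omega>. ennreal (dyadic_variation (\<lambda>t. L t x \<omega>) T n) \<partial>M) \<le> ennreal (16 * sqrt (T / 2^n) * sqrt T)"
    using second_moment_local_time_increment T
    by (intro nn_integral_dyadic_variation_le L_measurable) force+
  have "(\<integral>\<^sup>+\<omega>. ennreal (majorant \<epsilon> T n \<omega>) \<partial>M)
    = (\<integral>\<^sup>+\<omega>. ennreal (2 * real (Suc n)) * (\<Sum>j\<le>n. ennreal (dyadic_variation (\<lambda>t. J_version \<epsilon> t \<omega> - L t x \<omega>) T j))
        + ennreal 2 * ennreal (dyadic_variation (\<lambda>t. L t x \<omega>) T n) \<partial>M)"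
  proof (rule nn_integral_cong)
    fix \<omega>
    define S where "S = (\<Sum>j\<le>n. dyadic_variation (\<lambda>t. J_version \<epsilon> t \<omega> - L t x \<omega>) T j)"
    have "0 \<le> S" unfolding S_def by (intro sum_nonneg dyadic_variation_nonneg)
    moreover have "(\<Sum>j\<le>n. ennreal (dyadic_variation (\<lambda>t. J_version \<epsilon> t \<omega> - L t x \<omega>) T j)) = ennreal S"
      unfolding S_def by (intro sum_ennreal dyadic_variation_nonneg)
    ultimately show "ennreal (majorant \<epsilon> T n \<omega>)
      = ennreal (2 * real (Suc n)) * (\<Sum>j\<le>n. ennreal (dyadic_variation (\<lambda>t. J_version \<epsilon> t \<omega> - L t x \<omega>) T j))
        + ennreal 2 * ennreal (dyadic_variation (\<lambda>t. L t x \<omega>) T n)"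
      unfolding majorant_def S_def[symmetric]
      by (simp only: ennreal_plus ennreal_mult mult_nonneg_nonneg dyadic_variation_nonneg of_nat_0_le_iff
        zero_le_numeral)
  qed
  also have "\<dots> = ennreal (2 * real (Suc n)) * (\<Sum>j\<le>n. \<integral>\<^sup>+\<omega>. ennreal (dyadic_variation (\<lambda>t. J_version \<epsilon> t \<omega> - L t x \<omega>) T j) \<partial>M)
        + ennreal 2 * (\<integral>\<^sup>+\<omega>. ennreal (dyadic_variation (\<lambda>t. L t x \<omega>) T n) \<partial>M)"
    by (simp add: nn_integral_add nn_integral_cmult nn_integral_sum del: of_nat_Suc)
  also have "\<dots> \<le> ennreal (2 * real (Suc n)) * (\<Sum>j\<le>n. ennreal (c * sqrt T))
        + ennreal 2 * ennreal (16 * sqrt (T / 2^n) * sqrt T)"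
    by (intro add_mono mult_left_mono sum_mono D l) auto
  also have "(\<Sum>j\<le>n. ennreal (c * sqrt T)) = ennreal (\<Sum>j\<le>n. c * sqrt T)"
    using c T by (intro sum_ennreal) auto
  also have "ennreal (2 * real (Suc n)) * ennreal (\<Sum>j\<le>n. c * sqrt T) + ennreal 2 * ennreal (16 * sqrt (T / 2^n) * sqrt T)
    = ennreal (2 * real (Suc n) * (\<Sum>j\<le>n. c * sqrt T) + 2 * (16 * sqrt (T / 2^n) * sqrt T))"
  proof -
    have combine: "ennreal a * ennreal b + ennreal a' * ennreal b' = ennreal (a * b + a' * b')"
      if "0 \<le> a" "0 \<le> b" "0 \<le> a'" "0 \<le> b'" for a b a' b'
      using that by (simp add: ennreal_mult)
    show ?thesis by (rule combine) (use c T in \<open>auto intro!: sum_nonneg\<close>)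
  qed
  also have "2 * real (Suc n) * (\<Sum>j\<le>n. c * sqrt T) + 2 * (16 * sqrt (T / 2^n) * sqrt T)
    = 2 * (real (Suc n))\<^sup>2 * (c * sqrt T) + 32 * sqrt (T / 2^n) * sqrt T"
    by (simp add: power2_eq_square)
  finally show ?thesis by (simp add: c_def)
qed

end

theorem theorem1p6:
  fixes M :: "'a measure" and X :: "real \<Rightarrow> 'a \<Rightarrow> real" and L :: "real \<Rightarrow> real \<Rightarrow> 'a \<Rightarrow> real"
    and T x \<delta> :: real
  assumes "std_brownian_motion M X"
    and "local_time_family M X L"
    and "0 < T"
    and "0 < \<delta>" and "\<delta> < 1/2"
  shows "\<exists>C::real. \<forall>\<epsilon>\<in>{0<..1}.
    L2_norm M (\<lambda>\<omega>. SUP t\<in>{0..T}. ennreal \<bar>J X \<epsilon> t x \<omega> - L t x \<omega>\<bar>) \<le> ennreal (C * \<epsilon> powr (\<delta> / 2))"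
proof -
  interpret std_brownian_motion M X by fact
  obtain Y where "continuous_version M X Y" using continuous_version_exists by blast
  then interpret local_time_setting M X Y L x
    using assms(2) by (intro local_time_setting.intro local_time_setting_axioms.intro)
  \<comment> \<open>halfway between \<open>\<delta>\<close> and \<open>1/2\<close>; the gap \<open>\<gamma> - \<delta>\<close> pays for the squared number of levels\<close>
  define \<gamma> where "\<gamma> = 1/4 + \<delta> / 2"
  have \<gamma>: "0 < \<gamma>" "\<gamma> < 1/2" and gap: "0 < (\<gamma> - \<delta>) / 2" using assms by (auto simp: \<gamma>_def)
  obtain C1 where C1: "0 \<le> C1"
    "\<And>\<epsilon>. \<epsilon> \<in> {0<..1} \<Longrightarrow> \<exists>n. T / 2^n \<le> \<epsilon> \<and> real (Suc n) \<le> C1 * \<epsilon> powr - ((\<gamma> - \<delta>) / 2)"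
    using dyadic_mesh_exists[OF \<open>0 < T\<close> gap] by blast
  define C0 where "C0 = 2 * C1\<^sup>2 * (96 / (1/2 - \<gamma>) * T powr (1/2 - \<gamma>) * sqrt T) + 32 * sqrt T"
  have C0: "0 \<le> C0" using \<gamma> \<open>0 < T\<close> by (simp add: C0_def)
  show ?thesis
  proof (intro exI[of _ "sqrt C0"] ballI)
    fix \<epsilon> :: real assume \<epsilon>01: "\<epsilon> \<in> {0<..1}"
    then have \<epsilon>: "0 < \<epsilon>" "\<epsilon> \<le> 1" by auto
    define f where "f \<omega> = (SUP t\<in>{0..T}. ennreal \<bar>J X \<epsilon> t x \<omega> - L t x \<omega>\<bar>)" for \<omega>
    obtain n where n: "T / 2^n \<le> \<epsilon>" "real (Suc n) \<le> C1 * \<epsilon> powr - ((\<gamma> - \<delta>) / 2)"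
      using C1(2)[OF \<epsilon>01] by blast
    have f_eq: "f \<omega> = (SUP t\<in>{0..T}. ennreal \<bar>J_version \<epsilon> t \<omega> - L t x \<omega>\<bar>)" if "regular \<omega>" for \<omega>
      unfolding f_def using that \<epsilon> by (intro SUP_cong refl) (simp add: J_eq_J_version)
    have meas: "f \<in> borel_measurable (completion M)"
    proof -
      \<comment> \<open>a countable set of times suffices for the supremum, by continuity of the paths\<close>
      obtain S where S: "countable S" "S \<subseteq> {0..T}" "{0..T} \<subseteq> closure S"
        by (rule separable)
      define g where "g \<omega> = (SUP t\<in>S. ennreal \<bar>J_version \<epsilon> t \<omega> - L t x \<omega>\<bar>)" for \<omega>
      have "g \<in> borel_measurable M"
        unfolding g_def
      proof (rule borel_measurable_SUP[OF S(1)])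
        fix t assume "t \<in> S"
        then have "0 \<le> t" using S(2) by auto
        then show "(\<lambda>\<omega>. ennreal \<bar>J_version \<epsilon> t \<omega> - L t x \<omega>\<bar>) \<in> borel_measurable M" by measurable
      qed
      moreover have "AE \<omega> in M. f \<omega> = g \<omega>"
        using AE_regular
      proof eventually_elim
        case (elim \<omega>)
        have "continuous_on {0..T} (\<lambda>t. \<bar>J_version \<epsilon> t \<omega> - L t x \<omega>\<bar>)"
          using elim unfolding regular_def
          by (intro continuous_intros J_version_continuous) (auto intro: continuous_on_subset)
        then show ?case
          unfolding f_eq[OF elim] g_def by (rule SUP_dense_eq[OF _ S(2,3)])
      qed
      ultimately show ?thesis by (rule measurable_completion_AE_eq) simp
    qed
    define I where "I = (\<integral>\<^sup>+\<omega>. (f \<omega>)\<^sup>2 \<partial>completion M)"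
    have "I = (\<integral>\<^sup>+\<omega>. (f \<omega>)\<^sup>2 \<partial>M)" unfolding I_def by (rule nn_integral_completion)
    also have "\<dots> \<le> (\<integral>\<^sup>+\<omega>. ennreal (majorant \<epsilon> T n \<omega>) \<partial>M)"
    proof (rule nn_integral_mono_AE)
      show "AE \<omega> in M. (f \<omega>)\<^sup>2 \<le> ennreal (majorant \<epsilon> T n \<omega>)"
        using AE_regular
      proof eventually_elim
        case (elim \<omega>)
        have "f \<omega> \<le> ennreal (sqrt (majorant \<epsilon> T n \<omega>))"
          unfolding f_eq[OF elim]
        proof (intro SUP_least ennreal_leI)
          fix t assume "t \<in> {0..T}"
          then have "(J_version \<epsilon> t \<omega> - L t x \<omega>)\<^sup>2 \<le> majorant \<epsilon> T n \<omega>"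
            by (intro error_square_le_majorant elim \<open>0 < T\<close> \<epsilon>)
          then show "\<bar>J_version \<epsilon> t \<omega> - L t x \<omega>\<bar> \<le> sqrt (majorant \<epsilon> T n \<omega>)"
            by (intro real_le_rsqrt) simp
        qed
        then have "(f \<omega>)\<^sup>2 \<le> (ennreal (sqrt (majorant \<epsilon> T n \<omega>)))\<^sup>2"
          by (intro power_mono) auto
        then show ?case
          using majorant_nonneg by (simp add: ennreal_power)
      qed
    qed
    also have "\<dots> \<le> ennreal (2 * (real (Suc n))\<^sup>2 * (96 / (1/2 - \<gamma>) * \<epsilon> powr \<gamma> * T powr (1/2 - \<gamma>) * sqrt T)
        + 32 * sqrt (T / 2^n) * sqrt T)"
      by (rule nn_integral_majorant_le[OF \<open>0 < T\<close> \<epsilon>(1) \<gamma>])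
    also have "\<dots> \<le> ennreal (C0 * \<epsilon> powr \<delta>)"
    proof (rule ennreal_leI)
      have "(real (Suc n))\<^sup>2 \<le> (C1 * \<epsilon> powr - ((\<gamma> - \<delta>) / 2))\<^sup>2"
        by (intro power_mono n) simp
      also have "\<dots> = C1\<^sup>2 * \<epsilon> powr - (\<gamma> - \<delta>)"
        by (simp add: power_mult_distrib power2_eq_square powr_add[symmetric])
      finally have "(real (Suc n))\<^sup>2 * \<epsilon> powr \<gamma> \<le> C1\<^sup>2 * \<epsilon> powr - (\<gamma> - \<delta>) * \<epsilon> powr \<gamma>"
        by (rule mult_right_mono) simp
      also have "\<dots> = C1\<^sup>2 * \<epsilon> powr \<delta>"
        by (simp add: mult.assoc powr_add[symmetric])
      finally have 1: "2 * (96 / (1/2 - \<gamma>) * T powr (1/2 - \<gamma>) * sqrt T) * ((real (Suc n))\<^sup>2 * \<epsilon> powr \<gamma>)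
        \<le> 2 * (96 / (1/2 - \<gamma>) * T powr (1/2 - \<gamma>) * sqrt T) * (C1\<^sup>2 * \<epsilon> powr \<delta>)"
        using \<gamma> \<open>0 < T\<close> by (intro mult_left_mono) auto
      have "sqrt (T / 2^n) \<le> sqrt \<epsilon>" using n by simp
      also have "\<dots> \<le> \<epsilon> powr \<delta>"
        using \<epsilon> assms powr_mono'[of \<delta> "1/2" \<epsilon>] by (simp add: powr_half_sqrt)
      finally have 2: "32 * sqrt T * sqrt (T / 2^n) \<le> 32 * sqrt T * \<epsilon> powr \<delta>"
        using \<open>0 < T\<close> by (intro mult_left_mono) auto
      show "2 * (real (Suc n))\<^sup>2 * (96 / (1/2 - \<gamma>) * \<epsilon> powr \<gamma> * T powr (1/2 - \<gamma>) * sqrt T)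
        + 32 * sqrt (T / 2^n) * sqrt T \<le> C0 * \<epsilon> powr \<delta>"
        using add_mono[OF 1 2] unfolding C0_def by (simp only: distrib_left distrib_right mult_ac)
    qed
    finally have I: "I \<le> ennreal (C0 * \<epsilon> powr \<delta>)" .
    then have "I < \<infinity>" by (rule le_less_trans) simp
    then have "L2_norm M f = ennreal (sqrt (enn2real I))"
      using meas by (simp add: L2_norm_def I_def)
    also have "\<dots> \<le> ennreal (sqrt (C0 * \<epsilon> powr \<delta>))"
      using I C0 by (intro ennreal_leI real_sqrt_le_mono) (auto intro: enn2real_leI)
    also have "sqrt (C0 * \<epsilon> powr \<delta>) = sqrt C0 * \<epsilon> powr (\<delta> / 2)"
      using \<epsilon> by (simp add: real_sqrt_mult powr_half_sqrt[symmetric] powr_powr)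
    finally show "L2_norm M (\<lambda>\<omega>. SUP t\<in>{0..T}. ennreal \<bar>J X \<epsilon> t x \<omega> - L t x \<omega>\<bar>) \<le> ennreal (sqrt C0 * \<epsilon> powr (\<delta> / 2))"
      unfolding f_def .
  qed
qed

end
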